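(* Let $n\ge 2$, let $c_0,c_1,\ldots,c_n\ge 0$, and let $\Gamma=([n],w)$ be the weighted hypergraph with $w_B=c_{|B|}$ for every $B\subseteq[n]$. Then \[ \min_{\mathrm{triv}\ne\rho\in\mathrm{Irr}(\mathrm{U}(n))}\lambda_{\min}(\Gamma,\rho)=\lambda_{\min}\big(\Gamma,\rho_{(2,0,\ldots,0,-2)}\big)=\sum_{\ell=0}^{n}c_\ell\,\frac{n+1}{\ell+1}\binom{n-2}{\ell-2}, \] with the convention $\binom{a}{b}=0$ when $b<0$ or $a<b$. (In particular the minimum over the infinitely many non-trivial irreducible representations is attained.)
   Context: A weighted hypergraph $\Gamma=([n],w)$ is an assignment of a weight $w_B\ge0$ to every subset $B\subseteq[n]$. For $B\subseteq[n]$, $\mathrm{U}_B\le\mathrm{U}(n)$ denotes the subgroup of unitary matrices that coincide with the identity matrix outside the $|B|\times|B|$ minor with rows and columns in $B$ (so $\mathrm{U}_B\cong\mathrm{U}(|B|)$), and $\mu_B$ is the Haar probability measure on $\mathrm{U}_B$. For a finite-dimensional representation $\rho\colon\mathrm{U}(n)\to\mathrm{GL}_d(\mathbb{C})$, the Laplacian is ${\cal L}(\Gamma,\rho)=\sum_{B\subseteq[n]}w_B\big[I_d-\int_{\mathrm{U}_B}\rho(A)\,d\mu_B(A)\big]$; its spectrum is real, and $\lambda_{\min}(\Gamma,\rho)$ denotes its smallest eigenvalue. $\mathrm{Irr}(\mathrm{U}(n))$ is the set of irreducible representations of $\mathrm{U}(n)$; these are indexed by highest weights, i.e. non-increasing integer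 vectors $\mu=(\mu_1\ge\cdots\ge\mu_n)\in\mathbb{Z}^n$, and $\rho_\mu$ denotes the irreducible representation with highest weight $\mu$; $\mathrm{triv}=\rho_{(0,\ldots,0)}$. For $n=2$, $(2,0,\ldots,0,-2)$ means $(2,-2)$. *)

theory Defs
  imports "HOL-Analysis.Analysis" "HOL-Probability.Probability"
begin

text \<open>Matrices in U(n) are elements of complex^'n^'n, where the finite linearly
ordered type 'n plays the role of [n] = {1,...,n} (with its order).
Representations of dimension d take values in d x d complex matrices, represented
as functions nat => nat => complex that vanish outside {0..<d} x {0..<d}.\<close>

definition unitary_grp :: "(complex^('n::finite)^'n) set" where
  "unitary_grp = {A. \<forall>i j. (\<Sum>k\<in>UNIV. cnj (A$k$i) * A$k$j) = (if i = j then 1 else 0)}"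

definition unitary_sub :: "'n::finite set \<Rightarrow> (complex^'n^'n) set" where
  "unitary_sub B = {A \<in> unitary_grp. \<forall>i j. (i \<notin> B \<or> j \<notin> B) \<longrightarrow> A$i$j = (if i = j then 1 else 0)}"

definition is_haar_prob :: "'n::finite set \<Rightarrow> (complex^'n^'n) measure \<Rightarrow> bool" where
  "is_haar_prob B M \<longleftrightarrow> prob_space M \<and> sets M = sets borel \<and>
     emeasure M (unitary_sub B) = 1 \<and>
     (\<forall>g\<in>unitary_sub B. distr M borel (\<lambda>A. g ** A) = M)"

definition idm :: "nat \<Rightarrow> nat \<Rightarrow> nat \<Rightarrow> complex" where
  "idm d i j = (if i < d \<and> j < d \<and> i = j then 1 else 0)"

definition is_rep :: "nat \<Rightarrow> (complex^('n::finite)^'n \<Rightarrow> nat \<Rightarrow> nat \<Rightarrow> complex) \<Rightarrow> bool" where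
  "is_rep d \<rho> \<longleftrightarrow>
     (\<forall>A\<in>unitary_grp. \<forall>i j. (d \<le> i \<or> d \<le> j) \<longrightarrow> \<rho> A i j = 0) \<and>
     \<rho> (mat 1) = idm d \<and>
     (\<forall>A\<in>unitary_grp. \<forall>B\<in>unitary_grp. \<forall>i<d. \<forall>j<d.
        \<rho> (A ** B) i j = (\<Sum>k<d. \<rho> A i k * \<rho> B k j)) \<and>
     (\<forall>i j. continuous_on unitary_grp (\<lambda>A. \<rho> A i j))"

definition cvecs :: "nat \<Rightarrow> (nat \<Rightarrow> complex) set" where
  "cvecs d = {v. \<forall>k. d \<le> k \<longrightarrow> v k = 0}"

definition mat_app :: "nat \<Rightarrow> (nat \<Rightarrow> nat \<Rightarrow> complex) \<Rightarrow> (nat \<Rightarrow> complex) \<Rightarrow> (nat \<Rightarrow> complex)" where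
  "mat_app d M v = (\<lambda>i. if i < d then (\<Sum>k<d. M i k * v k) else 0)"

definition is_irrep :: "nat \<Rightarrow> (complex^('n::finite)^'n \<Rightarrow> nat \<Rightarrow> nat \<Rightarrow> complex) \<Rightarrow> bool" where
  "is_irrep d \<rho> \<longleftrightarrow> is_rep d \<rho> \<and> 1 \<le> d \<and>
     (\<forall>W. W \<subseteq> cvecs d \<and> (\<lambda>_. 0) \<in> W \<and>
          (\<forall>v\<in>W. \<forall>w\<in>W. (\<lambda>k. v k + w k) \<in> W) \<and>
          (\<forall>a. \<forall>v\<in>W. (\<lambda>k. a * v k) \<in> W) \<and>
          (\<forall>A\<in>unitary_grp. \<forall>v\<in>W. mat_app d (\<rho> A) v \<in> W)
        \<longrightarrow> W = {\<lambda>_. 0} \<or> W = cvecs d)"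

definition is_trivial_rep :: "nat \<Rightarrow> (complex^('n::finite)^'n \<Rightarrow> nat \<Rightarrow> nat \<Rightarrow> complex) \<Rightarrow> bool" where
  "is_trivial_rep d \<rho> \<longleftrightarrow> (\<forall>A\<in>unitary_grp. \<rho> A = idm d)"

definition diagm :: "('n::finite \<Rightarrow> complex) \<Rightarrow> complex^'n^'n" where
  "diagm z = (\<chi> i j. if i = j then z i else 0)"

definition is_weight :: "nat \<Rightarrow> (complex^('n::finite)^'n \<Rightarrow> nat \<Rightarrow> nat \<Rightarrow> complex) \<Rightarrow> ('n \<Rightarrow> int) \<Rightarrow> bool" where
  "is_weight d \<rho> \<nu> \<longleftrightarrow> (\<exists>v\<in>cvecs d. v \<noteq> (\<lambda>_. 0) \<and>
     (\<forall>z. (\<forall>i. norm (z i) = 1) \<longrightarrow>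
        mat_app d (\<rho> (diagm z)) v = (\<lambda>k. (\<Prod>i\<in>UNIV. z i powi \<nu> i) * v k)))"

definition dom_le :: "('n::{finite,linorder} \<Rightarrow> int) \<Rightarrow> ('n \<Rightarrow> int) \<Rightarrow> bool" where
  "dom_le \<nu> \<mu> \<longleftrightarrow> (\<Sum>i\<in>UNIV. \<nu> i) = (\<Sum>i\<in>UNIV. \<mu> i) \<and>
     (\<forall>k. (\<Sum>i\<in>{i. i \<le> k}. \<nu> i) \<le> (\<Sum>i\<in>{i. i \<le> k}. \<mu> i))"

definition has_highest_weight :: "nat \<Rightarrow> (((complex,'n) vec,'n) vec \<Rightarrow> nat \<Rightarrow> nat \<Rightarrow> complex) \<Rightarrow> ('n::{finite,linorder} \<Rightarrow> int) \<Rightarrow> bool" where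
  "has_highest_weight d \<rho> \<mu> \<longleftrightarrow> is_weight d \<rho> \<mu> \<and> (\<forall>\<nu>. is_weight d \<rho> \<nu> \<longrightarrow> dom_le \<nu> \<mu>)"

definition weight_2m2 :: "'n::{finite,linorder} \<Rightarrow> int" where
  "weight_2m2 i = (if i = Min UNIV then 2 else if i = Max UNIV then -2 else 0)"

definition laplacian :: "('n::finite set \<Rightarrow> real) \<Rightarrow> ('n set \<Rightarrow> (complex^'n^'n) measure) \<Rightarrow>
    nat \<Rightarrow> (complex^'n^'n \<Rightarrow> nat \<Rightarrow> nat \<Rightarrow> complex) \<Rightarrow> nat \<Rightarrow> nat \<Rightarrow> complex" where
  "laplacian w \<mu> d \<rho> i j = (if i < d \<and> j < d then
     (\<Sum>B\<in>UNIV. complex_of_real (w B) *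
        (idm d i j - (LINT A:unitary_sub B|\<mu> B. \<rho> A i j))) else 0)"

definition is_eigenvalue :: "nat \<Rightarrow> (nat \<Rightarrow> nat \<Rightarrow> complex) \<Rightarrow> complex \<Rightarrow> bool" where
  "is_eigenvalue d M e \<longleftrightarrow> (\<exists>v\<in>cvecs d. v \<noteq> (\<lambda>_. 0) \<and> mat_app d M v = (\<lambda>k. e * v k))"

text \<open>Smallest eigenvalue (the spectrum is real).\<close>
definition lambda_min :: "('n::finite set \<Rightarrow> real) \<Rightarrow> ('n set \<Rightarrow> (complex^'n^'n) measure) \<Rightarrow>
    nat \<Rightarrow> (complex^'n^'n \<Rightarrow> nat \<Rightarrow> nat \<Rightarrow> complex) \<Rightarrow> real" where
  "lambda_min w \<mu> d \<rho> = Min {x::real. is_eigenvalue d (laplacian w \<mu> d \<rho>) (complex_of_real x)}"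

end

theory Submission
  imports Defs "HOL-Library.Function_Algebras"
begin

text \<open>Let \<open>P\<^sub>B\<close> be the average of \<open>\<rho>\<close> over \<open>U\<^sub>B\<close>, the orthogonal projection onto the \<open>U\<^sub>B\<close>-invariant
  vectors for an invariant hermitian form \<open>H\<close>, and let \<open>\<delta>\<^sub>B(x) = H(x, (1 - P\<^sub>B) x)\<close>.

  The lower bound follows by downward induction on \<open>l\<close> from the inequality
  \<open>\<Sum>\<^sub>i\<^sub>\<in>\<^sub>B \<delta>\<^bsub>B-i\<^esub> \<ge> (m+1)(m-2)/m \<delta>\<^sub>B\<close> for \<open>m = |B|\<close>, because \<open>\<delta>\<^bsub>[n]\<^esub> = H(x, x)\<close> when there are no
  invariant vectors. The inequality says that \<open>\<Sum>\<^sub>i P\<^bsub>B-i\<^esub>\<close> has no eigenvalue above \<open>1 + 2/m\<close> on the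
  complement of the \<open>U\<^sub>B\<close>-invariants. An eigenvector there yields one of \<open>P\<^sub>K \<rho>(\<sigma>) P\<^sub>K\<close>, where \<open>K = U\<^bsub>B-p\<^esub>\<close>
  and \<open>\<sigma>\<close> is a transposition moving \<open>p\<close>, and the non-zero eigenvalues of this operator are
  \<open>(-1)\<^sup>N \<integral>\<^sub>K |k\<^sub>q\<^sub>q|\<^sup>2\<^sup>N dk\<close> with \<open>N \<ge> 1\<close>.

  The value is attained at vectors \<open>\<integral> \<Sum>\<^sub>i |g\<^sub>i\<^sub>p|\<^sup>4 \<rho>(g) y dg\<close>, which are always eigenvectors by the formula for
  the fourth moments of \<open>U\<^sub>B\<close>. For the highest weight \<open>(2,0,\<dots>,0,-2)\<close> some of them is non-zero: the
  Lie algebra action shows that the matrix coefficient of a highest weight vector depends on the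
  weight only, so it is a multiple of \<open>g\<^sub>p\<^sub>p\<^sup>2 cnj(g\<^sub>q\<^sub>q)\<^sup>2\<close> with \<open>p\<close> the first and \<open>q\<close> the last index, as in
  the tensor representation \<open>V \<otimes> V \<otimes> V\<^sup>* \<otimes> V\<^sup>*\<close>. The complex conjugate of this function is a linear
  combination of two-sided translates of \<open>\<Sum>\<^sub>i |g\<^sub>i\<^sub>p|\<^sup>4\<close>.\<close>

section \<open>Unitary matrices and complex reflections\<close>

text \<open>The constant 1 + 2/m comes from the even exponents N: an eigenvalue e of the sum of the
  projections yields the eigenvalue (e - 1)/(m - 1) or 1 - e of the operator built from the
  transposition. Even N bound its eigenvalues above by the fourth moment 2/(m(m - 1)) of an entry in
  U(m - 1), odd N bound them below by -1/(m - 1), and the first possibility decides.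

  Representations are only assumed continuous, while highest weights call for a Lie algebra. Complex
  reflections take the place of the exponential map: they generate the group, every unit vector a
  gives a one-parameter group \<open>refl_mat a (cis t)\<close> with generator i times
  \<open>outer a a\<close>, and the projections \<open>outer a a\<close> span all matrices over the
  complex numbers. Identities linear in X are therefore proved at X = \<open>outer a a\<close> only.

  The Haar measures of different \<open>unitary_sub B\<close> are unrelated data, so their averages
  are compared through the invariant vectors onto which they project.\<close>

definition adjm :: "complex^('n::finite)^'n \<Rightarrow> complex^'n^'n" where
  "adjm A = (\<chi> i j. cnj (A$j$i))"

definition csm :: "complex \<Rightarrow> complex^('n::finite)^'n \<Rightarrow> complex^'n^'n" where
  "csm z A = (\<chi> i j. z * A$i$j)"

definition cin :: "complex^('n::finite) \<Rightarrow> complex^'n \<Rightarrow> complex" where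
  "cin x y = (\<Sum>i\<in>UNIV. cnj (x$i) * y$i)"

definition outer :: "complex^('n::finite) \<Rightarrow> complex^'n \<Rightarrow> complex^'n^'n" where
  "outer a b = (\<chi> i j. a$i * cnj (b$j))"

text \<open>For a unit vector a this is the complex reflection that multiplies a by z and fixes the
  orthogonal complement of a. With z = \<open>cis t\<close> it runs through a one-parameter
  group.\<close>

definition refl_mat :: "complex^('n::finite) \<Rightarrow> complex \<Rightarrow> complex^'n^'n" where
  "refl_mat a z = mat 1 + csm (z - 1) (outer a a)"

lemma adjm_nth [simp]: "adjm A $ i $ j = cnj (A$j$i)"
  by (simp add: adjm_def)

lemma csm_nth [simp]: "csm z A $ i $ j = z * A$i$j"
  by (simp add: csm_def)

lemma outer_nth [simp]: "outer a b $ i $ j = a$i * cnj (b$j)"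
  by (simp add: outer_def)

lemma mat1_nth: "(mat 1 :: complex^('n::finite)^'n) $ i $ j = (if i = j then 1 else 0)"
  by (simp add: mat_def)

lemma matmul_nth: "((A::complex^('n::finite)^'n) ** B) $ i $ j = (\<Sum>k\<in>UNIV. A$i$k * B$k$j)"
  by (simp add: matrix_matrix_mult_def)

lemma matrix_add_rdistrib: "((A::complex^('n::finite)^'n) + B) ** C = A ** C + B ** (C::complex^'n^'n)"
  by (simp add: vec_eq_iff matmul_nth algebra_simps sum.distrib)

lemma adjm_adjm [simp]: "adjm (adjm A) = A"
  by (simp add: vec_eq_iff)

lemma adjm_one [simp]: "adjm (mat 1) = mat 1"
  by (simp add: vec_eq_iff mat_def)

lemma adjm_mul: "adjm (A ** B) = adjm B ** adjm A"
  by (simp add: vec_eq_iff matmul_nth mult.commute)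

lemma adjm_add: "adjm (A + B) = adjm A + adjm B"
  by (simp add: vec_eq_iff)

lemma adjm_csm: "adjm (csm z A) = csm (cnj z) (adjm A)"
  by (simp add: vec_eq_iff)

lemma adjm_outer: "adjm (outer a b) = outer b a"
  by (simp add: vec_eq_iff mult.commute)

lemma csm_mul_left: "csm z A ** B = csm z (A ** B)"
  by (simp add: vec_eq_iff matmul_nth sum_distrib_left mult.assoc)

lemma csm_mul_right: "A ** csm z B = csm z (A ** B)"
  by (simp add: vec_eq_iff matmul_nth sum_distrib_left mult_ac)

lemma outer_mul_outer: "outer a b ** outer c d = csm (cin b c) (outer a d)"
  by (simp add: vec_eq_iff matmul_nth cin_def sum_distrib_left sum_distrib_right mult_ac)

lemma mul_outer_adjm: "A ** outer a a ** adjm A = outer (A *v a) (A *v a)"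
proof -
  have "(A ** outer a a ** adjm A) $ i $ j = outer (A *v a) (A *v a) $ i $ j" for i j
  proof -
    have "(A ** outer a a ** adjm A) $ i $ j
        = (\<Sum>k\<in>UNIV. (\<Sum>l\<in>UNIV. A$i$l * (a$l * cnj (a$k))) * cnj (A$j$k))"
      by (simp add: matmul_nth)
    also have "\<dots> = (\<Sum>k\<in>UNIV. \<Sum>l\<in>UNIV. (A$i$l * a$l) * (cnj (A$j$k) * cnj (a$k)))"
      unfolding sum_distrib_right by (simp only: mult_ac)
    also have "\<dots> = (\<Sum>l\<in>UNIV. A$i$l * a$l) * (\<Sum>k\<in>UNIV. cnj (A$j$k) * cnj (a$k))"
      unfolding sum_product by (rule sum.swap)
    finally show ?thesis
      by (simp add: matrix_vector_mult_def)
  qed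
  then show ?thesis by (simp add: vec_eq_iff)
qed

lemma unitary_iff: "A \<in> unitary_grp \<longleftrightarrow> adjm A ** A = mat 1"
  by (simp add: unitary_grp_def vec_eq_iff matmul_nth mat_def)

lemma unitary_iff2: "A \<in> unitary_grp \<longleftrightarrow> A ** adjm A = mat 1"
  by (simp add: unitary_iff matrix_left_right_inverse)

lemma unitary_adj_mul [simp]: "A \<in> unitary_grp \<Longrightarrow> adjm A ** A = mat 1"
  by (simp add: unitary_iff)

lemma unitary_mul_adj [simp]: "A \<in> unitary_grp \<Longrightarrow> A ** adjm A = mat 1"
  by (simp add: unitary_iff2)

lemma unitary_one [simp]: "mat 1 \<in> unitary_grp"
  by (simp add: unitary_iff)

lemma unitary_mul: "A \<in> unitary_grp \<Longrightarrow> B \<in> unitary_grp \<Longrightarrow> A ** B \<in> unitary_grp"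
  unfolding unitary_iff adjm_mul by (metis matrix_mul_assoc matrix_mul_lid)

lemma unitary_adj: "A \<in> unitary_grp \<Longrightarrow> adjm A \<in> unitary_grp"
  using unitary_iff unitary_iff2 by fastforce

lemma adj_cancel_left: "A \<in> unitary_grp \<Longrightarrow> adjm A ** (A ** B) = B"
  by (simp add: matrix_mul_assoc)

lemma adj_cancel_left': "A \<in> unitary_grp \<Longrightarrow> A ** (adjm A ** B) = B"
  by (simp add: matrix_mul_assoc)

lemma adj_cancel_right: "A \<in> unitary_grp \<Longrightarrow> (B ** A) ** adjm A = B"
  by (simp add: matrix_mul_assoc[symmetric])

lemma adj_cancel_right': "A \<in> unitary_grp \<Longrightarrow> (B ** adjm A) ** A = B"
  by (simp add: matrix_mul_assoc[symmetric])

lemma unitary_col: "A \<in> unitary_grp \<Longrightarrow> (\<Sum>k\<in>UNIV. (cmod (A$k$i))^2) = 1"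
proof -
  assume "A \<in> unitary_grp"
  then have "(\<Sum>k\<in>UNIV. cnj (A$k$i) * A$k$i) = 1" by (simp add: unitary_grp_def)
  then have "complex_of_real (\<Sum>k\<in>UNIV. (cmod (A$k$i))^2) = 1"
    unfolding of_real_sum complex_norm_square by (simp add: mult.commute)
  then show ?thesis using of_real_eq_1_iff by blast
qed

lemma unitary_entry_le1: "A \<in> unitary_grp \<Longrightarrow> cmod (A$i$j) \<le> 1"
proof -
  assume A: "A \<in> unitary_grp"
  have "(cmod (A$i$j))^2 \<le> (\<Sum>k\<in>UNIV. (cmod (A$k$j))^2)"
    by (rule member_le_sum) auto
  then show ?thesis using unitary_col[OF A] by (simp add: power_le_one_iff abs_square_le_1)
qed

lemma unitary_subD: "A \<in> unitary_sub B \<Longrightarrow> A \<in> unitary_grp"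
  by (simp add: unitary_sub_def)

lemma unitary_sub_nth: "A \<in> unitary_sub B \<Longrightarrow> i \<notin> B \<or> j \<notin> B \<Longrightarrow> A$i$j = (if i = j then 1 else 0)"
  by (auto simp: unitary_sub_def)

lemma unitary_sub_UNIV [simp]: "unitary_sub UNIV = unitary_grp"
  by (simp add: unitary_sub_def)

lemma unitary_sub_mono: "B \<subseteq> C \<Longrightarrow> unitary_sub B \<subseteq> unitary_sub C"
  by (auto simp: unitary_sub_def)

lemma unitary_sub_one [simp]: "mat 1 \<in> unitary_sub B"
  by (simp add: unitary_sub_def mat1_nth)

lemma unitary_sub_adj: "A \<in> unitary_sub B \<Longrightarrow> adjm A \<in> unitary_sub B"
  by (auto simp: unitary_sub_def unitary_adj)

lemma unitary_sub_mul:
  assumes "A \<in> unitary_sub B" "C \<in> unitary_sub B"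
  shows "A ** C \<in> unitary_sub B"
proof -
  have "(A ** C)$i$j = (if i = j then 1 else 0)" if "i \<notin> B \<or> j \<notin> B" for i j
  proof (cases "i \<in> B")
    case False
    then have "A$i$k = (if i = k then 1 else 0)" for k
      using assms unitary_sub_nth by blast
    then have "(A ** C)$i$j = C$i$j" by (simp add: matmul_nth if_distrib[of "\<lambda>x. x * _"] cong: if_cong)
    then show ?thesis using unitary_sub_nth[OF assms(2)] False by metis
  next
    case True
    then have j: "j \<notin> B" using that by simp
    then have "C$k$j = (if k = j then 1 else 0)" for k
      using assms unitary_sub_nth by blast
    then have "(A ** C)$i$j = A$i$j" by (simp add: matmul_nth if_distrib[of "\<lambda>x. _ * x"] cong: if_cong)
    then show ?thesis using unitary_sub_nth[OF assms(1)] j by metis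
  qed
  then show ?thesis using assms unitary_mul[of A C] by (simp add: unitary_sub_def)
qed

section \<open>Compactness of the groups U_B\<close>

lemma continuous_on_matmul [continuous_intros]:
  fixes f g :: "'a::topological_space \<Rightarrow> complex^('n::finite)^'n"
  assumes "continuous_on S f" "continuous_on S g"
  shows "continuous_on S (\<lambda>x. f x ** g x)"
  unfolding matrix_matrix_mult_def
  by (intro continuous_intros continuous_on_vec_lambda assms)

lemma continuous_on_adjm [continuous_intros]:
  fixes f :: "'a::topological_space \<Rightarrow> complex^('n::finite)^'n"
  assumes "continuous_on S f"
  shows "continuous_on S (\<lambda>x. adjm (f x))"
  unfolding adjm_def
  by (intro continuous_intros continuous_on_vec_lambda assms)

lemma compact_unitary_sub [simp]: "compact (unitary_sub B)"
proof -
  have "closed {A::complex^'a^'a. A$i$j = (if i = j then 1 else 0)}" for i j :: 'a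
    by (rule closed_Collect_eq) (auto intro!: continuous_intros)
  moreover have "closed (unitary_grp :: (complex^'a^'a) set)"
    unfolding unitary_grp_def by (intro closed_Collect_all closed_Collect_eq continuous_intros)
  moreover have "unitary_sub B = unitary_grp \<inter> (\<Inter>i. \<Inter>j\<in>{j. i \<notin> B \<or> j \<notin> B}. {A. A$i$j = (if i = j then 1 else 0)})"
    by (auto simp: unitary_sub_def)
  ultimately have "closed (unitary_sub B)" by (auto intro!: closed_Int closed_INT)
  moreover have "bounded (unitary_sub B)"
  proof (rule boundedI)
    fix A assume "A \<in> unitary_sub B"
    then have A: "A \<in> unitary_grp" by (rule unitary_subD)
    have "norm A \<le> (\<Sum>i\<in>UNIV. norm (A$i))" by (simp add: norm_vec_def L2_set_le_sum)
    also have "\<dots> \<le> (\<Sum>i\<in>UNIV. \<Sum>j\<in>UNIV. norm (A$i$j))"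
      by (intro sum_mono) (simp add: norm_vec_def L2_set_le_sum)
    also have "\<dots> \<le> (\<Sum>i\<in>(UNIV::'a set). \<Sum>j\<in>(UNIV::'a set). 1)"
      by (intro sum_mono unitary_entry_le1 A)
    finally show "norm A \<le> (\<Sum>i\<in>(UNIV::'a set). \<Sum>j\<in>(UNIV::'a set). 1)" .
  qed
  ultimately show ?thesis using compact_eq_bounded_closed by blast
qed

lemma sets_unitary_sub [measurable]: "unitary_sub B \<in> sets borel"
  using compact_unitary_sub by (intro borel_closed compact_imp_closed)

section \<open>Complex reflections and transitivity on spheres\<close>

lemma refl_mat_mul:
  assumes "cin a a = 1"
  shows "refl_mat a z ** refl_mat a w = refl_mat a (z * w)"
  by (simp add: refl_mat_def matrix_add_ldistrib matrix_add_rdistrib csm_mul_left csm_mul_right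
      outer_mul_outer assms vec_eq_iff algebra_simps)

lemma refl_mat_one [simp]: "refl_mat a 1 = mat 1"
  by (simp add: refl_mat_def vec_eq_iff)

lemma adjm_refl_mat: "adjm (refl_mat a z) = refl_mat a (cnj z)"
  by (simp add: refl_mat_def adjm_add adjm_csm adjm_outer)

lemma refl_mat_unitary_sub:
  assumes "cin a a = 1" "cmod z = 1" "\<And>i. i \<notin> B \<Longrightarrow> a$i = 0"
  shows "refl_mat a z \<in> unitary_sub B"
proof -
  have "cnj z * z = 1"
    using assms(2) by (metis complex_norm_square mult.commute of_real_1 power_one)
  then have "refl_mat a z \<in> unitary_grp"
    by (simp add: unitary_iff adjm_refl_mat refl_mat_mul assms)
  then show ?thesis
    using assms(3) by (auto simp: unitary_sub_def refl_mat_def mat_def)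
qed

lemma refl_mat_unitary: "cin a a = 1 \<Longrightarrow> cmod z = 1 \<Longrightarrow> refl_mat a z \<in> unitary_grp"
  using refl_mat_unitary_sub[of a z UNIV] by simp

lemma cin_real: "cin x x = complex_of_real (\<Sum>i\<in>UNIV. (cmod (x$i))^2)"
  unfolding of_real_sum complex_norm_square cin_def by (simp add: mult.commute)

lemma cin_eq_0_iff: "cin x x = 0 \<longleftrightarrow> x = 0"
  unfolding cin_real of_real_eq_0_iff
  by (subst sum_nonneg_eq_0_iff) (auto simp: vec_eq_iff)

lemma cnj_cin: "cnj (cin x y) = cin y x"
  by (simp add: cin_def mult.commute)

lemma cin_diff_left: "cin (x - y) z = cin x z - cin y z"
  by (simp add: cin_def algebra_simps sum_subtractf)

lemma cin_diff_right: "cin x (y - z) = cin x y - cin x z"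
  by (simp add: cin_def algebra_simps sum_subtractf)

text \<open>The root of the reflection is the difference of the two vectors.\<close>

lemma refl_mat_transitive:
  fixes x y :: "complex^'n::finite"
  assumes "cin x x = cin y y" "x \<noteq> y"
  obtains a z where "cin a a = 1" "cmod z = 1" "refl_mat a z *v x = y"
    "\<And>i. x$i = y$i \<Longrightarrow> a$i = 0"
proof -
  define u where "u = x - y"
  define c where "c = cin u x"
  define s where "s = sqrt (\<Sum>i\<in>UNIV. (cmod (u$i))^2)"
  define a where "a = (\<chi> i. u$i / complex_of_real s)"
  have uu: "cin u u = complex_of_real (s^2)"
    by (simp add: cin_real s_def sum_nonneg)
  have "u \<noteq> 0" using assms by (simp add: u_def)
  then have s: "s \<noteq> 0" using uu cin_eq_0_iff[of u] by auto
  have uc: "cin u u = c + cnj c"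
    by (simp add: c_def u_def cin_diff_left cin_diff_right cnj_cin assms)
  have c: "c \<noteq> 0" using uc uu s by auto
  \<comment> \<open>With a = u / s the reflection sends x to x + (z - 1) c u / s^2. Asking for x - u
    = y forces (z - 1) c = - s^2 = - (c + cnj c), whose solution is this z, of modulus 1.\<close>
  define z where "z = - (cnj c / c)"
  have aa: "cin a a = 1"
  proof -
    have "cin a a = cin u u / (complex_of_real s)^2"
      by (simp add: cin_def a_def sum_divide_distrib power2_eq_square)
    then show ?thesis using uu s by simp
  qed
  have z: "cmod z = 1" using c by (simp add: z_def norm_divide)
  have zc: "(z - 1) * c = - ((complex_of_real s)^2)"
    using uc uu c by (simp add: z_def field_simps)
  have "(refl_mat a z *v x) $ i = y $ i" for i
  proof -
    have "(refl_mat a z *v x) $ i = (\<Sum>j\<in>UNIV. (if i = j then x$j else 0)) + (\<Sum>j\<in>UNIV. (z - 1) * (a$i * cnj (a$j)) * x$j)"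
      unfolding sum.distrib[symmetric]
      by (auto simp: matrix_vector_mult_def refl_mat_def mat_def algebra_simps intro!: sum.cong)
    also have "\<dots> = x$i + (z - 1) * u$i * c / (complex_of_real s)^2"
      by (simp add: c_def cin_def a_def sum_distrib_left sum_divide_distrib power2_eq_square mult_ac)
    also have "\<dots> = x$i - u$i"
    proof -
      have "(z - 1) * u$i * c = - (u$i * (complex_of_real s)^2)"
        using zc by (metis (no_types, lifting) mult.commute mult.left_commute mult_minus_left)
      then show ?thesis using s by simp
    qed
    finally show ?thesis by (simp add: u_def)
  qed
  then have "refl_mat a z *v x = y" by (simp add: vec_eq_iff)
  moreover have "a$i = 0" if "x$i = y$i" for i using that by (simp add: a_def u_def)
  ultimately show ?thesis using aa z that by blast
qed

text \<open>The root of the connecting reflection vanishes wherever x and y agree, so the reflection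
  already lies in U_B.\<close>

lemma unitary_sub_transitive:
  fixes x y :: "complex^'n::finite"
  assumes "cin x x = cin y y" "\<And>i. i \<notin> B \<Longrightarrow> x$i = y$i"
  obtains h where "h \<in> unitary_sub B" "h *v x = y"
proof (cases "x = y")
  case True
  then show ?thesis using that[of "mat 1"] by simp
next
  case False
  then obtain a z where a: "cin a a = 1" "cmod z = 1" "refl_mat a z *v x = y"
    "\<And>i. x$i = y$i \<Longrightarrow> a$i = 0"
    using refl_mat_transitive assms by metis
  then have "refl_mat a z \<in> unitary_sub B" using assms by (intro refl_mat_unitary_sub) auto
  then show ?thesis using that a by blast
qed

lemma cin_mult_unitary:
  assumes "A \<in> unitary_grp"
  shows "cin (A *v x) (A *v y) = cin x y"
proof -
  have "cin (A *v x) (A *v y) = (\<Sum>i\<in>UNIV. (\<Sum>j\<in>UNIV. cnj (A$i$j) * cnj (x$j)) * (\<Sum>k\<in>UNIV. A$i$k * y$k))"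
    by (simp add: cin_def matrix_vector_mult_def)
  also have "\<dots> = (\<Sum>i\<in>UNIV. \<Sum>j\<in>UNIV. \<Sum>k\<in>UNIV. cnj (x$j) * y$k * (cnj (A$i$j) * A$i$k))"
    unfolding sum_product by (simp only: mult_ac)
  also have "\<dots> = (\<Sum>j\<in>UNIV. \<Sum>k\<in>UNIV. \<Sum>i\<in>UNIV. cnj (x$j) * y$k * (cnj (A$i$j) * A$i$k))"
    by (subst sum.swap, rule sum.cong[OF refl], subst sum.swap, rule refl)
  also have "\<dots> = (\<Sum>j\<in>UNIV. \<Sum>k\<in>UNIV. cnj (x$j) * y$k * (if j = k then 1 else 0))"
    using assms by (simp add: sum_distrib_left[symmetric] unitary_grp_def)
  also have "\<dots> = cin x y"
    by (simp add: cin_def if_distrib[of "\<lambda>x. _ * x"] cong: if_cong)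
  finally show ?thesis .
qed

lemma cin_axis [simp]: "cin (axis i 1) (axis j 1) = (if i = j then 1 else 0)"
  by (simp add: cin_def axis_def if_distrib[of "\<lambda>x. _ * x"] if_distrib[of cnj] cong: if_cong)

lemma mult_axis_nth: "((A::complex^('n::finite)^'n) *v axis j 1) $ i = A$i$j"
  by (simp add: matrix_vector_mult_def axis_def if_distrib[of "\<lambda>x. _ * x"] cong: if_cong)

text \<open>Orthogonality of column i to the other columns forces row i to be the unit row as well;
  a condition on one column is thus enough to drop an index.\<close>

lemma unitary_sub_removeI:
  assumes A: "A \<in> unitary_sub (insert i B)" and col: "\<And>j. A$j$i = (if j = i then 1 else 0)"
  shows "A \<in> unitary_sub B"
proof -
  have U: "A \<in> unitary_grp" using A by (rule unitary_subD)
  have "A$i$j = (if i = j then 1 else 0)" for j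
  proof -
    have "(\<Sum>k\<in>UNIV. cnj (A$k$i) * A$k$j) = (if i = j then 1 else 0)"
      using U by (simp add: unitary_grp_def)
    then show ?thesis by (simp add: col if_distrib[of cnj] if_distrib[of "\<lambda>x. x * _"] cong: if_cong)
  qed
  then have "A$j$k = (if j = k then 1 else 0)" if "j = i \<or> k = i" for j k using col that by auto
  then show ?thesis using A U by (simp add: unitary_sub_def) (metis insert_iff)
qed

text \<open>Householder reduction: the reflection that sends the i-th basis vector to its preimage
  under g turns g into an element fixing that basis vector, hence into a smaller U_B. Generation by
  reflections is used where one would otherwise write g as an exponential.\<close>

lemma unitary_refl_induct:
  fixes g :: "complex^('n::finite)^'n"
  assumes g: "g \<in> unitary_grp"
    and one: "P (mat 1)"
    and step: "\<And>g a z. g \<in> unitary_grp \<Longrightarrow> P g \<Longrightarrow> cin a a = 1 \<Longrightarrow> cmod z = 1 \<Longrightarrow> P (g ** refl_mat a z)"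
  shows "P g"
proof -
  have "finite B \<Longrightarrow> (\<forall>g\<in>unitary_sub B. P g)" for B :: "'n set"
  proof (induction B rule: finite_induct)
    case empty
    have "g = mat 1" if "g \<in> unitary_sub {}" for g :: "complex^'n^'n"
      using that by (auto simp: unitary_sub_def vec_eq_iff mat_def)
    then show ?case using one by auto
  next
    case (insert i B)
    show ?case
    proof
      fix g :: "complex^'n^'n" assume g: "g \<in> unitary_sub (insert i B)"
      define x where "x = adjm g *v axis i 1"
      have gU: "g \<in> unitary_grp" using g by (rule unitary_subD)
      have gx: "g *v x = axis i 1"
        by (simp add: x_def matrix_vector_mul_assoc gU)
      show "P g"
      proof (cases "axis i 1 = x")
        case True
        have "g$j$i = (if j = i then 1 else 0)" for j
          using mult_axis_nth[of g i j] gx[folded True] by (simp add: axis_def)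
        then have "g \<in> unitary_sub B" by (rule unitary_sub_removeI[OF g])
        then show ?thesis using insert by blast
      next
        case False
        have "cin x x = cin (axis i 1) (axis i 1)"
          unfolding x_def by (rule cin_mult_unitary[OF unitary_adj[OF gU]])
        then obtain a z where a: "cin a a = 1" "cmod z = 1" "refl_mat a z *v axis i 1 = x"
            "\<And>j. (axis i 1 :: complex^'n)$j = x$j \<Longrightarrow> a$j = 0"
          using False refl_mat_transitive[of "axis i 1" x] by metis
        have "a$j = 0" if "j \<notin> insert i B" for j
        proof -
          have "x $ j = cnj (g$i$j)" by (simp add: x_def mult_axis_nth)
          also have "\<dots> = 0" using unitary_sub_nth[OF g, of i j] that by auto
          finally show ?thesis using a(4)[of j] that by (auto simp: axis_def)
        qed
        then have r: "refl_mat a z \<in> unitary_sub (insert i B)" using a(1,2) by (intro refl_mat_unitary_sub) auto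
        define g' where "g' = g ** refl_mat a z"
        have g': "g' \<in> unitary_sub (insert i B)" unfolding g'_def by (intro unitary_sub_mul g r)
        have "g' *v axis i 1 = axis i 1"
          using gx a(3) by (simp add: g'_def matrix_vector_mul_assoc[symmetric])
        then have "g'$j$i = (if j = i then 1 else 0)" for j
          using mult_axis_nth[of g' i j] by (simp add: axis_def)
        then have "g' \<in> unitary_sub B" by (rule unitary_sub_removeI[OF g'])
        then have "P g'" using insert by blast
        then have "P (g' ** refl_mat a (cnj z))"
          using step a(1,2) g' by (metis complex_mod_cnj unitary_subD)
        moreover have "g' ** refl_mat a (cnj z) = g"
          unfolding g'_def adjm_refl_mat[symmetric] using r by (intro adj_cancel_right) (rule unitary_subD)
        ultimately show ?thesis by simp
      qed
    qed
  qed
  then show ?thesis using g finite[of UNIV] by (metis unitary_sub_UNIV)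
qed

section \<open>Transposition matrices\<close>

definition tau :: "'n \<Rightarrow> 'n \<Rightarrow> 'n \<Rightarrow> 'n" where
  "tau p q i = (if i = p then q else if i = q then p else i)"

definition swp :: "'n::finite \<Rightarrow> 'n \<Rightarrow> complex^'n^'n" where
  "swp p q = (\<chi> i j. if i = tau p q j then 1 else 0)"

lemma tau_tau [simp]: "tau p q (tau p q i) = i"
  by (auto simp: tau_def)

lemma tau_eq_iff: "i = tau p q j \<longleftrightarrow> tau p q i = j"
  by (metis tau_tau)

lemma tau_simps [simp]: "tau p q p = q" "tau p q q = p"
  by (auto simp: tau_def)

lemma swp_mul_nth: "(swp p q ** A) $ i $ j = A $ tau p q i $ j"
  by (simp add: matmul_nth swp_def tau_eq_iff if_distrib[of "\<lambda>x. x * _"] cong: if_cong)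

lemma mul_swp_nth: "((A::complex^('n::finite)^'n) ** swp p q) $ i $ j = A $ i $ tau p q j"
  by (simp add: matmul_nth swp_def if_distrib[of "\<lambda>x. A$i$_ * x"] cong: if_cong)

lemma adjm_swp [simp]: "adjm (swp p q) = swp p q"
  by (auto simp: vec_eq_iff swp_def tau_eq_iff)

lemma swp_swp [simp]: "swp p q ** swp p q = mat 1"
proof -
  have "tau p q i = tau p q j \<longleftrightarrow> i = j" for i j by (metis tau_tau)
  then show ?thesis by (simp add: vec_eq_iff swp_mul_nth mat1_nth) (simp add: swp_def)
qed

lemma swp_unitary [simp]: "swp p q \<in> unitary_grp"
  by (simp add: unitary_iff)

lemma swp_unitary_sub: "p \<in> B \<Longrightarrow> q \<in> B \<Longrightarrow> swp p q \<in> unitary_sub B"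
  using swp_unitary[of p q] by (auto simp: unitary_sub_def) (auto simp: swp_def tau_def)

lemma swp_conj_unitary_sub:
  assumes "A \<in> unitary_sub B"
  shows "swp p q ** A ** swp p q \<in> unitary_sub (tau p q ` B)"
proof -
  have "swp p q ** A ** swp p q \<in> unitary_grp"
    using assms unitary_mul unitary_subD swp_unitary by metis
  moreover have "(swp p q ** A ** swp p q)$i$j = (if i = j then 1 else 0)" if "i \<notin> tau p q ` B \<or> j \<notin> tau p q ` B" for i j
  proof -
    have "tau p q i \<notin> B \<or> tau p q j \<notin> B" using that by (metis image_eqI tau_tau)
    then show ?thesis
      using unitary_sub_nth[OF assms] by (metis mul_swp_nth swp_mul_nth tau_tau)
  qed
  ultimately show ?thesis by (simp add: unitary_sub_def)
qed

section \<open>Haar integrals\<close>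

locale haar_family =
  fixes \<mu> :: "'n::finite set \<Rightarrow> (complex^'n^'n) measure"
  assumes haar: "\<And>B. is_haar_prob B (\<mu> B)"
begin

definition hI :: "'n set \<Rightarrow> (complex^'n^'n \<Rightarrow> complex) \<Rightarrow> complex" where
  "hI B f = (LINT A:unitary_sub B|\<mu> B. f A)"

lemma prob_space_haar: "prob_space (\<mu> B)"
  using haar[of B] by (simp add: is_haar_prob_def)

lemma sets_haar [measurable_cong]: "sets (\<mu> B) = sets borel"
  using haar[of B] by (simp add: is_haar_prob_def)

lemma space_haar [simp]: "space (\<mu> B) = UNIV"
  using sets_eq_imp_space_eq[OF sets_haar] by simp

lemma indicator_continuous_measurable:
  fixes f :: "complex^'n^'n \<Rightarrow> complex"
  assumes "continuous_on (unitary_sub B) f"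
  shows "(\<lambda>A. indicator (unitary_sub B) A *\<^sub>R f A) \<in> borel_measurable borel"
  by (rule borel_measurable_continuous_on_indicator[OF sets_unitary_sub assms])

lemma continuous_unitary_sub_bounded:
  fixes f :: "complex^'n^'n \<Rightarrow> 'b::real_normed_vector"
  assumes "continuous_on (unitary_sub B) f"
  obtains K where "K > 0" "\<And>A. A \<in> unitary_sub B \<Longrightarrow> norm (f A) \<le> K"
proof -
  have "bounded (f ` unitary_sub B)"
    by (intro compact_imp_bounded compact_continuous_image assms compact_unitary_sub)
  then show ?thesis using that by (auto simp: bounded_pos)
qed

lemma hI_set_integrable:
  fixes f :: "complex^'n^'n \<Rightarrow> complex"
  assumes "continuous_on (unitary_sub B) f"
  shows "set_integrable (\<mu> B) (unitary_sub B) f"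
proof -
  interpret P: prob_space "\<mu> B" by (rule prob_space_haar)
  obtain K where K: "K > 0" "\<And>A. A \<in> unitary_sub B \<Longrightarrow> norm (f A) \<le> K"
    using continuous_unitary_sub_bounded[OF assms] by blast
  show ?thesis unfolding set_integrable_def
  proof (rule P.integrable_const_bound)
    show "AE A in \<mu> B. norm (indicat_real (unitary_sub B) A *\<^sub>R f A) \<le> K"
      using K by (intro AE_I2) (auto simp: indicator_def)
    show "(\<lambda>A. indicat_real (unitary_sub B) A *\<^sub>R f A) \<in> borel_measurable (\<mu> B)"
      using indicator_continuous_measurable[OF assms] measurable_cong_sets[OF sets_haar refl] by blast
  qed
qed

lemma hI_cong: "(\<And>A. A \<in> unitary_sub B \<Longrightarrow> f A = g A) \<Longrightarrow> hI B f = hI B g"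
  unfolding hI_def set_lebesgue_integral_def
  by (intro Bochner_Integration.integral_cong refl) (auto simp: indicator_def)

lemma hI_const [simp]: "hI B (\<lambda>_. c) = c"
proof -
  interpret prob_space "\<mu> B" by (rule prob_space_haar)
  have "measure (\<mu> B) (unitary_sub B) = 1"
    using haar[of B] by (simp add: is_haar_prob_def measure_def)
  then show ?thesis
    by (simp add: hI_def set_integral_const sets_haar sets_unitary_sub emeasure_eq_measure)
qed

lemma hI_add:
  assumes "continuous_on (unitary_sub B) f" "continuous_on (unitary_sub B) g"
  shows "hI B (\<lambda>A. f A + g A) = hI B f + hI B g"
  unfolding hI_def by (intro set_integral_add hI_set_integrable assms)

lemma hI_diff:
  assumes "continuous_on (unitary_sub B) f" "continuous_on (unitary_sub B) g"
  shows "hI B (\<lambda>A. f A - g A) = hI B f - hI B g"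
  unfolding hI_def by (intro set_integral_diff hI_set_integrable assms)

lemma hI_mult_left: "hI B (\<lambda>A. c * f A) = c * hI B f"
  unfolding hI_def by (rule set_integral_mult_right)

lemma hI_mult_right: "hI B (\<lambda>A. f A * c) = hI B f * c"
  unfolding hI_def by (rule set_integral_mult_left)

lemma hI_sum:
  assumes "\<And>i. i \<in> I \<Longrightarrow> continuous_on (unitary_sub B) (f i)"
  shows "hI B (\<lambda>A. \<Sum>i\<in>I. f i A) = (\<Sum>i\<in>I. hI B (f i))"
  using assms
proof (induction I rule: infinite_finite_induct)
  case (insert x F)
  then show ?case
    by (simp add: hI_add continuous_on_sum)
qed auto

lemma hI_cnj: "hI B (\<lambda>A. cnj (f A)) = cnj (hI B f)"
proof -
  have *: "(\<lambda>A. indicat_real (unitary_sub B) A *\<^sub>R cnj (f A)) = (\<lambda>A. cnj (indicat_real (unitary_sub B) A *\<^sub>R f A))"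
    by auto
  show ?thesis
    unfolding hI_def set_lebesgue_integral_def * by (rule Bochner_Integration.integral_cnj)
qed

lemma hI_Re: "continuous_on (unitary_sub B) f \<Longrightarrow>
    Re (hI B f) = (LINT A|\<mu> B. Re (indicat_real (unitary_sub B) A *\<^sub>R f A))"
  using hI_set_integrable[of B f]
  unfolding hI_def set_lebesgue_integral_def set_integrable_def by (intro integral_Re[symmetric])

lemma hI_mono:
  assumes "continuous_on (unitary_sub B) f" "continuous_on (unitary_sub B) g"
    and "\<And>A. A \<in> unitary_sub B \<Longrightarrow> Re (f A) \<le> Re (g A)"
  shows "Re (hI B f) \<le> Re (hI B g)"
  unfolding hI_Re[OF assms(1)] hI_Re[OF assms(2)]
proof (rule integral_mono)
  show "integrable (\<mu> B) (\<lambda>A. Re (indicat_real (unitary_sub B) A *\<^sub>R f A))"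
    using hI_set_integrable[OF assms(1)] unfolding set_integrable_def by (rule integrable_Re)
  show "integrable (\<mu> B) (\<lambda>A. Re (indicat_real (unitary_sub B) A *\<^sub>R g A))"
    using hI_set_integrable[OF assms(2)] unfolding set_integrable_def by (rule integrable_Re)
qed (use assms(3) in \<open>auto simp: indicator_def\<close>)

lemma hI_of_real:
  "hI B (\<lambda>A. complex_of_real (f A)) = complex_of_real (Re (hI B (\<lambda>A. complex_of_real (f A))))"
proof -
  have "cnj (hI B (\<lambda>A. complex_of_real (f A))) = hI B (\<lambda>A. complex_of_real (f A))"
    by (simp add: hI_cnj[symmetric])
  then show ?thesis by (simp add: complex_eq_iff)
qed

lemma hI_norm_le:
  assumes "continuous_on (unitary_sub B) f" "continuous_on (unitary_sub B) g"
    and "\<And>A. A \<in> unitary_sub B \<Longrightarrow> norm (f A) \<le> Re (g A)"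
  shows "norm (hI B f) \<le> Re (hI B g)"
proof -
  have "norm (hI B f) \<le> (LINT A|\<mu> B. norm (indicat_real (unitary_sub B) A *\<^sub>R f A))"
    unfolding hI_def set_lebesgue_integral_def by (rule integral_norm_bound)
  also have "\<dots> \<le> Re (hI B g)"
    unfolding hI_Re[OF assms(2)]
  proof (rule integral_mono)
    show "integrable (\<mu> B) (\<lambda>A. norm (indicat_real (unitary_sub B) A *\<^sub>R f A))"
      using hI_set_integrable[OF assms(1)] unfolding set_integrable_def by (rule integrable_norm)
    show "integrable (\<mu> B) (\<lambda>A. Re (indicat_real (unitary_sub B) A *\<^sub>R g A))"
      using hI_set_integrable[OF assms(2)] unfolding set_integrable_def by (rule integrable_Re)
  qed (use assms(3) in \<open>auto simp: indicator_def\<close>)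
  finally show ?thesis .
qed

section \<open>Invariance and positivity of the Haar integral\<close>

lemma continuous_on_left_translate:
  assumes "continuous_on (unitary_sub B) f" "g \<in> unitary_sub B"
  shows "continuous_on (unitary_sub B) (\<lambda>A. f (g ** A))"
  by (rule continuous_on_compose2[OF assms(1)])
    (auto intro!: continuous_intros unitary_sub_mul assms)

lemma continuous_on_right_translate:
  assumes "continuous_on (unitary_sub B) f" "g \<in> unitary_sub B"
  shows "continuous_on (unitary_sub B) (\<lambda>A. f (A ** g))"
  by (rule continuous_on_compose2[OF assms(1)])
    (auto intro!: continuous_intros unitary_sub_mul assms)

lemma continuous_on_inverse_arg:
  assumes "continuous_on (unitary_sub B) f"
  shows "continuous_on (unitary_sub B) (\<lambda>A. f (adjm A))"
  by (rule continuous_on_compose2[OF assms(1)])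
    (auto intro!: continuous_intros unitary_sub_adj)

lemma hI_left:
  assumes f: "continuous_on (unitary_sub B) f" and g: "g \<in> unitary_sub B"
  shows "hI B (\<lambda>A. f (g ** A)) = hI B f"
proof -
  define F where "F = (\<lambda>A. indicat_real (unitary_sub B) A *\<^sub>R f A)"
  have F: "F \<in> borel_measurable borel"
    unfolding F_def by (rule indicator_continuous_measurable[OF f])
  have ind: "g ** A \<in> unitary_sub B \<longleftrightarrow> A \<in> unitary_sub B" for A :: "complex^'n^'n"
  proof
    assume "g ** A \<in> unitary_sub B"
    then have "adjm g ** (g ** A) \<in> unitary_sub B" by (rule unitary_sub_mul[OF unitary_sub_adj[OF g]])
    then show "A \<in> unitary_sub B" using unitary_subD[OF g] by (simp add: adj_cancel_left)
  qed (rule unitary_sub_mul[OF g])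
  have "continuous_on UNIV (\<lambda>A::complex^'n^'n. g ** A)" by (intro continuous_intros)
  then have m: "(\<lambda>A::complex^'n^'n. g ** A) \<in> measurable (\<mu> B) borel"
    using measurable_cong_sets[OF sets_haar refl] borel_measurable_continuous_onI by blast
  have "hI B f = integral\<^sup>L (distr (\<mu> B) borel (\<lambda>A. g ** A)) F"
    using haar[of B] g by (simp add: is_haar_prob_def hI_def set_lebesgue_integral_def F_def)
  also have "\<dots> = (LINT A|\<mu> B. F (g ** A))"
    by (rule integral_distr[OF m F])
  also have "\<dots> = hI B (\<lambda>A. f (g ** A))"
    unfolding hI_def set_lebesgue_integral_def F_def
    by (intro Bochner_Integration.integral_cong refl) (simp add: indicator_def ind)
  finally show ?thesis by simp
qed

lemma hI_fubini:
  assumes f: "continuous_on (unitary_sub B \<times> unitary_sub C) (\<lambda>(x, y). f x y)"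
  shows "hI B (\<lambda>x. hI C (\<lambda>y. f x y)) = hI C (\<lambda>y. hI B (\<lambda>x. f x y))"
proof -
  interpret B: prob_space "\<mu> B" by (rule prob_space_haar)
  interpret C: prob_space "\<mu> C" by (rule prob_space_haar)
  interpret P: pair_prob_space "\<mu> B" "\<mu> C" ..
  define S where "S = unitary_sub B \<times> unitary_sub C"
  have S: "compact S" by (simp add: S_def compact_Times)
  define F where "F = (\<lambda>x y. indicat_real S (x, y) *\<^sub>R f x y)"
  have F_eq: "F x y = indicat_real (unitary_sub B) x *\<^sub>R (indicat_real (unitary_sub C) y *\<^sub>R f x y)" for x y
    by (simp add: F_def S_def indicator_def)
  have "(\<lambda>z. indicat_real S z *\<^sub>R (\<lambda>(x, y). f x y) z) \<in> borel_measurable borel"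
    using f S unfolding S_def
    by (intro borel_measurable_continuous_on_indicator borel_closed compact_imp_closed) auto
  then have "case_prod F \<in> borel_measurable (borel \<Otimes>\<^sub>M borel)"
    by (simp add: F_def borel_prod case_prod_unfold)
  then have m: "case_prod F \<in> borel_measurable (\<mu> B \<Otimes>\<^sub>M \<mu> C)"
    using measurable_cong_sets[OF sets_pair_measure_cong[OF sets_haar sets_haar] refl] by blast
  obtain K where K: "\<And>z. z \<in> S \<Longrightarrow> norm ((\<lambda>(x, y). f x y) z) \<le> K"
    using compact_imp_bounded[OF compact_continuous_image[OF f[folded S_def] S]]
    unfolding bounded_iff by blast
  have i: "integrable (\<mu> B \<Otimes>\<^sub>M \<mu> C) (case_prod F)"
  proof (rule P.integrable_const_bound[OF _ m])
    have "norm (case_prod F z) \<le> max K 0" for z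
      using K[of z] by (auto simp: F_def indicator_def split: prod.splits)
    then show "AE z in \<mu> B \<Otimes>\<^sub>M \<mu> C. norm (case_prod F z) \<le> max K 0" by simp
  qed
  have 1: "hI B (\<lambda>x. hI C (\<lambda>y. f x y)) = (LINT x|\<mu> B. LINT y|\<mu> C. F x y)"
    by (simp add: hI_def set_lebesgue_integral_def F_eq del: scaleR_scaleR)
  have 2: "hI C (\<lambda>y. hI B (\<lambda>x. f x y)) = (LINT y|\<mu> C. LINT x|\<mu> B. F x y)"
  proof -
    have "F x y = indicat_real (unitary_sub C) y *\<^sub>R (indicat_real (unitary_sub B) x *\<^sub>R f x y)" for x y
      by (auto simp: F_def S_def indicator_def)
    then show ?thesis by (simp add: hI_def set_lebesgue_integral_def del: scaleR_scaleR)
  qed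
  show ?thesis unfolding 1 2 using P.Fubini_integral[OF i] by simp
qed

text \<open>Integrating \<open>f (g\<^sup>-\<^sup>1 h)\<close> in both orders shows that a left invariant probability measure is
  invariant under inversion.\<close>

lemma hI_adj:
  assumes f: "continuous_on (unitary_sub B) f"
  shows "hI B (\<lambda>A. f (adjm A)) = hI B f"
proof -
  have c: "continuous_on (unitary_sub B \<times> unitary_sub B) (\<lambda>(x, y). f (adjm x ** y))"
    unfolding case_prod_unfold
    by (rule continuous_on_compose2[OF f])
      (auto intro!: continuous_intros unitary_sub_mul unitary_sub_adj)
  have "hI B f = hI B (\<lambda>x. hI B (\<lambda>y. f (adjm x ** y)))"
  proof -
    have "hI B (\<lambda>x. hI B (\<lambda>y. f (adjm x ** y))) = hI B (\<lambda>x. hI B f)"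
      by (intro hI_cong hI_left f unitary_sub_adj)
    then show ?thesis by simp
  qed
  also have "\<dots> = hI B (\<lambda>y. hI B (\<lambda>x. f (adjm x ** y)))"
    by (rule hI_fubini[OF c])
  also have "\<dots> = hI B (\<lambda>y. hI B (\<lambda>x. f (adjm x)))"
  proof (rule hI_cong)
    fix y assume y: "y \<in> unitary_sub B"
    have "hI B (\<lambda>x. f (adjm (adjm y ** x))) = hI B (\<lambda>x. f (adjm x))"
      by (rule hI_left[OF continuous_on_inverse_arg[OF f] unitary_sub_adj[OF y]])
    then show "hI B (\<lambda>x. f (adjm x ** y)) = hI B (\<lambda>x. f (adjm x))"
      by (simp add: adjm_mul)
  qed
  finally show ?thesis by simp
qed

lemma hI_right:
  assumes f: "continuous_on (unitary_sub B) f" and g: "g \<in> unitary_sub B"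
  shows "hI B (\<lambda>A. f (A ** g)) = hI B f"
proof -
  have "hI B (\<lambda>A. f (A ** g)) = hI B (\<lambda>A. f (adjm A ** g))"
    by (rule hI_adj[OF continuous_on_right_translate[OF f g], symmetric])
  also have "\<dots> = hI B (\<lambda>A. f (adjm (adjm g ** A)))"
    by (simp add: adjm_mul)
  also have "\<dots> = hI B (\<lambda>A. f (adjm A))"
    by (rule hI_left[OF continuous_on_inverse_arg[OF f] unitary_sub_adj[OF g]])
  finally show ?thesis using hI_adj[OF f] by simp
qed

text \<open>Finitely many translates of the open set where \<open>Re f\<close> is positive cover the
  compact group. The sum of the corresponding translates of f has a positive minimum, and each
  translate has the same integral as f.\<close>

lemma hI_pos:
  assumes f: "continuous_on (unitary_sub B) f" and g: "g \<in> unitary_sub B"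
    and nn: "\<And>A. A \<in> unitary_sub B \<Longrightarrow> 0 \<le> Re (f A)" and pos: "Re (f g) > 0"
  shows "Re (hI B f) > 0"
proof -
  let ?S = "unitary_sub B"
  \<comment> \<open>The translate that carries x to g, hence is positive near x.\<close>
  define t where "t = (\<lambda>x A. f (g ** adjm x ** A))"
  have gx: "g ** adjm x \<in> ?S" if "x \<in> ?S" for x by (intro unitary_sub_mul unitary_sub_adj g that)
  have ct: "continuous_on ?S (t x)" if "x \<in> ?S" for x
    unfolding t_def by (rule continuous_on_left_translate[OF f gx[OF that]])
  have "\<exists>T. open T \<and> x \<in> T \<and> (\<forall>A\<in>?S \<inter> T. Re (t x A) > 0)" if x: "x \<in> ?S" for x
  proof -
    have "Re (t x x) > 0"
      using x pos by (simp add: t_def adj_cancel_right' unitary_subD)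
    moreover have "continuous_on ?S (\<lambda>A. Re (t x A))" by (intro continuous_intros ct x)
    ultimately obtain T where "open T" "x \<in> T" "\<forall>A\<in>?S. A \<in> T \<longrightarrow> Re (t x A) \<in> {0<..}"
      using x unfolding continuous_on_topological by (metis greaterThan_iff open_greaterThan)
    then show ?thesis by (intro exI[of _ T]) auto
  qed
  then obtain T where T: "\<And>x. x \<in> ?S \<Longrightarrow> open (T x) \<and> x \<in> T x \<and> (\<forall>A\<in>?S \<inter> T x. Re (t x A) > 0)"
    by metis
  have "?S \<subseteq> (\<Union>x\<in>?S. T x)" using T by blast
  then obtain D where D: "D \<subseteq> ?S" "finite D" "?S \<subseteq> (\<Union>x\<in>D. T x)"
    using compactE_image[OF compact_unitary_sub[of B], of ?S T] T by metis
  define s where "s = (\<lambda>A. \<Sum>x\<in>D. t x A)"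
  have cs: "continuous_on ?S s" unfolding s_def using D ct by (intro continuous_on_sum) auto
  have spos: "Re (s A) > 0" if A: "A \<in> ?S" for A
  proof -
    obtain x where x: "x \<in> D" "A \<in> T x" using D A by blast
    have "0 < Re (t x A)" using x T D A by blast
    also have "\<dots> \<le> (\<Sum>x\<in>D. Re (t x A))"
      using D x A nn gx unfolding t_def by (intro member_le_sum) (auto intro!: nn unitary_sub_mul unitary_sub_adj g)
    finally show ?thesis by (simp add: s_def)
  qed
  have "continuous_on ?S (\<lambda>A. Re (s A))" by (intro continuous_intros cs)
  then obtain A0 where A0: "A0 \<in> ?S" "\<And>A. A \<in> ?S \<Longrightarrow> Re (s A0) \<le> Re (s A)"
    using continuous_attains_inf[OF compact_unitary_sub[of B]] unitary_sub_one[of B] by blast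
  have "Re (s A0) = Re (hI B (\<lambda>_. s A0))" by simp
  also have "\<dots> \<le> Re (hI B s)" by (intro hI_mono cs A0(2)) auto
  also have "hI B s = (\<Sum>x\<in>D. hI B (t x))" unfolding s_def using D ct by (intro hI_sum) auto
  also have "\<dots> = (\<Sum>x\<in>D. hI B f)"
    unfolding t_def using D gx by (intro sum.cong refl hI_left f) auto
  finally have "Re (s A0) \<le> real (card D) * Re (hI B f)" by simp
  then show ?thesis using spos[OF A0(1)] by (smt (verit) mult_nonneg_nonpos of_nat_0_le_iff)
qed

text \<open>The normalised measures with density \<open>F\<^sup>N\<close> concentrate on the set where \<open>F = 1\<close>.\<close>

lemma hI_power_concentration:
  fixes F :: "complex^'n^'n \<Rightarrow> real" and c :: "complex^'n^'n \<Rightarrow> complex"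
  assumes F: "continuous_on (unitary_sub B) F" and c: "continuous_on (unitary_sub B) c"
    and F01: "\<And>A. A \<in> unitary_sub B \<Longrightarrow> 0 \<le> F A \<and> F A \<le> 1"
    and g: "g \<in> unitary_sub B" "F g = 1"
    and c0: "\<And>A. A \<in> unitary_sub B \<Longrightarrow> F A = 1 \<Longrightarrow> c A = 0"
    and e: "e > 0"
  shows "\<exists>N. norm (hI B (\<lambda>A. complex_of_real (F A ^ N) * c A)) \<le> e * Re (hI B (\<lambda>A. complex_of_real (F A ^ N)))"
proof -
  let ?S = "unitary_sub B"
  define K where "K = {A \<in> ?S. norm (c A) \<ge> e/2}"
  obtain C where C: "C > 0" "\<And>A. A \<in> ?S \<Longrightarrow> norm (c A) \<le> C"
    using continuous_unitary_sub_bounded[OF c] by blast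
  have "compact K"
  proof -
    have "closedin (top_of_set ?S) (?S \<inter> (\<lambda>A. norm (c A)) -` {e/2..})"
      by (intro continuous_closedin_preimage continuous_intros c)
    moreover have "K = ?S \<inter> (\<lambda>A. norm (c A)) -` {e/2..}" by (auto simp: K_def)
    ultimately show ?thesis using closedin_compact compact_unitary_sub by metis
  qed
  have KS: "K \<subseteq> ?S" by (auto simp: K_def)
  obtain d where d: "0 \<le> d" "d < 1" "\<And>A. A \<in> K \<Longrightarrow> F A \<le> d"
  proof (cases "K = {}")
    case True
    then show ?thesis using that[of 0] by auto
  next
    case False
    then obtain A0 where A0: "A0 \<in> K" "\<And>A. A \<in> K \<Longrightarrow> F A \<le> F A0"
      using continuous_attains_sup[OF \<open>compact K\<close> False continuous_on_subset[OF F KS]] by blast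
    have "c A0 \<noteq> 0" using A0 e by (auto simp: K_def)
    then have "F A0 \<noteq> 1" using c0 A0 KS by blast
    then show ?thesis using that[of "F A0"] A0 F01 KS by (metis less_eq_real_def subsetD)
  qed
  \<comment> \<open>Since d < d' < 1, the contribution of K, at most C d^N, becomes negligible: the
    bump J, supported where F > d', bounds the integral of F^N below by d'^N times a positive
    number.\<close>
  define d' where "d' = (1 + d) / 2"
  have d': "d < d'" "d' < 1" "0 < d'" using d by (auto simp: d'_def)
  define J where "J = (\<lambda>A. complex_of_real (max 0 (F A - d')))"
  have cJ: "continuous_on ?S J" unfolding J_def by (intro continuous_intros F)
  have j: "Re (hI B J) > 0"
    by (rule hI_pos[OF cJ g(1)]) (use d' g in \<open>auto simp: J_def\<close>)
  have "(\<lambda>N. (d / d') ^ N) \<longlonglongrightarrow> 0"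
    using d d' by (intro LIMSEQ_realpow_zero) auto
  moreover have "e * Re (hI B J) / (2 * C) > 0" using e j C by simp
  ultimately obtain N where N: "(d / d') ^ N < e * Re (hI B J) / (2 * C)"
    by (metis (no_types, lifting) eventually_sequentially order_refl order_tendstoD(2))
  have cF: "continuous_on ?S (\<lambda>A. complex_of_real (F A ^ N))" by (intro continuous_intros F)
  have low: "d' ^ N * Re (hI B J) \<le> Re (hI B (\<lambda>A. complex_of_real (F A ^ N)))"
  proof -
    have "d' ^ N * Re (hI B J) = Re (hI B (\<lambda>A. complex_of_real (d' ^ N) * J A))"
      by (simp add: hI_mult_left)
    also have "\<dots> \<le> Re (hI B (\<lambda>A. complex_of_real (F A ^ N)))"
    proof (rule hI_mono)
      fix A assume A: "A \<in> ?S"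
      have "d' ^ N * max 0 (F A - d') \<le> F A ^ N"
      proof (cases "F A > d'")
        case True
        have "d' ^ N * max 0 (F A - d') \<le> d' ^ N * 1"
          using F01[OF A] d' by (intro mult_left_mono) auto
        also have "\<dots> \<le> F A ^ N" using True d' by (simp add: power_mono)
        finally show ?thesis .
      next
        case False
        then show ?thesis using F01[OF A] by simp
      qed
      then show "Re (complex_of_real (d' ^ N) * J A) \<le> Re (complex_of_real (F A ^ N))"
        by (simp add: J_def)
    qed (intro continuous_intros cJ cF)+
    finally show ?thesis .
  qed
  have "norm (hI B (\<lambda>A. complex_of_real (F A ^ N) * c A))
      \<le> Re (hI B (\<lambda>A. complex_of_real (e/2) * complex_of_real (F A ^ N) + complex_of_real (C * d ^ N)))"
  proof (rule hI_norm_le)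
    fix A assume A: "A \<in> ?S"
    have "F A ^ N * norm (c A) \<le> e/2 * F A ^ N + C * d ^ N"
    proof (cases "A \<in> K")
      case True
      have "F A ^ N * norm (c A) \<le> d ^ N * C"
        using d True C A F01[OF A] by (intro mult_mono power_mono) auto
      then show ?thesis using e F01[OF A] by (simp add: mult.commute add_increasing)
    next
      case False
      then have "F A ^ N * norm (c A) \<le> F A ^ N * (e/2)"
        using F01[OF A] A by (intro mult_left_mono) (auto simp: K_def)
      then show ?thesis using C d by (simp add: mult.commute add_increasing2)
    qed
    then show "norm (complex_of_real (F A ^ N) * c A) \<le> Re (complex_of_real (e/2) * complex_of_real (F A ^ N) + complex_of_real (C * d ^ N))"
      using F01[OF A] by (simp add: norm_mult norm_power)
  qed (intro continuous_intros c F)+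
  also have "\<dots> = e/2 * Re (hI B (\<lambda>A. complex_of_real (F A ^ N))) + C * d ^ N"
    by (subst hI_add, (intro continuous_intros F)+, subst hI_mult_left) simp
  also have "C * d ^ N \<le> e/2 * (d' ^ N * Re (hI B J))"
  proof -
    have "C * d ^ N = C * d' ^ N * (d / d') ^ N" using d' by (simp add: power_divide)
    also have "\<dots> \<le> C * d' ^ N * (e * Re (hI B J) / (2 * C))"
      using N C d' by (intro mult_left_mono) auto
    finally show ?thesis using C by (simp add: field_simps)
  qed
  also have "\<dots> \<le> e/2 * Re (hI B (\<lambda>A. complex_of_real (F A ^ N)))"
    using low e by (intro mult_left_mono) auto
  finally have "norm (hI B (\<lambda>A. complex_of_real (F A ^ N) * c A)) \<le> e * Re (hI B (\<lambda>A. complex_of_real (F A ^ N)))"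
    by simp
  then show ?thesis by blast
qed

subsection \<open>Moments of a matrix entry\<close>

definition mom :: "'n set \<Rightarrow> 'n \<Rightarrow> nat \<Rightarrow> real" where
  "mom B q N = Re (hI B (\<lambda>k. complex_of_real (cmod (k$q$q) ^ (2 * N))))"

lemma of_real_mom: "complex_of_real (mom B q N) = hI B (\<lambda>k. complex_of_real (cmod (k$q$q) ^ (2 * N)))"
  unfolding mom_def by (rule hI_of_real[symmetric])

lemma cin_axis_left: "cin (axis i z) w = cnj z * w$i"
  by (simp add: cin_def axis_def if_distrib[of "\<lambda>x. x * _"] if_distrib[of cnj] cong: if_cong)

text \<open>Column q of a Haar distributed element is uniform on the unit sphere over B. An element
  of U_B rotates the coefficient vector to a multiple of the q-th basis vector, which reduces every
  linear form to the single entry (q, q).\<close>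

lemma hI_abs_linear_power:
  assumes q: "q \<in> B"
  shows "hI B (\<lambda>k. complex_of_real (cmod (\<Sum>j\<in>UNIV. x j * k$j$q) ^ (2 * N)))
    = complex_of_real ((\<Sum>j\<in>B. (cmod (x j))^2) ^ N * mom B q N)"
proof -
  \<comment> \<open>Truncation to B loses nothing: outside B the entries of column q are 0, as q
    lies in B.\<close>
  define y :: "complex^'n" where "y = (\<chi> j. if j \<in> B then cnj (x j) else 0)"
  define r where "r = sqrt (\<Sum>j\<in>B. (cmod (x j))^2)"
  have r2: "r^2 = (\<Sum>j\<in>B. (cmod (x j))^2)" by (simp add: r_def sum_nonneg)
  have "(\<Sum>j\<in>UNIV. (cmod (y$j))^2) = (\<Sum>j\<in>UNIV. if j \<in> B then (cmod (x j))^2 else 0)"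
    by (intro sum.cong refl) (simp add: y_def)
  also have "\<dots> = r^2" by (simp add: r2 sum.If_cases)
  finally have yy: "cin y y = complex_of_real (r^2)" by (simp add: cin_real)
  have "cin (axis q (complex_of_real r)) (axis q (complex_of_real r)) = complex_of_real (r^2)"
    by (simp add: cin_def axis_def power2_eq_square if_distrib[of "\<lambda>x. _ * x"] if_distrib[of cnj] cong: if_cong)
  then obtain h where h: "h \<in> unitary_sub B" "h *v y = axis q (complex_of_real r)"
    using unitary_sub_transitive[of y "axis q (complex_of_real r)" B] yy q
    by (force simp: y_def axis_def)
  have *: "(\<Sum>j\<in>UNIV. x j * k$j$q) = complex_of_real r * (h ** k)$q$q" if k: "k \<in> unitary_sub B" for k
  proof -
    have "x j * k$j$q = cnj (y$j) * (k *v axis q 1)$j" for j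
      using unitary_sub_nth[OF k, of j q] q by (auto simp: y_def mult_axis_nth)
    then have "(\<Sum>j\<in>UNIV. x j * k$j$q) = cin y (k *v axis q 1)" by (simp add: cin_def)
    also have "\<dots> = cin (h *v y) (h *v (k *v axis q 1))"
      by (rule cin_mult_unitary[OF unitary_subD[OF h(1)], symmetric])
    finally show ?thesis by (simp add: h(2) cin_axis_left matrix_vector_mul_assoc mult_axis_nth)
  qed
  have "hI B (\<lambda>k. complex_of_real (cmod (\<Sum>j\<in>UNIV. x j * k$j$q) ^ (2 * N)))
      = hI B (\<lambda>k. complex_of_real ((r^2)^N) * complex_of_real (cmod ((h ** k)$q$q) ^ (2 * N)))"
    by (intro hI_cong) (simp add: * norm_mult power_mult_distrib power_mult)
  also have "\<dots> = complex_of_real ((r^2)^N) * hI B (\<lambda>k. complex_of_real (cmod ((h ** k)$q$q) ^ (2 * N)))"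
    by (rule hI_mult_left)
  also have "hI B (\<lambda>k. complex_of_real (cmod ((h ** k)$q$q) ^ (2 * N))) = complex_of_real (mom B q N)"
    unfolding of_real_mom by (rule hI_left[OF _ h(1)]) (intro continuous_intros)
  finally show ?thesis by (simp add: r2)
qed

lemma hI_entry_power:
  assumes "q \<in> B" "i \<in> B"
  shows "hI B (\<lambda>k. complex_of_real (cmod (k$i$q) ^ (2 * N))) = complex_of_real (mom B q N)"
proof -
  have "(\<Sum>j\<in>UNIV. (if j = i then 1 else 0) * k$j$q) = k$i$q" for k :: "complex^'n^'n"
    by (simp add: if_distrib[of "\<lambda>x. x * _"] cong: if_cong)
  moreover have "(\<Sum>j\<in>B. (cmod (if j = i then 1 else 0))^2) = 1"
    using assms by (simp add: if_distrib[of cmod] if_distrib[of "\<lambda>x. x^2"] cong: if_cong)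
  ultimately show ?thesis
    using hI_abs_linear_power[OF assms(1), of "\<lambda>j. if j = i then 1 else 0" N] by simp
qed

lemma unitary_sub_col:
  assumes "k \<in> unitary_sub B" "q \<in> B"
  shows "(\<Sum>j\<in>B. (cmod (k$j$q))^2) = 1"
proof -
  have "(\<Sum>j\<in>B. (cmod (k$j$q))^2) = (\<Sum>j\<in>UNIV. (cmod (k$j$q))^2)"
    using unitary_sub_nth[OF assms(1), of _ q] assms(2)
    by (intro sum.mono_neutral_left) auto
  then show ?thesis using unitary_col[OF unitary_subD[OF assms(1)]] by simp
qed

lemma unitary_sub_row:
  assumes "k \<in> unitary_sub B" "q \<in> B"
  shows "(\<Sum>j\<in>B. (cmod (k$q$j))^2) = 1"
  using unitary_sub_col[OF unitary_sub_adj[OF assms(1)] assms(2)] by simp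

text \<open>The entries of a column over B have equal second moments, and their squared moduli add
  up to 1.\<close>

lemma mom_1:
  assumes q: "q \<in> B"
  shows "mom B q 1 = 1 / real (card B)"
proof -
  have "1 = hI B (\<lambda>k. \<Sum>j\<in>B. complex_of_real (cmod (k$j$q) ^ (2 * 1)))"
  proof -
    have "hI B (\<lambda>k. \<Sum>j\<in>B. complex_of_real (cmod (k$j$q) ^ (2 * 1))) = hI B (\<lambda>k. 1)"
    proof (rule hI_cong)
      fix k assume "k \<in> unitary_sub B"
      then have "(\<Sum>j\<in>B. (cmod (k$j$q))^2) = 1" using unitary_sub_col q by blast
      then have "complex_of_real (\<Sum>j\<in>B. (cmod (k$j$q))^2) = 1" by (simp only: of_real_1)
      then show "(\<Sum>j\<in>B. complex_of_real (cmod (k$j$q) ^ (2 * 1))) = 1" by simp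
    qed
    then show ?thesis by simp
  qed
  also have "\<dots> = (\<Sum>j\<in>B. hI B (\<lambda>k. complex_of_real (cmod (k$j$q) ^ (2 * 1))))"
    by (intro hI_sum continuous_intros)
  also have "\<dots> = (\<Sum>j\<in>B. complex_of_real (mom B q 1))"
    by (intro sum.cong refl hI_entry_power q)
  also have "\<dots> = complex_of_real (real (card B) * mom B q 1)" by simp
  finally have "real (card B) * mom B q 1 = 1" by (metis of_real_eq_1_iff)
  moreover have "card B \<noteq> 0" using q by auto
  ultimately show ?thesis by (simp add: field_simps)
qed

text \<open>Over the fourth roots of unity z, both z and z^2 average to 0, so among the mixed terms
  only |a|^2 |b|^2 survives. Square roots of unity would leave a term with z^2.\<close>

lemma sum_fourth_roots_norm4:
  fixes a b :: complex
  shows "cmod (a + b) ^ 4 + cmod (a - b) ^ 4 + cmod (a + \<i> * b) ^ 4 + cmod (a - \<i> * b) ^ 4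
    = 4 * (cmod a ^ 4 + cmod b ^ 4 + 4 * ((cmod a)^2 * (cmod b)^2))"
proof -
  have "x ^ 4 = (x^2)^2" for x :: real by simp
  then show ?thesis
    by (simp only: cmod_power2) (simp add: power2_eq_square algebra_simps)
qed

text \<open>Invariance of the fourth moment under the rotations \<open>(e\<^sub>i + \<zeta> e\<^sub>j) / \<surd>2\<close>, \<open>\<zeta>\<^sup>4 = 1\<close>,
  forces the mixed moment to be half of the pure one.\<close>

lemma mom_2:
  assumes q: "q \<in> B"
  shows "mom B q 2 = 2 / (real (card B) * (real (card B) + 1))"
proof -
  let ?A = "mom B q 2"
  define X where "X = (\<lambda>i j. hI B (\<lambda>k. complex_of_real ((cmod (k$i$q))^2 * (cmod (k$j$q))^2)))"
  have cX: "continuous_on (unitary_sub B) (\<lambda>k. complex_of_real ((cmod (k$i$q))^2 * (cmod (k$j$q))^2))" for i j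
    by (intro continuous_intros)
  have Xii: "X i i = complex_of_real ?A" if "i \<in> B" for i
    using hI_entry_power[OF q that, of 2] by (simp add: X_def power2_eq_square power4_eq_xxxx mult.assoc)
  have Xij: "X i j = complex_of_real (?A / 2)" if ij: "i \<in> B" "j \<in> B" "i \<noteq> j" for i j
  proof -
    \<comment> \<open>The coefficient vector has squared length 2, so the fourth moment is
      multiplied by 2^2, whatever the phase z.\<close>
    have lin: "hI B (\<lambda>k. complex_of_real (cmod (k$i$q + z * k$j$q) ^ 4)) = complex_of_real (4 * ?A)" if z: "cmod z = 1" for z
    proof -
      let ?x = "\<lambda>l. if l = i then 1 else if l = j then z else 0"
      have 1: "(\<Sum>l\<in>UNIV. ?x l * k$l$q) = k$i$q + z * k$j$q" for k :: "complex^'n^'n"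
      proof -
        have "(\<Sum>l\<in>UNIV. ?x l * k$l$q) = (\<Sum>l\<in>{i,j}. ?x l * k$l$q)"
          by (rule sum.mono_neutral_right) auto
        then show ?thesis using ij by simp
      qed
      have "(\<Sum>l\<in>B. (cmod (?x l))^2) = (\<Sum>l\<in>{i,j}. (cmod (?x l))^2)"
        using ij by (intro sum.mono_neutral_right) auto
      then have "(\<Sum>l\<in>B. (cmod (?x l))^2) = 2" using ij z by simp
      then show ?thesis using hI_abs_linear_power[OF q, of ?x 2] by (simp add: 1)
    qed
    have cl: "continuous_on (unitary_sub B) (\<lambda>k. complex_of_real (cmod (k$i$q + z * k$j$q) ^ 4))" for z
      by (intro continuous_intros)
    have "complex_of_real (16 * ?A) = hI B (\<lambda>k. complex_of_real (cmod (k$i$q + 1 * k$j$q) ^ 4)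
        + complex_of_real (cmod (k$i$q + (-1) * k$j$q) ^ 4)
        + complex_of_real (cmod (k$i$q + \<i> * k$j$q) ^ 4) + complex_of_real (cmod (k$i$q + (-\<i>) * k$j$q) ^ 4))"
      by (simp only: hI_add cl continuous_on_add) (simp only: lin norm_one norm_minus_cancel norm_ii, simp)
    also have "\<dots> = hI B (\<lambda>k. 4 * (complex_of_real ((cmod (k$i$q))^2 * (cmod (k$i$q))^2)
        + complex_of_real ((cmod (k$j$q))^2 * (cmod (k$j$q))^2)
        + 4 * complex_of_real ((cmod (k$i$q))^2 * (cmod (k$j$q))^2)))"
    proof (rule hI_cong)
      fix k :: "complex^'n^'n"
      have "complex_of_real (cmod (k$i$q + 1 * k$j$q) ^ 4)
        + complex_of_real (cmod (k$i$q + (-1) * k$j$q) ^ 4)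
        + complex_of_real (cmod (k$i$q + \<i> * k$j$q) ^ 4) + complex_of_real (cmod (k$i$q + (-\<i>) * k$j$q) ^ 4)
        = complex_of_real (cmod (k$i$q + k$j$q) ^ 4 + cmod (k$i$q - k$j$q) ^ 4
          + cmod (k$i$q + \<i> * k$j$q) ^ 4 + cmod (k$i$q - \<i> * k$j$q) ^ 4)"
        by simp
      also have "\<dots> = complex_of_real (4 * (cmod (k$i$q) ^ 4 + cmod (k$j$q) ^ 4 + 4 * ((cmod (k$i$q))^2 * (cmod (k$j$q))^2)))"
        by (simp only: sum_fourth_roots_norm4)
      finally show "complex_of_real (cmod (k$i$q + 1 * k$j$q) ^ 4)
        + complex_of_real (cmod (k$i$q + (-1) * k$j$q) ^ 4)
        + complex_of_real (cmod (k$i$q + \<i> * k$j$q) ^ 4) + complex_of_real (cmod (k$i$q + (-\<i>) * k$j$q) ^ 4)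
        = 4 * (complex_of_real ((cmod (k$i$q))^2 * (cmod (k$i$q))^2)
        + complex_of_real ((cmod (k$j$q))^2 * (cmod (k$j$q))^2)
        + 4 * complex_of_real ((cmod (k$i$q))^2 * (cmod (k$j$q))^2))"
        by (simp add: power2_eq_square power4_eq_xxxx mult.assoc)
    qed
    also have "\<dots> = 4 * (X i i + X j j + 4 * X i j)"
      unfolding hI_mult_left X_def by (subst hI_add, (intro continuous_intros)+)+ (simp only: hI_mult_left)
    finally have "complex_of_real (16 * ?A) = 4 * (2 * complex_of_real ?A + 4 * X i j)"
      using Xii ij by simp
    then show ?thesis by simp
  qed
  \<comment> \<open>With m = card B and A the fourth moment, integrating the square of the column
    identity gives 1 = m A + m (m - 1) A / 2 = m (m + 1) A / 2.\<close>
  have "1 = hI B (\<lambda>k. \<Sum>i\<in>B. \<Sum>j\<in>B. complex_of_real ((cmod (k$i$q))^2 * (cmod (k$j$q))^2))"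
  proof -
    have "hI B (\<lambda>k. \<Sum>i\<in>B. \<Sum>j\<in>B. complex_of_real ((cmod (k$i$q))^2 * (cmod (k$j$q))^2)) = hI B (\<lambda>k. 1)"
    proof (rule hI_cong)
      fix k assume k: "k \<in> unitary_sub B"
      have "(\<Sum>i\<in>B. \<Sum>j\<in>B. (cmod (k$i$q))^2 * (cmod (k$j$q))^2) = 1"
        using unitary_sub_col[OF k q] by (simp add: sum_product[symmetric])
      then have "complex_of_real (\<Sum>i\<in>B. \<Sum>j\<in>B. (cmod (k$i$q))^2 * (cmod (k$j$q))^2) = 1" by simp
      then show "(\<Sum>i\<in>B. \<Sum>j\<in>B. complex_of_real ((cmod (k$i$q))^2 * (cmod (k$j$q))^2)) = 1"
        by (simp only: of_real_sum)
    qed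
    then show ?thesis by simp
  qed
  also have "\<dots> = (\<Sum>i\<in>B. \<Sum>j\<in>B. X i j)"
    unfolding X_def by (simp only: hI_sum cX continuous_on_sum)
  also have "\<dots> = (\<Sum>i\<in>B. \<Sum>j\<in>B. complex_of_real (?A / 2) + (if j = i then complex_of_real (?A / 2) else 0))"
    using Xii Xij by (intro sum.cong refl) (auto simp flip: of_real_add)
  also have "\<dots> = complex_of_real (real (card B) * (real (card B) * (?A / 2) + ?A / 2))"
    by (simp add: sum.distrib algebra_simps)
  finally have "real (card B) * (real (card B) * (?A / 2) + ?A / 2) = 1"
    by (metis of_real_eq_1_iff)
  moreover have "real (card B) * (real (card B) + 1) \<noteq> 0" using q by auto
  ultimately show ?thesis by (simp add: eq_divide_eq algebra_simps)
qed

text \<open>Entries have modulus at most 1. All odd N are thereby controlled by N = 1 and all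
  positive even N by N = 2.\<close>

lemma mom_antimono:
  assumes "M \<le> N"
  shows "mom B q N \<le> mom B q M"
  unfolding mom_def
proof (rule hI_mono)
  fix A :: "complex^'n^'n" assume "A \<in> unitary_sub B"
  then have "cmod (A$q$q) \<le> 1" using unitary_entry_le1 unitary_subD by blast
  then show "Re (complex_of_real (cmod (A$q$q) ^ (2 * N))) \<le> Re (complex_of_real (cmod (A$q$q) ^ (2 * M)))"
    using assms by (simp add: power_decreasing)
qed (intro continuous_intros)+

lemma mom_nonneg: "mom B q N \<ge> 0"
proof -
  have "Re (hI B (\<lambda>_. 0)) \<le> mom B q N"
    unfolding mom_def by (rule hI_mono) (auto intro!: continuous_intros)
  then show ?thesis by simp
qed

lemma diag_refl_commute:
  fixes k :: "complex^'n^'n"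
  assumes k: "k \<in> unitary_sub (B - {p})"
  shows "refl_mat (axis p 1) z ** k = k ** refl_mat (axis p 1) z"
proof -
  have o: "outer (axis p 1) (axis p 1) ** k = outer (axis p 1) (axis p 1)"
    "k ** outer (axis p 1) (axis p 1) = outer (axis p 1) (axis p 1)"
    using unitary_sub_nth[OF k, of p] unitary_sub_nth[OF k, of _ p]
    by (auto simp: vec_eq_iff matmul_nth axis_def if_distrib[of cnj] if_distrib[of "\<lambda>x. x * _"] if_distrib[of "\<lambda>x. _ * x"] cong: if_cong)
  show ?thesis
    by (simp add: refl_mat_def matrix_add_ldistrib matrix_add_rdistrib csm_mul_left csm_mul_right o)
qed

text \<open>Moments of an eigenfunction against the powers of \<open>|g\<^sub>p\<^sub>p|\<^sup>2\<close>: averaging \<open>|g\<^sub>p\<^sub>q|\<^sup>2\<^sup>N\<close> over the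
  stabiliser of \<open>e\<^sub>p\<close> gives a multiple of \<open>(1 - |g\<^sub>p\<^sub>p|\<^sup>2)\<^sup>N\<close>, so the recursion is triangular and the first
  non-vanishing moment determines the eigenvalue.\<close>

lemma zonal_eigenvalue_at_one:
  fixes c :: "complex^'n^'n \<Rightarrow> complex"
  assumes p: "p \<in> B" and q: "q \<in> B" and pq: "p \<noteq> q"
    and c: "continuous_on (unitary_sub B) c"
    and inv: "\<And>g k. g \<in> unitary_sub B \<Longrightarrow> k \<in> unitary_sub (B - {p}) \<Longrightarrow> c (g ** k) = c g"
    and eig: "\<And>g. g \<in> unitary_sub B \<Longrightarrow> hI (B - {p}) (\<lambda>k. c (g ** k ** swp p q)) = \<phi> * c g"
    and zero: "hI B c = 0" and phi: "\<phi> \<noteq> 0" and one: "c (mat 1) \<noteq> 0"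
  shows "\<exists>N\<ge>1. \<phi> = complex_of_real ((-1) ^ N * mom (B - {p}) q N)"
proof -
  let ?K = "B - {p}"
  have KB: "unitary_sub ?K \<subseteq> unitary_sub B" by (rule unitary_sub_mono) auto
  have qK: "q \<in> ?K" using q pq by auto
  have sB: "swp p q \<in> unitary_sub B" by (rule swp_unitary_sub[OF p q])
  \<comment> \<open>Such a g is a phase t at the coordinate p times an element of K, and c ignores
    the latter. The phase commutes with K and the transposition moves it to q, into K again; the
    eigenvalue equation at t and at 1 then agree, and \<phi> \<noteq> 0 can be cancelled.\<close>
  have const: "c g = c (mat 1)" if g: "g \<in> unitary_sub B" and gp: "cmod (g$p$p) = 1" for g
  proof -
    define z where "z = g$p$p"
    define t where "t = refl_mat (axis p 1 :: complex^'n) z"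
    have tp: "t \<in> unitary_sub {p}"
      unfolding t_def
    proof (rule refl_mat_unitary_sub)
      show "axis p (1::complex) $ i = 0" if "i \<notin> {p}" for i using that by (simp add: axis_def)
    qed (use gp in \<open>simp_all add: z_def\<close>)
    have tB: "t \<in> unitary_sub B" using unitary_sub_mono[of "{p}" B] p tp by auto
    define k where "k = adjm t ** g"
    have kB: "k \<in> unitary_sub B" unfolding k_def by (intro unitary_sub_mul unitary_sub_adj tB g)
    have col: "g$j$p = 0" if "j \<noteq> p" for j
    proof -
      have "(\<Sum>i\<in>UNIV. (cmod (g$i$p))^2) = (cmod (g$p$p))^2 + (\<Sum>i\<in>UNIV - {p}. (cmod (g$i$p))^2)"
        by (rule sum.remove) auto
      then have "(\<Sum>i\<in>UNIV - {p}. (cmod (g$i$p))^2) = 0"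
        using unitary_col[OF unitary_subD[OF g], of p] gp by simp
      then show ?thesis using that by (subst (asm) sum_nonneg_eq_0_iff) auto
    qed
    have zz: "cnj z * z = 1" using gp unfolding z_def
      by (metis complex_norm_square mult.commute of_real_1 power_one)
    have "k$j$p = (if j = p then 1 else 0)" for j
    proof -
      have "k$j$p = (\<Sum>l\<in>UNIV. cnj (t$l$j) * g$l$p)" by (simp add: k_def matmul_nth)
      also have "\<dots> = (\<Sum>l\<in>{p}. cnj (t$l$j) * g$l$p)"
        by (rule sum.mono_neutral_right) (auto simp: col)
      also have "\<dots> = cnj (t$p$j) * z" by (simp add: z_def)
      also have "\<dots> = (if j = p then 1 else 0)"
        using zz by (simp add: t_def refl_mat_def mat_def axis_def)
      finally show ?thesis .
    qed
    then have kK: "k \<in> unitary_sub ?K"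
      using unitary_sub_removeI[of k p ?K] kB p by (simp add: insert_absorb)
    have "g = t ** k" unfolding k_def using tB by (simp add: adj_cancel_left'[OF unitary_subD[OF tB]])
    then have "c g = c t" using inv[OF tB kK] by simp
    also have "c t = c (mat 1)"
    proof -
      define t' where "t' = swp p q ** t ** swp p q"
      have "t' \<in> unitary_sub (tau p q ` {p})" unfolding t'_def by (rule swp_conj_unitary_sub[OF tp])
      then have t': "t' \<in> unitary_sub ?K" using unitary_sub_mono[of "{q}" ?K] qK by auto
      have st: "swp p q ** t' = t ** swp p q"
        by (simp add: t'_def matrix_mul_assoc)
      have "\<phi> * c t = hI ?K (\<lambda>k. c (t ** k ** swp p q))" using eig[OF tB] by simp
      also have "\<dots> = hI ?K (\<lambda>k. c (mat 1 ** k ** swp p q))"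
      proof (rule hI_cong)
        fix k assume k: "k \<in> unitary_sub ?K"
        have "t ** k ** swp p q = (k ** swp p q) ** t'"
          using diag_refl_commute[OF k] st by (metis matrix_mul_assoc t_def)
        moreover have "k ** swp p q \<in> unitary_sub B" using k KB sB unitary_sub_mul by blast
        ultimately show "c (t ** k ** swp p q) = c (mat 1 ** k ** swp p q)"
          using inv t' by simp
      qed
      also have "\<dots> = \<phi> * c (mat 1)" using eig[of "mat 1"] by simp
      finally show ?thesis using phi by simp
    qed
    finally show ?thesis .
  qed
  define F where "F = (\<lambda>g::complex^'n^'n. (cmod (g$p$p))^2)"
  have cF: "continuous_on S F" for S unfolding F_def by (intro continuous_intros)
  define a where "a = (\<lambda>N. hI B (\<lambda>g. complex_of_real (F g ^ N) * c g))"
  have F01: "0 \<le> F g \<and> F g \<le> 1" if "g \<in> unitary_sub B" for g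
    using unitary_entry_le1[OF unitary_subD[OF that], of p p] by (simp add: F_def power_le_one)
  \<comment> \<open>If all moments vanished, concentrating F^N where F = 1 would give average 0 to c
    there, although c is constantly \<open>c (mat 1)\<close> \<noteq> 0 on that set.\<close>
  have ex: "\<exists>N. a N \<noteq> 0"
  proof (rule ccontr)
    assume "\<not> ?thesis"
    then have a0: "a N = 0" for N by blast
    define e where "e = cmod (c (mat 1)) / 2"
    have e: "e > 0" using one by (simp add: e_def)
    have F1: "F (mat 1) = 1" by (simp add: F_def mat_def)
    have "\<exists>N. norm (hI B (\<lambda>A. complex_of_real (F A ^ N) * (c A - c (mat 1)))) \<le> e * Re (hI B (\<lambda>A. complex_of_real (F A ^ N)))"
    proof (rule hI_power_concentration)
      show "c A - c (mat 1) = 0" if "A \<in> unitary_sub B" "F A = 1" for A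
        using const[OF that(1)] that(2) power2_eq_imp_eq[of "cmod (A$p$p)" 1] by (simp add: F_def)
    qed (use F01 F1 e in \<open>auto intro!: continuous_intros c cF\<close>)
    then obtain N where N: "norm (hI B (\<lambda>A. complex_of_real (F A ^ N) * (c A - c (mat 1)))) \<le> e * Re (hI B (\<lambda>A. complex_of_real (F A ^ N)))"
      by blast
    define J where "J = Re (hI B (\<lambda>A. complex_of_real (F A ^ N)))"
    have J: "J > 0" unfolding J_def
      by (rule hI_pos[of _ _ "mat 1"]) (use F01 F1 in \<open>auto intro!: continuous_intros cF\<close>)
    have "hI B (\<lambda>A. complex_of_real (F A ^ N) * (c A - c (mat 1)))
      = hI B (\<lambda>A. complex_of_real (F A ^ N) * c A - complex_of_real (F A ^ N) * c (mat 1))"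
      by (simp add: algebra_simps)
    also have "\<dots> = a N - hI B (\<lambda>A. complex_of_real (F A ^ N)) * c (mat 1)"
      unfolding a_def by (subst hI_diff) (auto intro!: continuous_intros cF c simp: hI_mult_right simp del: of_real_power)
    also have "hI B (\<lambda>A. complex_of_real (F A ^ N)) = complex_of_real J"
      unfolding J_def by (rule hI_of_real)
    finally have "norm (complex_of_real J * c (mat 1)) \<le> e * J" using N a0 by (simp add: J_def)
    then show False using J e by (simp add: norm_mult e_def)
  qed
  define N where "N = (LEAST N. a N \<noteq> 0)"
  have aN: "a N \<noteq> 0" unfolding N_def using ex by (rule LeastI_ex)
  have al: "a j = 0" if "j < N" for j using that not_less_Least unfolding N_def by blast
  have "N \<noteq> 0"
  proof
    assume "N = 0"
    then show False using aN zero by (simp add: a_def)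
  qed
  have c3: "continuous_on (unitary_sub B \<times> unitary_sub ?K) (\<lambda>(g, k). complex_of_real (F g ^ N) * c (g ** k ** swp p q))"
    unfolding case_prod_unfold
    by (intro continuous_intros continuous_on_compose2[OF cF[of UNIV]] continuous_on_compose2[OF c])
      (use KB sB in \<open>auto intro!: unitary_sub_mul\<close>)
  have c4: "continuous_on (unitary_sub ?K \<times> unitary_sub B) (\<lambda>(k, g). complex_of_real (cmod ((g ** k)$p$q) ^ (2*N)) * c g)"
    unfolding case_prod_unfold
    by (intro continuous_intros continuous_on_compose2[OF c]) auto
  define h where "h = (\<lambda>g. complex_of_real (cmod (g$p$q) ^ (2*N)) * c g)"
  have ch: "continuous_on (unitary_sub B) h" unfolding h_def by (intro continuous_intros c)
  \<comment> \<open>Right translation moves k and the transposition from c to the density, where the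
    entry (p, p) becomes (p, q). A second translation uses the K-invariance of c to put the average
    over K on the density alone.\<close>
  have "\<phi> * a N = hI B (\<lambda>g. hI ?K (\<lambda>k. complex_of_real (F g ^ N) * c (g ** k ** swp p q)))"
    unfolding a_def hI_mult_left[symmetric]
    by (intro hI_cong) (simp only: hI_mult_left eig mult_ac)
  also have "\<dots> = hI ?K (\<lambda>k. hI B (\<lambda>g. complex_of_real (F g ^ N) * c (g ** k ** swp p q)))"
    by (rule hI_fubini[OF c3])
  also have "\<dots> = hI ?K (\<lambda>k. hI B h)"
  proof (rule hI_cong)
    fix k assume k: "k \<in> unitary_sub ?K"
    define u where "u = k ** swp p q"
    have u: "u \<in> unitary_sub B" using k KB sB unitary_sub_mul unfolding u_def by blast
    have "hI B (\<lambda>g. h (g ** u)) = hI B h" by (rule hI_right[OF ch u])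
    moreover have "h (g ** u) = complex_of_real (F g ^ N) * c (g ** k ** swp p q)" for g
    proof -
      have "(g ** u)$p$q = (g ** k)$p$p"
        by (simp add: u_def matrix_mul_assoc mul_swp_nth)
      also have "\<dots> = g$p$p"
        using unitary_sub_nth[OF k, of _ p]
        by (simp add: matmul_nth if_distrib[of "\<lambda>x. _ * x"] cong: if_cong)
      finally show ?thesis by (simp add: h_def u_def F_def matrix_mul_assoc power_mult)
    qed
    ultimately show "hI B (\<lambda>g. complex_of_real (F g ^ N) * c (g ** k ** swp p q)) = hI B h" by simp
  qed
  also have "\<dots> = hI ?K (\<lambda>k. hI B (\<lambda>g. complex_of_real (cmod ((g ** k)$p$q) ^ (2*N)) * c g))"
  proof (rule hI_cong)
    fix k assume k: "k \<in> unitary_sub ?K"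
    then have kB: "k \<in> unitary_sub B" using KB by blast
    have "hI B h = hI B (\<lambda>g. h (g ** k))" by (rule hI_right[OF ch kB, symmetric])
    also have "\<dots> = hI B (\<lambda>g. complex_of_real (cmod ((g ** k)$p$q) ^ (2*N)) * c g)"
      by (intro hI_cong) (simp add: h_def inv k)
    finally show "hI B h = hI B (\<lambda>g. complex_of_real (cmod ((g ** k)$p$q) ^ (2*N)) * c g)" .
  qed
  also have "\<dots> = hI B (\<lambda>g. hI ?K (\<lambda>k. complex_of_real (cmod ((g ** k)$p$q) ^ (2*N)) * c g))"
    by (rule hI_fubini[OF c4])
  also have "\<dots> = hI B (\<lambda>g. complex_of_real (mom ?K q N) * (\<Sum>j\<le>N. (of_nat (N choose j) * (-1)^j) * (complex_of_real (F g ^ j) * c g)))"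
  proof (rule hI_cong)
    fix g assume g: "g \<in> unitary_sub B"
    have "(\<Sum>j\<in>B. (cmod (g$p$j))^2) = F g + (\<Sum>j\<in>?K. (cmod (g$p$j))^2)"
      unfolding F_def by (rule sum.remove) (use p in auto)
    then have s: "(\<Sum>j\<in>?K. (cmod (g$p$j))^2) = 1 - F g" using unitary_sub_row[OF g p] by simp
    have "hI ?K (\<lambda>k. complex_of_real (cmod ((g ** k)$p$q) ^ (2*N)) * c g)
      = hI ?K (\<lambda>k. complex_of_real (cmod (\<Sum>j\<in>UNIV. g$p$j * k$j$q) ^ (2*N))) * c g"
      by (simp only: hI_mult_right matmul_nth)
    also have "\<dots> = complex_of_real ((1 - F g)^N * mom ?K q N) * c g"
      using hI_abs_linear_power[OF qK, of "\<lambda>j. g$p$j" N] s by simp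
    also have "\<dots> = complex_of_real (mom ?K q N) * (complex_of_real ((1 - F g)^N) * c g)"
      by simp
    also have "complex_of_real ((1 - F g)^N) = (\<Sum>j\<le>N. of_nat (N choose j) * (-1)^j * complex_of_real (F g ^ j))"
      using binomial_ring[of "- complex_of_real (F g)" 1 N]
      by (simp add: power_minus[of "complex_of_real (F g)"] mult.assoc)
    finally show "hI ?K (\<lambda>k. complex_of_real (cmod ((g ** k)$p$q) ^ (2*N)) * c g)
      = complex_of_real (mom ?K q N) * (\<Sum>j\<le>N. (of_nat (N choose j) * (-1)^j) * (complex_of_real (F g ^ j) * c g))"
      by (simp add: sum_distrib_right mult.assoc)
  qed
  also have "\<dots> = complex_of_real (mom ?K q N) * (\<Sum>j\<le>N. (of_nat (N choose j) * (-1)^j) * a j)"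
    unfolding hI_mult_left a_def
    by (subst hI_sum) (auto intro!: continuous_intros cF c simp: hI_mult_left simp del: of_real_power)
  \<comment> \<open>By minimality of N only the top coefficient (-1)^N of (1 - F)^N meets a non-zero
    moment.\<close>
  also have "(\<Sum>j\<le>N. (of_nat (N choose j) * (-1)^j) * a j) = (\<Sum>j\<in>{N}. (of_nat (N choose j) * (-1)^j) * a j)"
    by (rule sum.mono_neutral_right) (auto simp: al)
  finally have "\<phi> * a N = complex_of_real ((-1)^N * mom ?K q N) * a N"
    by (simp add: mult.commute)
  then have "\<phi> = complex_of_real ((-1)^N * mom ?K q N)" using aN by simp
  then show ?thesis using \<open>N \<noteq> 0\<close> by (intro exI[of _ N]) auto
qed

text \<open>A left translation brings a point where c is non-zero to the identity. Then \<phi> is a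
  signed moment for U(m - 1), m = card B: for odd N at least minus the second moment 1/(m - 1), for
  even N at most the fourth moment 2/((m - 1) m).\<close>

lemma zonal_eigenvalue:
  fixes c :: "complex^'n^'n \<Rightarrow> complex"
  assumes p: "p \<in> B" and q: "q \<in> B" and pq: "p \<noteq> q"
    and c: "continuous_on (unitary_sub B) c"
    and inv: "\<And>g k. g \<in> unitary_sub B \<Longrightarrow> k \<in> unitary_sub (B - {p}) \<Longrightarrow> c (g ** k) = c g"
    and eig: "\<And>g. g \<in> unitary_sub B \<Longrightarrow> hI (B - {p}) (\<lambda>k. c (g ** k ** swp p q)) = complex_of_real \<phi> * c g"
    and zero: "hI B c = 0" and phi: "\<phi> \<noteq> 0" and g0: "g0 \<in> unitary_sub B" "c g0 \<noteq> 0"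
  shows "- 1 / (real (card B) - 1) \<le> \<phi> \<and> \<phi> \<le> 2 / (real (card B) * (real (card B) - 1))"
proof -
  define c' where "c' = (\<lambda>g. c (g0 ** g))"
  have "\<exists>N\<ge>1. complex_of_real \<phi> = complex_of_real ((-1) ^ N * mom (B - {p}) q N)"
  proof (rule zonal_eigenvalue_at_one[OF p q pq])
    show "continuous_on (unitary_sub B) c'" unfolding c'_def by (rule continuous_on_left_translate[OF c g0(1)])
    show "c' (g ** k) = c' g" if "g \<in> unitary_sub B" "k \<in> unitary_sub (B - {p})" for g k
      using inv[OF unitary_sub_mul[OF g0(1) that(1)] that(2)] by (simp add: c'_def matrix_mul_assoc)
    show "hI (B - {p}) (\<lambda>k. c' (g ** k ** swp p q)) = complex_of_real \<phi> * c' g" if "g \<in> unitary_sub B" for g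
      using eig[OF unitary_sub_mul[OF g0(1) that]] by (simp add: c'_def matrix_mul_assoc)
    show "hI B c' = 0" unfolding c'_def using hI_left[OF c g0(1)] zero by simp
  qed (use phi g0 in \<open>auto simp: c'_def\<close>)
  then obtain N where N: "N \<ge> 1" "\<phi> = (-1) ^ N * mom (B - {p}) q N"
    using of_real_eq_iff by blast
  have qK: "q \<in> B - {p}" using q pq by auto
  have "card B > 0" using p by (auto simp: card_gt_0_iff)
  then have cK: "real (card (B - {p})) = real (card B) - 1"
    using p by (simp add: of_nat_diff card_Diff_singleton)
  have "card {p, q} \<le> card B" using p q by (intro card_mono) auto
  then have b2: "real (card B) \<ge> 2" using pq by simp
  have m1: "mom (B - {p}) q N \<le> 1 / (real (card B) - 1)"
    using mom_antimono[OF N(1), of "B - {p}" q] mom_1[OF qK] cK by simp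
  have nn: "mom (B - {p}) q N \<ge> 0" by (rule mom_nonneg)
  show ?thesis
  proof (cases "even N")
    case True
    then have "N \<ge> 2" using N(1) by presburger
    then have "mom (B - {p}) q N \<le> 2 / (real (card B) * (real (card B) - 1))"
      using mom_antimono[of 2 N "B - {p}" q] mom_2[OF qK] cK by (simp add: mult.commute)
    moreover have "- 1 / (real (card B) - 1) \<le> 0" using b2 by simp
    moreover have "\<phi> = mom (B - {p}) q N" using N True by simp
    ultimately show ?thesis using nn by linarith
  next
    case False
    moreover have "0 \<le> 2 / (real (card B) * (real (card B) - 1))" using b2 by simp
    moreover have "\<phi> = - mom (B - {p}) q N" using N False by simp
    ultimately show ?thesis using m1 nn by linarith
  qed
qed

end

section \<open>The lower bound\<close>

declare zero_fun_def [simp del] plus_fun_def [simp del]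

definition sc :: "complex \<Rightarrow> (nat \<Rightarrow> complex) \<Rightarrow> nat \<Rightarrow> complex" where
  "sc a x = (\<lambda>k. a * x k)"

lemma sc_apply [simp]: "sc a x k = a * x k"
  by (simp add: sc_def)

lemma sum_fun_nth: "(\<Sum>i\<in>I. f i) k = (\<Sum>i\<in>I. f i k)" for f :: "'i \<Rightarrow> 'a \<Rightarrow> 'b::comm_monoid_add"
  by (induction I rule: infinite_finite_induct) auto

interpretation cv: vector_space sc
  by unfold_locales (auto simp: fun_eq_iff algebra_simps)

lemma cvecs_zero [simp]: "0 \<in> cvecs d"
  and cvecs_add: "x \<in> cvecs d \<Longrightarrow> y \<in> cvecs d \<Longrightarrow> x + y \<in> cvecs d"
  and cvecs_diff: "x \<in> cvecs d \<Longrightarrow> y \<in> cvecs d \<Longrightarrow> x - y \<in> cvecs d"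
  and cvecs_sc: "x \<in> cvecs d \<Longrightarrow> sc a x \<in> cvecs d"
  by (auto simp: cvecs_def)

lemma cvecs_sum: "(\<And>i. i \<in> I \<Longrightarrow> f i \<in> cvecs d) \<Longrightarrow> (\<Sum>i\<in>I. f i) \<in> cvecs d"
  by (induction I rule: infinite_finite_induct) (auto intro: cvecs_add)

lemma cvecs_eqI: "x \<in> cvecs d \<Longrightarrow> y \<in> cvecs d \<Longrightarrow> (\<And>i. i < d \<Longrightarrow> x i = y i) \<Longrightarrow> x = y"
  by (auto simp: cvecs_def fun_eq_iff) (metis not_le)

lemma mat_app_in [simp]: "mat_app d M x \<in> cvecs d"
  by (simp add: mat_app_def cvecs_def)

lemma mat_app_add: "mat_app d M (x + y) = mat_app d M x + mat_app d M y"
  by (auto simp: mat_app_def fun_eq_iff algebra_simps sum.distrib)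

lemma mat_app_diff: "mat_app d M (x - y) = mat_app d M x - mat_app d M y"
  by (auto simp: mat_app_def fun_eq_iff algebra_simps sum_subtractf)

lemma mat_app_sc: "mat_app d M (sc a x) = sc a (mat_app d M x)"
  by (auto simp: mat_app_def fun_eq_iff sum_distrib_left mult_ac)

lemma mat_app_zero [simp]: "mat_app d M 0 = 0"
  by (auto simp: mat_app_def fun_eq_iff)

lemma mat_app_sum: "mat_app d M (\<Sum>i\<in>I. f i) = (\<Sum>i\<in>I. mat_app d M (f i))"
  by (induction I rule: infinite_finite_induct)
    (simp_all only: sum.infinite sum.empty sum.insert mat_app_zero mat_app_add not_False_eq_True)

lemma eigenvalue_iff:
  "is_eigenvalue d M e \<longleftrightarrow> (\<exists>v\<in>cvecs d. v \<noteq> 0 \<and> mat_app d M v = sc e v)"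
  by (simp add: is_eigenvalue_def sc_def zero_fun_def)

locale herm_form =
  fixes d :: nat and h :: "nat \<Rightarrow> nat \<Rightarrow> complex"
  assumes herm: "h i j = cnj (h j i)"
    and posdef: "x \<in> cvecs d \<Longrightarrow> x \<noteq> 0 \<Longrightarrow> 0 < Re (\<Sum>i<d. \<Sum>j<d. cnj (x i) * h i j * x j)"
begin

definition H :: "(nat \<Rightarrow> complex) \<Rightarrow> (nat \<Rightarrow> complex) \<Rightarrow> complex" where
  "H x y = (\<Sum>i<d. \<Sum>j<d. cnj (x i) * h i j * y j)"

lemma H_pos: "x \<in> cvecs d \<Longrightarrow> x \<noteq> 0 \<Longrightarrow> 0 < Re (H x x)"
  using posdef by (simp add: H_def)

lemma H_cnj: "cnj (H x y) = H y x"
proof -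
  have "cnj (H x y) = (\<Sum>i<d. \<Sum>j<d. x i * h j i * cnj (y j))"
    by (simp add: H_def) (simp add: herm[symmetric])
  also have "\<dots> = H y x" unfolding H_def by (subst sum.swap) (simp add: mult_ac)
  finally show ?thesis .
qed

lemma H_add_right: "H x (y + z) = H x y + H x z"
  by (simp add: H_def algebra_simps sum.distrib)

lemma H_diff_right: "H x (y - z) = H x y - H x z"
  by (simp add: H_def algebra_simps sum_subtractf)

lemma H_sc_right: "H x (sc a y) = a * H x y"
  by (simp add: H_def sum_distrib_left mult_ac)

lemma H_zero_right [simp]: "H x 0 = 0"
  by (simp add: H_def)

lemma H_sum_right: "H x (\<Sum>i\<in>I. f i) = (\<Sum>i\<in>I. H x (f i))"
  by (induction I rule: infinite_finite_induct)
    (simp_all only: sum.infinite sum.empty sum.insert H_zero_right H_add_right not_False_eq_True)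

lemma H_add_left: "H (y + z) x = H y x + H z x"
  by (simp add: H_def algebra_simps sum.distrib)

lemma H_diff_left: "H (y - z) x = H y x - H z x"
  by (simp add: H_def algebra_simps sum_subtractf)

lemma H_sc_left: "H (sc a y) x = cnj a * H y x"
  by (simp add: H_def sum_distrib_left mult_ac)

lemma H_zero_left [simp]: "H 0 x = 0"
  by (simp add: H_def)

lemma H_eq_0_iff: "x \<in> cvecs d \<Longrightarrow> H x x = 0 \<longleftrightarrow> x = 0"
  using H_pos[of x] by force

lemma H_nonneg: "x \<in> cvecs d \<Longrightarrow> 0 \<le> Re (H x x)"
  by (cases "x = 0") (auto dest: H_pos)

lemma continuous_on_H:
  assumes "\<And>i. continuous_on S (\<lambda>t. f t i)" "\<And>i. continuous_on S (\<lambda>t. g t i)"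
  shows "continuous_on S (\<lambda>t. H (f t) (g t))"
  unfolding H_def by (intro continuous_intros assms)

text \<open>The Rayleigh quotient attains its maximum e at some x0. As M - e is negative
  semidefinite and its form vanishes at x0, moving x0 in the direction (M - e) x0 shows that this
  direction is 0.\<close>

lemma self_adjoint_max_eigenvalue:
  assumes sa: "\<And>x y. x \<in> cvecs d \<Longrightarrow> y \<in> cvecs d \<Longrightarrow> H (mat_app d M x) y = H x (mat_app d M y)"
    and d: "1 \<le> d"
  shows "\<exists>e::real. is_eigenvalue d M (complex_of_real e) \<and>
    (\<forall>x\<in>cvecs d. Re (H x (mat_app d M x)) \<le> e * Re (H x x))"
proof -
  \<comment> \<open>Vectors are functions on all naturals, so compactness comes from the product
    topology, with the coordinates from d on pinned to 0. S is the unit sphere of the maximum norm;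
    the quotient is homogeneous of degree 0, so it represents all directions.\<close>
  define box where "box = PiE UNIV (\<lambda>i::nat. if i < d then cball (0::complex) 1 else {0})"
  have "compactin (product_topology (\<lambda>i. euclidean) UNIV) box"
    unfolding box_def by (subst compactin_PiE) (auto simp: compactin_euclidean_iff)
  then have box: "compact box" by (simp add: euclidean_product_topology compactin_euclidean_iff)
  define S where "S = box \<inter> (\<Union>i<d. {x. cmod (x i) = 1})"
  have coord: "continuous_on T (\<lambda>x::nat\<Rightarrow>complex. x i)" for i T
    by (rule continuous_on_subset[OF continuous_on_product_coordinates]) simp
  have "closed {x::nat\<Rightarrow>complex. cmod (x i) = 1}" for i
    by (rule closed_Collect_eq) (auto intro!: continuous_intros coord)
  then have "closed (\<Union>i<d. {x::nat\<Rightarrow>complex. cmod (x i) = 1})" by auto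
  then have S: "compact S" unfolding S_def using box by (rule compact_Int_closed[rotated])
  have Scv: "x \<in> cvecs d" if "x \<in> S" for x
  proof -
    have "x i \<in> (if i < d then cball (0::complex) 1 else {0})" for i
      using that unfolding S_def box_def by (intro PiE_mem[of x UNIV]) auto
    then have "x i = 0" if "d \<le> i" for i using that by (metis not_le singletonD)
    then show ?thesis by (simp add: cvecs_def)
  qed
  have S0: "x \<noteq> 0" if "x \<in> S" for x using that by (auto simp: S_def)
  have "(\<lambda>i. if i = 0 then 1 else 0) \<in> S"
    using d by (auto simp: S_def box_def intro!: bexI[of _ 0])
  then have Sne: "S \<noteq> {}" by blast
  define r where "r = (\<lambda>x. Re (H x (mat_app d M x)) / Re (H x x))"
  have "continuous_on S (\<lambda>x. mat_app d M x i)" for i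
    unfolding mat_app_def by (cases "i < d") (auto intro!: continuous_intros coord)
  then have "continuous_on S r" unfolding r_def
    using H_pos Scv S0 by (intro continuous_intros continuous_on_H coord) force+
  then obtain x0 where x0: "x0 \<in> S" "\<And>x. x \<in> S \<Longrightarrow> r x \<le> r x0"
    using continuous_attains_sup[OF S Sne] by blast
  define e where "e = r x0"
  have x0c: "x0 \<in> cvecs d" "x0 \<noteq> 0" using x0 Scv S0 by auto
  have le: "Re (H x (mat_app d M x)) \<le> e * Re (H x x)" if x: "x \<in> cvecs d" for x
  proof (cases "x = 0")
    case False
    define m where "m = Max ((\<lambda>i. cmod (x i)) ` {..<d})"
    have fin: "finite ((\<lambda>i. cmod (x i)) ` {..<d})" "(\<lambda>i. cmod (x i)) ` {..<d} \<noteq> {}" using d by (auto simp: lessThan_empty_iff)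
    have mle: "cmod (x i) \<le> m" if "i < d" for i unfolding m_def using that fin by (intro Max_ge) auto
    obtain i0 where i0: "i0 < d" "cmod (x i0) = m" using Max_in[OF fin] unfolding m_def by auto
    have "m > 0"
    proof (rule ccontr)
      assume "\<not> m > 0"
      then have "cmod (x i) \<le> 0" if "i < d" for i using mle[OF that] by linarith
      then have "x = 0" using x by (intro cvecs_eqI[of x d 0]) auto
      then show False using False by simp
    qed
    define y where "y = sc (complex_of_real (1/m)) x"
    have "y \<in> S" unfolding S_def
    proof
      show "y \<in> box" using x mle \<open>m > 0\<close> by (auto simp: box_def y_def cvecs_def norm_divide)
      show "y \<in> (\<Union>i<d. {x. cmod (x i) = 1})"
        using i0 \<open>m > 0\<close> by (auto simp: y_def norm_divide)
    qed
    then have "r y \<le> e" using x0(2) by (simp add: e_def)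
    moreover have "r y = r x"
    proof -
      have "Re (H y (mat_app d M y)) = (1/m)^2 * Re (H x (mat_app d M x))" "Re (H y y) = (1/m)^2 * Re (H x x)"
        by (simp_all add: y_def mat_app_sc H_sc_left H_sc_right power2_eq_square)
      then show ?thesis using \<open>m > 0\<close> by (simp add: r_def)
    qed
    ultimately have "Re (H x (mat_app d M x)) / Re (H x x) \<le> e" by (simp add: r_def)
    then show ?thesis using H_pos[OF x False] by (simp add: pos_divide_le_eq)
  qed simp
  define N where "N = (\<lambda>x. mat_app d M x - sc (complex_of_real e) x)"
  have N_in: "N x \<in> cvecs d" if "x \<in> cvecs d" for x unfolding N_def using that by (intro cvecs_diff cvecs_sc) auto
  have N_sa: "H (N x) y = H x (N y)" if "x \<in> cvecs d" "y \<in> cvecs d" for x y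
    using sa[OF that] by (simp add: N_def H_diff_left H_diff_right H_sc_left H_sc_right)
  have N_lin: "N (x + sc t y) = N x + sc t (N y)" for x y t
    by (auto simp: N_def mat_app_add mat_app_sc fun_eq_iff algebra_simps)
  have N_le: "Re (H x (N x)) \<le> 0" if "x \<in> cvecs d" for x
    using le[OF that] by (simp add: N_def H_diff_right H_sc_right)
  have N_x0: "Re (H x0 (N x0)) = 0"
    using H_pos[OF x0c] by (simp add: N_def H_diff_right H_sc_right e_def r_def)
  define y where "y = N x0"
  have y: "y \<in> cvecs d" unfolding y_def by (rule N_in[OF x0c(1)])
  \<comment> \<open>The form of M - e at x0 + t y. For small t > 0 the linear term would dominate
    and be positive unless y = 0.\<close>
  have quad: "2 * t * Re (H y y) + t^2 * Re (H y (N y)) \<le> 0" for t :: real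
  proof -
    let ?z = "x0 + sc (complex_of_real t) y"
    have "H x0 (N y) = H y y" using N_sa[OF x0c(1) y] by (simp add: y_def)
    then have "Re (H ?z (N ?z)) = Re (H x0 (N x0)) + 2 * t * Re (H y y) + t^2 * Re (H y (N y))"
      by (simp add: N_lin H_add_left H_add_right H_sc_left H_sc_right y_def[symmetric] power2_eq_square algebra_simps)
    moreover have "Re (H ?z (N ?z)) \<le> 0" by (intro N_le cvecs_add cvecs_sc x0c y)
    ultimately show ?thesis using N_x0 by simp
  qed
  have "y = 0"
  proof (rule ccontr)
    assume "y \<noteq> 0"
    then have a: "Re (H y y) > 0" using H_pos y by blast
    define b where "b = \<bar>Re (H y (N y))\<bar>"
    define t where "t = Re (H y y) / (b + 1)"
    have t: "t > 0" using a by (simp add: t_def b_def add_nonneg_pos)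
    have "t * b < Re (H y y) * 2"
    proof -
      have "t * b \<le> t * (b + 1)" using t by simp
      also have "\<dots> = Re (H y y)" by (simp add: t_def b_def)
      finally show ?thesis using a by linarith
    qed
    then have "t * (t * b) < t * (Re (H y y) * 2)" using t by simp
    moreover have "t^2 * Re (H y (N y)) \<ge> - (t * (t * b))"
      unfolding power2_eq_square mult.assoc mult_minus_right[symmetric]
      using t by (intro mult_left_mono) (auto simp: b_def)
    ultimately show False using quad[of t] by (simp add: algebra_simps)
  qed
  then have "mat_app d M x0 = sc (complex_of_real e) x0" by (simp add: y_def N_def)
  then have "is_eigenvalue d M (complex_of_real e)" unfolding eigenvalue_iff using x0c by blast
  then show ?thesis using le by blast
qed

text \<open>Eigenvectors for distinct eigenvalues are orthogonal, hence independent, and the space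
  has a spanning set of d vectors. Finiteness is what gives the \<open>Min\<close> in
  \<open>lambda_min\<close> its meaning.\<close>

lemma finite_real_eigenvalues:
  assumes sa: "\<And>x y. x \<in> cvecs d \<Longrightarrow> y \<in> cvecs d \<Longrightarrow> H (mat_app d M x) y = H x (mat_app d M y)"
  shows "finite {e::real. is_eigenvalue d M (complex_of_real e)}"
proof -
  let ?E = "{e::real. is_eigenvalue d M (complex_of_real e)}"
  have "\<forall>e\<in>?E. \<exists>v. v \<in> cvecs d \<and> v \<noteq> 0 \<and> mat_app d M v = sc (complex_of_real e) v"
    unfolding eigenvalue_iff by blast
  then obtain v where v: "\<And>e. e \<in> ?E \<Longrightarrow> v e \<in> cvecs d" "\<And>e. e \<in> ?E \<Longrightarrow> v e \<noteq> 0"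
      "\<And>e. e \<in> ?E \<Longrightarrow> mat_app d M (v e) = sc (complex_of_real e) (v e)"
    by metis
  have orth: "H (v a) (v b) = 0" if "a \<in> ?E" "b \<in> ?E" "a \<noteq> b" for a b
  proof -
    have "complex_of_real a * H (v a) (v b) = complex_of_real b * H (v a) (v b)"
      using sa[OF v(1)[OF that(1)] v(1)[OF that(2)]] v(3) that by (simp add: H_sc_left H_sc_right)
    then show ?thesis using that by simp
  qed
  have inj: "inj_on v ?E"
  proof
    fix a b assume ab: "a \<in> ?E" "b \<in> ?E" "v a = v b"
    show "a = b"
    proof (rule ccontr)
      assume "a \<noteq> b"
      then show False using orth[OF ab(1,2)] ab(3) H_eq_0_iff[OF v(1)[OF ab(1)]] v(2)[OF ab(1)] by simp
    qed
  qed
  have "cv.independent (v ` ?E)"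
  proof
    assume "cv.dependent (v ` ?E)"
    then obtain T u w where T: "finite T" "T \<subseteq> v ` ?E" "(\<Sum>w\<in>T. sc (u w) w) = 0"
      and w: "w \<in> T" "u w \<noteq> 0"
      unfolding cv.dependent_explicit by blast
    then obtain e where we: "w = v e" and ev: "e \<in> ?E" by blast
    have e: "v e \<in> T" "u (v e) \<noteq> 0" using w we by auto
    have "0 = H (v e) (\<Sum>w\<in>T. sc (u w) w)" using T by simp
    also have "\<dots> = (\<Sum>w\<in>T. u w * H (v e) w)" by (simp add: H_sum_right H_sc_right)
    also have "\<dots> = (\<Sum>w\<in>{v e}. u w * H (v e) w)"
    proof (rule sum.mono_neutral_right)
      show "\<forall>w\<in>T - {v e}. u w * H (v e) w = 0" using T orth ev by fastforce
    qed (use T e in auto)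
    finally have "H (v e) (v e) = 0" using e by simp
    then show False using v(1)[OF ev] v(2)[OF ev] H_eq_0_iff by simp
  qed
  moreover have "v ` ?E \<subseteq> cv.span ((\<lambda>k i. if i = k then 1 else 0) ` {..<d})"
  proof
    fix x assume "x \<in> v ` ?E"
    then have x: "x \<in> cvecs d" using v by blast
    have "x = (\<Sum>k<d. sc (x k) (\<lambda>i. if i = k then 1 else 0))"
      using x by (auto simp: fun_eq_iff sum_fun_nth cvecs_def if_distrib[of "\<lambda>x. _ * x"] cong: if_cong)
    then show "x \<in> cv.span ((\<lambda>k i. if i = k then 1 else 0) ` {..<d})"
      by (metis (no_types, lifting) cv.span_base cv.span_scale cv.span_sum image_eqI)
  qed
  ultimately have "finite (v ` ?E)"
    using cv.independent_span_bound[of "(\<lambda>k i. if i = k then 1 else 0) ` {..<d}" "v ` ?E"] by simp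
  then show ?thesis using inj finite_imageD by blast
qed

end

section \<open>Unitary representations and the averages over U_B\<close>

locale urep = haar_family \<mu> + herm_form d h
  for \<mu> :: "'n::finite set \<Rightarrow> (complex^'n^'n) measure"
    and d :: nat and h :: "nat \<Rightarrow> nat \<Rightarrow> complex" +
  fixes \<rho> :: "complex^'n^'n \<Rightarrow> nat \<Rightarrow> nat \<Rightarrow> complex"
  assumes rep: "is_rep d \<rho>"
    and H_inv: "\<And>g x y. g \<in> unitary_grp \<Longrightarrow> H (mat_app d (\<rho> g) x) (mat_app d (\<rho> g) y) = H x y"

lemma rep_mult:
  assumes "is_rep d \<rho>" "g \<in> unitary_grp" "g' \<in> unitary_grp"
  shows "mat_app d (\<rho> (g ** g')) x = mat_app d (\<rho> g) (mat_app d (\<rho> g') x)"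
proof (rule ext)
  fix i
  show "mat_app d (\<rho> (g ** g')) x i = mat_app d (\<rho> g) (mat_app d (\<rho> g') x) i"
  proof (cases "i < d")
    case True
    have "(\<Sum>k<d. \<rho> (g ** g') i k * x k) = (\<Sum>k<d. (\<Sum>l<d. \<rho> g i l * \<rho> g' l k) * x k)"
      using assms True by (intro sum.cong refl) (simp add: is_rep_def)
    also have "\<dots> = (\<Sum>l<d. \<rho> g i l * (\<Sum>k<d. \<rho> g' l k * x k))"
      unfolding sum_distrib_left sum_distrib_right by (subst sum.swap) (simp only: mult.assoc)
    finally show ?thesis using True by (simp add: mat_app_def)
  qed (simp add: mat_app_def)
qed

lemma rep_one:
  assumes "is_rep d \<rho>" "x \<in> cvecs d"
  shows "mat_app d (\<rho> (mat 1)) x = x"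
proof -
  have "mat_app d (\<rho> (mat 1)) x = mat_app d (idm d) x" using assms by (simp add: is_rep_def)
  also have "\<dots> = x" using assms(2)
    by (auto simp: mat_app_def idm_def cvecs_def fun_eq_iff if_distrib[of "\<lambda>x. x * _"] cong: if_cong)
  finally show ?thesis .
qed

lemma rep_continuous:
  assumes "is_rep d \<rho>"
  shows "continuous_on unitary_grp (\<lambda>g. mat_app d (\<rho> g) x i)"
  using assms unfolding mat_app_def is_rep_def
  by (cases "i < d") (auto intro!: continuous_intros)

context haar_family
begin

text \<open>Weyl averaging of the standard form. It is pulled back along \<open>adjm g\<close>
  instead of g, so that invariance is an instance of left invariance of the integral.\<close>

lemma rep_unitarizable:
  assumes rep: "is_rep d \<rho>"
  shows "\<exists>h. urep \<mu> d h \<rho>"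
proof -
  define h where "h = (\<lambda>i j. hI UNIV (\<lambda>g. \<Sum>k<d. cnj (\<rho> (adjm g) k i) * \<rho> (adjm g) k j))"
  define st where "st = (\<lambda>x y :: nat \<Rightarrow> complex. \<Sum>k<d. cnj (x k) * y k)"
  have cr: "continuous_on unitary_grp (\<lambda>g. \<rho> g i j)" for i j
    using rep by (simp add: is_rep_def)
  have cra: "continuous_on unitary_grp (\<lambda>g. \<rho> (adjm g) i j)" for i j
    using continuous_on_inverse_arg[of UNIV "\<lambda>g. \<rho> g i j"] cr by simp
  have form: "(\<Sum>i<d. \<Sum>j<d. cnj (x i) * h i j * y j)
      = hI UNIV (\<lambda>g. st (mat_app d (\<rho> (adjm g)) x) (mat_app d (\<rho> (adjm g)) y))" for x y
  proof -
    have "hI UNIV (\<lambda>g. st (mat_app d (\<rho> (adjm g)) x) (mat_app d (\<rho> (adjm g)) y))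
      = hI UNIV (\<lambda>g. \<Sum>i<d. \<Sum>j<d. cnj (x i) * (\<Sum>k<d. cnj (\<rho> (adjm g) k i) * \<rho> (adjm g) k j) * y j)"
    proof (rule hI_cong)
      fix g
      have "st (mat_app d (\<rho> (adjm g)) x) (mat_app d (\<rho> (adjm g)) y)
        = (\<Sum>k<d. \<Sum>i<d. \<Sum>j<d. cnj (x i) * (cnj (\<rho> (adjm g) k i) * \<rho> (adjm g) k j) * y j)"
        unfolding st_def mat_app_def
        by (intro sum.cong refl) (simp add: sum_product, simp only: mult_ac)
      also have "\<dots> = (\<Sum>i<d. \<Sum>j<d. \<Sum>k<d. cnj (x i) * (cnj (\<rho> (adjm g) k i) * \<rho> (adjm g) k j) * y j)"
        by (subst sum.swap, rule sum.cong[OF refl], rule sum.swap)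
      finally show "st (mat_app d (\<rho> (adjm g)) x) (mat_app d (\<rho> (adjm g)) y)
        = (\<Sum>i<d. \<Sum>j<d. cnj (x i) * (\<Sum>k<d. cnj (\<rho> (adjm g) k i) * \<rho> (adjm g) k j) * y j)"
        by (simp only: sum_distrib_left sum_distrib_right)
    qed
    also have "\<dots> = (\<Sum>i<d. \<Sum>j<d. hI UNIV (\<lambda>g. cnj (x i) * (\<Sum>k<d. cnj (\<rho> (adjm g) k i) * \<rho> (adjm g) k j) * y j))"
      by (subst hI_sum, simp, intro continuous_intros cra, rule sum.cong[OF refl], rule hI_sum, simp,
          intro continuous_intros cra)
    also have "\<dots> = (\<Sum>i<d. \<Sum>j<d. cnj (x i) * h i j * y j)"
      by (simp only: hI_mult_left hI_mult_right h_def)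
    finally show ?thesis by simp
  qed
  have cst: "continuous_on unitary_grp (\<lambda>g. st (mat_app d (\<rho> (adjm g)) x) (mat_app d (\<rho> (adjm g)) y))" for x y
    using continuous_on_inverse_arg[of UNIV "\<lambda>g. st (mat_app d (\<rho> g) x) (mat_app d (\<rho> g) y)"]
      rep_continuous[OF rep] unfolding st_def by (simp add: continuous_intros)
  have hf: "herm_form d h"
  proof
    fix i j
    show "h i j = cnj (h j i)"
      unfolding h_def hI_cnj[symmetric] by (intro hI_cong) (simp add: mult.commute)
  next
    fix x assume x: "x \<in> cvecs d" "x \<noteq> 0"
    have re: "Re (st y y) = (\<Sum>k<d. (cmod (y k))^2)" for y
      by (simp add: st_def cmod_power2) (simp add: power2_eq_square)
    show "0 < Re (\<Sum>i<d. \<Sum>j<d. cnj (x i) * h i j * x j)"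
      unfolding form
    proof (rule hI_pos)
      show "0 < Re (st (mat_app d (\<rho> (adjm (mat 1))) x) (mat_app d (\<rho> (adjm (mat 1))) x))"
      proof -
        obtain k where k: "x k \<noteq> 0" using x by (auto simp: fun_eq_iff)
        then have "k < d" using x by (metis (mono_tags, lifting) cvecs_def mem_Collect_eq not_le)
        then have "0 < (\<Sum>k<d. (cmod (x k))^2)" using k by (intro sum_pos2[of _ k]) auto
        then show ?thesis using rep_one[OF rep x(1)] by (simp add: re)
      qed
    qed (use cst in \<open>auto simp: re sum_nonneg\<close>)
  qed
  then interpret hf: herm_form d h .
  have "hf.H (mat_app d (\<rho> g) x) (mat_app d (\<rho> g) y) = hf.H x y" if g: "g \<in> unitary_grp" for g x y
  proof -
    have ag: "adjm g \<in> unitary_sub UNIV" using unitary_adj[OF g] by simp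
    have "hf.H (mat_app d (\<rho> g) x) (mat_app d (\<rho> g) y)
      = hI UNIV (\<lambda>u. st (mat_app d (\<rho> (adjm (adjm g ** u))) x) (mat_app d (\<rho> (adjm (adjm g ** u))) y))"
      unfolding hf.H_def form
      by (intro hI_cong) (simp add: adjm_mul rep_mult[OF rep unitary_adj g])
    also have "\<dots> = hf.H x y"
      unfolding hf.H_def form using cst
      by (intro hI_left[of UNIV "\<lambda>u. st (mat_app d (\<rho> (adjm u)) x) (mat_app d (\<rho> (adjm u)) y)", OF _ ag]) simp
    finally show ?thesis .
  qed
  then have "urep \<mu> d h \<rho>" using rep by unfold_locales auto
  then show ?thesis by blast
qed

end

context urep
begin

definition R :: "complex^'n^'n \<Rightarrow> (nat \<Rightarrow> complex) \<Rightarrow> nat \<Rightarrow> complex" where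
  "R g x = mat_app d (\<rho> g) x"

definition P :: "'n set \<Rightarrow> (nat \<Rightarrow> complex) \<Rightarrow> nat \<Rightarrow> complex" where
  "P B x = (\<lambda>i. hI B (\<lambda>g. R g x i))"

lemma R_in [simp]: "R g x \<in> cvecs d" by (simp add: R_def)
lemma R_add: "R g (x + y) = R g x + R g y" by (simp add: R_def mat_app_add)
lemma R_sc: "R g (sc a x) = sc a (R g x)" by (simp add: R_def mat_app_sc)
lemma R_sum: "R g (\<Sum>i\<in>I. f i) = (\<Sum>i\<in>I. R g (f i))" by (simp only: R_def mat_app_sum)
lemma R_zero [simp]: "R g 0 = 0" by (simp add: R_def)
lemma R_mult: "g \<in> unitary_grp \<Longrightarrow> g' \<in> unitary_grp \<Longrightarrow> R (g ** g') x = R g (R g' x)"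
  unfolding R_def by (rule rep_mult[OF rep])
lemma R_one: "x \<in> cvecs d \<Longrightarrow> R (mat 1) x = x"
  unfolding R_def by (rule rep_one[OF rep])
lemma R_continuous: "continuous_on (unitary_sub B) (\<lambda>g. R g x i)"
  unfolding R_def by (rule continuous_on_subset[OF rep_continuous[OF rep]]) (auto simp: unitary_subD)
lemma H_R: "g \<in> unitary_grp \<Longrightarrow> H (R g x) (R g y) = H x y"
  unfolding R_def by (rule H_inv)

lemma R_adj_cancel: "g \<in> unitary_grp \<Longrightarrow> x \<in> cvecs d \<Longrightarrow> R (adjm g) (R g x) = x"
  by (simp add: R_mult[symmetric] unitary_adj R_one)

lemma H_R_left: "g \<in> unitary_grp \<Longrightarrow> y \<in> cvecs d \<Longrightarrow> H (R g x) y = H x (R (adjm g) y)"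
  using H_R[of g x "R (adjm g) y"] R_adj_cancel[OF unitary_adj, of g y] by simp

lemma P_mat: "P B x = mat_app d (\<lambda>i j. hI B (\<lambda>g. \<rho> g i j)) x"
proof (rule ext)
  fix i
  have "continuous_on (unitary_sub B) (\<lambda>g. \<rho> g i j)" for j
    using rep unfolding is_rep_def by (metis continuous_on_subset subsetI unitary_subD)
  then have "hI B (\<lambda>g. \<Sum>k<d. \<rho> g i k * x k) = (\<Sum>k<d. hI B (\<lambda>g. \<rho> g i k * x k))"
    by (intro hI_sum continuous_intros)
  then show "P B x i = mat_app d (\<lambda>i j. hI B (\<lambda>g. \<rho> g i j)) x i"
    by (cases "i < d") (simp_all add: P_def R_def mat_app_def hI_mult_right)
qed

lemma P_in [simp]: "P B x \<in> cvecs d" by (simp add: P_mat)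
lemma P_diff: "P B (x - y) = P B x - P B y" by (simp add: P_mat mat_app_diff)
lemma P_sc: "P B (sc a x) = sc a (P B x)" by (simp add: P_mat mat_app_sc)
lemma P_sum: "P B (\<Sum>i\<in>I. f i) = (\<Sum>i\<in>I. P B (f i))" by (simp only: P_mat mat_app_sum)
lemma P_zero [simp]: "P B 0 = 0" by (simp add: P_mat)

lemma mat_app_hI:
  assumes "\<And>i. continuous_on (unitary_sub B) (\<lambda>g. f g i)"
  shows "mat_app d M (\<lambda>i. hI B (\<lambda>g. f g i)) = (\<lambda>i. hI B (\<lambda>g. mat_app d M (f g) i))"
proof (rule ext)
  fix i
  have "hI B (\<lambda>g. \<Sum>k<d. M i k * f g k) = (\<Sum>k<d. hI B (\<lambda>g. M i k * f g k))"
    by (intro hI_sum continuous_intros assms)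
  then show "mat_app d M (\<lambda>i. hI B (\<lambda>g. f g i)) i = hI B (\<lambda>g. mat_app d M (f g) i)"
    by (cases "i < d") (simp_all add: mat_app_def hI_mult_left)
qed

lemma R_hI:
  assumes "\<And>i. continuous_on (unitary_sub B) (\<lambda>g. f g i)"
  shows "R u (\<lambda>i. hI B (\<lambda>g. f g i)) = (\<lambda>i. hI B (\<lambda>g. R u (f g) i))"
  unfolding R_def by (rule mat_app_hI[OF assms])

lemma H_hI:
  assumes "\<And>i. continuous_on (unitary_sub B) (\<lambda>g. f g i)"
  shows "H x (\<lambda>i. hI B (\<lambda>g. f g i)) = hI B (\<lambda>g. H x (f g))"
proof -
  have "hI B (\<lambda>g. H x (f g)) = (\<Sum>i<d. \<Sum>j<d. hI B (\<lambda>g. cnj (x i) * h i j * f g j))"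
    unfolding H_def
    by (subst hI_sum, intro continuous_intros assms, rule sum.cong[OF refl], rule hI_sum,
        intro continuous_intros assms)
  then show ?thesis by (simp add: H_def hI_mult_left)
qed

lemma R_P: "k \<in> unitary_sub B \<Longrightarrow> R k (P B x) = P B x"
proof -
  assume k: "k \<in> unitary_sub B"
  have "R k (P B x) = (\<lambda>i. hI B (\<lambda>g. R k (R g x) i))"
    unfolding P_def by (rule R_hI[OF R_continuous])
  also have "\<dots> = (\<lambda>i. hI B (\<lambda>g. R (k ** g) x i))"
    using k by (intro ext hI_cong) (simp add: R_mult unitary_subD)
  also have "\<dots> = P B x"
    unfolding P_def by (intro ext hI_left R_continuous k)
  finally show ?thesis .
qed

lemma P_R: "k \<in> unitary_sub B \<Longrightarrow> P B (R k x) = P B x"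
proof -
  assume k: "k \<in> unitary_sub B"
  have "P B (R k x) = (\<lambda>i. hI B (\<lambda>g. R (g ** k) x i))"
    unfolding P_def using k by (intro ext hI_cong) (simp add: R_mult unitary_subD)
  also have "\<dots> = P B x"
    unfolding P_def by (intro ext hI_right R_continuous k)
  finally show ?thesis .
qed

lemma P_fixed:
  assumes "\<And>k. k \<in> unitary_sub B \<Longrightarrow> R k x = x"
  shows "P B x = x"
proof (rule ext)
  fix i
  have "P B x i = hI B (\<lambda>g. x i)" unfolding P_def using assms by (intro hI_cong) simp
  then show "P B x i = x i" by simp
qed

text \<open>The adjoint of \<open>R g\<close> is \<open>R (adjm g)\<close>, and the integral is
  invariant under inversion.\<close>

lemma H_P: 
  assumes "y \<in> cvecs d"
  shows "H (P B x) y = H x (P B y)"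
proof -
  have c: "continuous_on (unitary_sub B) (\<lambda>g. H x (R g y))"
    by (intro continuous_on_H R_continuous) auto
  have "H x (P B y) = hI B (\<lambda>g. H x (R g y))" unfolding P_def by (rule H_hI[OF R_continuous])
  also have "\<dots> = hI B (\<lambda>g. H x (R (adjm g) y))" using hI_adj[OF c] by simp
  also have "\<dots> = hI B (\<lambda>g. cnj (H y (R g x)))"
    using assms by (intro hI_cong) (simp add: H_R_left[symmetric] unitary_subD H_cnj)
  also have "\<dots> = cnj (H y (P B x))"
    unfolding hI_cnj P_def by (simp only: H_hI[OF R_continuous])
  finally show ?thesis by (simp add: H_cnj)
qed

lemma P_P_sub: "C \<subseteq> B \<Longrightarrow> P C (P B x) = P B x"
  using unitary_sub_mono by (intro P_fixed R_P) blast

text \<open>The adjoint of \<open>P C (P B x) = P B x\<close>: the difference z lies in both images,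
  so self-adjointness turns \<open>H z z\<close> into a difference of equal terms.\<close>

lemma P_P_super:
  assumes "C \<subseteq> B" "x \<in> cvecs d"
  shows "P B (P C x) = P B x"
proof -
  define z where "z = P B (P C x) - P B x"
  have z: "z \<in> cvecs d" unfolding z_def by (intro cvecs_diff P_in)
  have Bz: "P B z = z" and Cz: "P C z = z"
    using assms by (simp_all add: z_def P_diff P_P_sub)
  have "H z z = H z (P B (P C x)) - H z (P B x)" using H_diff_right[of z "P B (P C x)" "P B x", folded z_def] .
  also have "\<dots> = H (P C (P B z)) x - H (P B z) x"
    using assms by (simp add: H_P)
  finally have "H z z = 0" by (simp add: Bz Cz)
  then have "z = 0" using H_eq_0_iff[OF z] by simp
  then show ?thesis by (simp add: z_def)
qed

text \<open>A substitute for a change of variables. The measures of different index sets are given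
  independently, so a conjugate of one average is recognised as another by its invariant values and
  by orthogonality.\<close>

lemma P_unique:
  assumes y: "y \<in> cvecs d" and z: "z \<in> cvecs d" and fixd: "\<And>k. k \<in> unitary_sub B \<Longrightarrow> R k z = z"
    and orth: "\<And>t. t \<in> cvecs d \<Longrightarrow> (\<And>k. k \<in> unitary_sub B \<Longrightarrow> R k t = t) \<Longrightarrow> H t (y - z) = 0"
  shows "P B y = z"
proof -
  define w where "w = y - z"
  define u where "u = P B w"
  have w: "w \<in> cvecs d" unfolding w_def by (intro cvecs_diff y z)
  have "H u u = H (P B u) w" using w by (simp add: H_P u_def)
  moreover have "P B u = u" by (simp add: u_def P_P_sub)
  moreover have "H u w = 0" unfolding w_def u_def by (intro orth R_P) auto
  ultimately have "H u u = 0" by simp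
  then have "u = 0" using H_eq_0_iff[of u] by (simp add: u_def)
  then show ?thesis using P_fixed[OF fixd] by (simp add: P_diff u_def w_def)
qed

lemma laplacian_app:
  assumes "x \<in> cvecs d"
  shows "mat_app d (laplacian w \<mu> d \<rho>) x = (\<Sum>B\<in>UNIV. sc (complex_of_real (w B)) (x - P B x))"
proof (rule cvecs_eqI[of _ d])
  fix i assume i: "i < d"
  have "mat_app d (laplacian w \<mu> d \<rho>) x i
    = (\<Sum>k<d. \<Sum>B\<in>UNIV. complex_of_real (w B) * (idm d i k * x k - hI B (\<lambda>A. \<rho> A i k) * x k))"
    using i unfolding mat_app_def laplacian_def hI_def
    by (simp only: if_True simp_thms sum_distrib_right mult.assoc left_diff_distrib)
       (simp add: sum_distrib_right mult.assoc left_diff_distrib)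
  also have "\<dots> = (\<Sum>B\<in>UNIV. complex_of_real (w B) * ((\<Sum>k<d. idm d i k * x k) - (\<Sum>k<d. hI B (\<lambda>A. \<rho> A i k) * x k)))"
    by (subst sum.swap) (simp add: sum_distrib_left sum_subtractf right_diff_distrib)
  also have "(\<Sum>k<d. idm d i k * x k) = x i"
    using i by (simp add: idm_def if_distrib[of "\<lambda>x. x * _"] cong: if_cong)
  finally show "mat_app d (laplacian w \<mu> d \<rho>) x i = (\<Sum>B\<in>UNIV. sc (complex_of_real (w B)) (x - P B x)) i"
    using i by (simp add: sum_fun_nth P_mat mat_app_def)
qed (auto intro!: cvecs_sum cvecs_sc cvecs_diff assms)

lemma laplacian_self_adjoint:
  assumes "x \<in> cvecs d" "y \<in> cvecs d"
  shows "H (mat_app d (laplacian w \<mu> d \<rho>) x) y = H x (mat_app d (laplacian w \<mu> d \<rho>) y)"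
proof -
  have "H (\<Sum>B\<in>UNIV. sc (complex_of_real (w B)) (x - P B x)) y = cnj (H y (\<Sum>B\<in>UNIV. sc (complex_of_real (w B)) (x - P B x)))"
    by (simp add: H_cnj)
  also have "\<dots> = (\<Sum>B\<in>UNIV. complex_of_real (w B) * (H x y - H (P B x) y))"
    by (simp add: H_sum_right H_sc_right H_diff_right H_cnj)
  also have "\<dots> = H x (\<Sum>B\<in>UNIV. sc (complex_of_real (w B)) (y - P B y))"
    using assms by (simp add: H_sum_right H_sc_right H_diff_right H_P)
  finally show ?thesis using assms by (simp add: laplacian_app)
qed

text \<open>Conjugation by the transposition exchanges \<open>unitary_sub (B - {p})\<close> and
  \<open>unitary_sub (B - {i})\<close>, hence their invariant vectors, and \<open>P_unique\<close>
  identifies the projections.\<close>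

lemma P_swp_conj:
  assumes "i \<in> B" "p \<in> B" "y \<in> cvecs d"
  shows "R (swp p i) (P (B - {i}) (R (swp p i) y)) = P (B - {p}) y"
proof -
  let ?s = "swp p i"
  have tau1: "tau p i ` (B - {p}) \<subseteq> B - {i}" and tau2: "tau p i ` (B - {i}) \<subseteq> B - {p}"
    using assms by (auto simp: tau_def split: if_splits)
  have conj1: "?s ** k ** ?s \<in> unitary_sub (B - {i})" if "k \<in> unitary_sub (B - {p})" for k
    using swp_conj_unitary_sub[OF that, of p i] unitary_sub_mono[OF tau1] by blast
  have conj2: "?s ** k ** ?s \<in> unitary_sub (B - {p})" if "k \<in> unitary_sub (B - {i})" for k
    using swp_conj_unitary_sub[OF that, of p i] unitary_sub_mono[OF tau2] by blast
  have ss: "R ?s (R ?s x) = x" if "x \<in> cvecs d" for x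
    using R_adj_cancel[of ?s x] that by simp
  have move: "R ?s (R k x) = R (?s ** k ** ?s) (R ?s x)" if "k \<in> unitary_grp" "x \<in> cvecs d" for k x
  proof -
    have "R (?s ** k ** ?s) (R ?s x) = R (?s ** k) (R ?s (R ?s x))"
      using that by (intro R_mult) (auto intro: unitary_mul)
    then show ?thesis using that by (simp add: ss R_mult)
  qed
  have "P (B - {p}) y = R ?s (P (B - {i}) (R ?s y))"
  proof (rule P_unique)
    fix k assume k: "k \<in> unitary_sub (B - {p})"
    have "R k (R ?s (P (B - {i}) (R ?s y))) = R ?s (R ?s (R k (R ?s (P (B - {i}) (R ?s y)))))"
      by (simp add: ss)
    also have "\<dots> = R ?s (R (?s ** k ** ?s) (R ?s (R ?s (P (B - {i}) (R ?s y)))))"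
      by (simp only: move[OF unitary_subD[OF k]] R_in)
    also have "\<dots> = R ?s (P (B - {i}) (R ?s y))"
      using conj1[OF k] by (simp add: ss R_P)
    finally show "R k (R ?s (P (B - {i}) (R ?s y))) = R ?s (P (B - {i}) (R ?s y))" .
  next
    fix t assume t: "t \<in> cvecs d" "\<And>k. k \<in> unitary_sub (B - {p}) \<Longrightarrow> R k t = t"
    have fixd: "R k (R ?s t) = R ?s t" if k: "k \<in> unitary_sub (B - {i})" for k
    proof -
      have "R ?s (R k (R ?s t)) = R (?s ** k ** ?s) (R ?s (R ?s t))"
        by (simp only: move[OF unitary_subD[OF k]] R_in)
      also have "\<dots> = t" using t conj2[OF k] by (simp add: ss)
      finally have "R ?s (R ?s (R k (R ?s t))) = R ?s t" by simp
      then show ?thesis by (simp add: ss)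
    qed
    have "H t (R ?s (P (B - {i}) (R ?s y))) = H (R ?s t) (P (B - {i}) (R ?s y))"
      using H_R_left[of ?s "P (B - {i}) (R ?s y)" t] by simp
    also have "\<dots> = H (P (B - {i}) (R ?s t)) (R ?s y)" by (simp add: H_P)
    also have "P (B - {i}) (R ?s t) = R ?s t" by (rule P_fixed[OF fixd])
    also have "H (R ?s t) (R ?s y) = H t y" by (simp add: H_R)
    finally show "H t (y - R ?s (P (B - {i}) (R ?s y))) = 0" by (simp add: H_diff_right)
  qed (use assms in auto)
  then show ?thesis by simp
qed

text \<open>With K = \<open>unitary_sub (B - {p})\<close>, the g in U_B with vanishing entry (p, p)
  form one double coset of K, that of the transposition: g maps the p-th basis vector to a unit
  vector over B - {p}, some k in K maps the q-th basis vector there, and what remains after removing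
  k and the transposition fixes the p-th one.\<close>

lemma P_double_coset:
  assumes g: "g \<in> unitary_sub B" and gp: "g$p$p = 0" and p: "p \<in> B" and q: "q \<in> B" "q \<noteq> p"
    and u: "\<And>k. k \<in> unitary_sub (B - {p}) \<Longrightarrow> R k u = u"
  shows "P (B - {p}) (R g u) = P (B - {p}) (R (swp p q) u)"
proof -
  let ?s = "swp p q"
  have gU: "g \<in> unitary_grp" using g by (rule unitary_subD)
  have "cin (axis q 1) (axis q 1) = cin (g *v axis p 1) (g *v axis p 1)"
    by (simp add: cin_mult_unitary[OF gU])
  moreover have "(axis q 1 :: complex^'n)$i = (g *v axis p 1)$i" if "i \<notin> B - {p}" for i
    using that unitary_sub_nth[OF g, of i p] gp q p by (auto simp: axis_def[of q] mult_axis_nth)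
  ultimately obtain k where k: "k \<in> unitary_sub (B - {p})" "k *v axis q 1 = g *v axis p 1"
    using unitary_sub_transitive by metis
  have kB: "k \<in> unitary_sub B" using k unitary_sub_mono[of "B - {p}" B] by blast
  have kU: "k \<in> unitary_grp" using kB by (rule unitary_subD)
  define k' where "k' = ?s ** (adjm k ** g)"
  have k'B: "k' \<in> unitary_sub B"
    unfolding k'_def by (intro unitary_sub_mul swp_unitary_sub unitary_sub_adj kB g p q)
  have "(adjm k ** g) *v axis p 1 = axis q 1"
    using k(2) kU by (metis matrix_vector_mul_assoc matrix_vector_mul_lid unitary_adj_mul)
  then have "(adjm k ** g)$j$p = axis q 1 $ j" for j by (metis mult_axis_nth)
  then have "k'$j$p = (if j = p then 1 else 0)" for j
    by (auto simp: k'_def swp_mul_nth axis_def tau_def)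
  then have k': "k' \<in> unitary_sub (B - {p})"
    using unitary_sub_removeI[of k' p "B - {p}"] k'B p by (simp add: insert_absorb)
  have k'U: "k' \<in> unitary_grp" using k' by (rule unitary_subD)
  have "?s ** k' = adjm k ** g"
    by (simp add: k'_def matrix_mul_assoc)
  then have "g = k ** (?s ** k')" using adj_cancel_left'[OF kU, of g] by simp
  then have "R g u = R k (R ?s (R k' u))"
    using kU k'U by (simp add: R_mult unitary_mul)
  then show ?thesis using u[OF k'] P_R[OF k(1)] by simp
qed

text \<open>A coordinate of \<open>R g u\<close>, as a function of g, is right invariant under
  \<open>unitary_sub (B - {p})\<close> and inherits the eigenvalue equation;
  \<open>P B u = 0\<close> says that its mean is 0.\<close>

lemma Phi_eigenvalue_bounds:
  assumes p: "p \<in> B" and q: "q \<in> B" "q \<noteq> p"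
    and u: "u \<in> cvecs d" "u \<noteq> 0" "\<And>k. k \<in> unitary_sub (B - {p}) \<Longrightarrow> R k u = u"
    and eig: "P (B - {p}) (R (swp p q) u) = sc (complex_of_real \<phi>) u"
    and zero: "P B u = 0" and phi: "\<phi> \<noteq> 0"
  shows "- 1 / (real (card B) - 1) \<le> \<phi> \<and> \<phi> \<le> 2 / (real (card B) * (real (card B) - 1))"
proof -
  obtain i where i: "u i \<noteq> 0" using u by (auto simp: fun_eq_iff)
  show ?thesis
  proof (rule zonal_eigenvalue[of p B q "\<lambda>g. R g u i" \<phi> "mat 1"])
    show "R (g ** k) u i = R g u i" if "g \<in> unitary_sub B" "k \<in> unitary_sub (B - {p})" for g k
      using that u by (simp add: R_mult unitary_subD)
    show "hI (B - {p}) (\<lambda>k. R (g ** k ** swp p q) u i) = complex_of_real \<phi> * R g u i" if g: "g \<in> unitary_sub B" for g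
    proof -
      have "hI (B - {p}) (\<lambda>k. R (g ** k ** swp p q) u i) = hI (B - {p}) (\<lambda>k. R g (R k (R (swp p q) u)) i)"
        using g by (intro hI_cong) (simp add: R_mult unitary_subD unitary_mul)
      also have "\<dots> = R g (P (B - {p}) (R (swp p q) u)) i"
        unfolding P_def by (subst R_hI[OF R_continuous]) simp
      finally show ?thesis by (simp add: eig R_sc)
    qed
    show "hI B (\<lambda>g. R g u i) = 0" using zero by (simp add: P_def fun_eq_iff)
    show "R (mat 1) u i \<noteq> 0" using i u by (simp add: R_one)
  qed (use p q phi in \<open>auto intro: R_continuous\<close>)
qed

text \<open>For \<open>i \<noteq> j\<close> the products \<open>P\<^bsub>B-j\<^esub> P\<^bsub>B-i\<^esub>\<close> are all conjugate to the single operator \<open>Phi\<close> on the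
  \<open>U\<^bsub>B-p\<^esub>\<close>-invariants. Transporting the components \<open>P\<^bsub>B-i\<^esub> x\<close> of an eigenvector \<open>x\<close> to vectors \<open>u\<^sub>i\<close>
  there, either \<open>\<Sum>\<^sub>i u\<^sub>i\<close> or one of the \<open>u\<^sub>i\<close> is an eigenvector of \<open>Phi\<close>.\<close>

lemma sum_P_remove_eigenvalue_le:
  assumes B: "card B \<ge> 2" and x: "x \<in> cvecs d" "x \<noteq> 0"
    and eig: "(\<Sum>i\<in>B. P (B - {i}) x) - sc (of_nat (card B)) (P B x) = sc (complex_of_real e) x"
  shows "e \<le> 1 + 2 / real (card B)"
proof (rule ccontr)
  assume "\<not> ?thesis"
  then have e: "e > 1 + 2 / real (card B)" by simp
  define m where "m = real (card B)"
  have m: "m \<ge> 2" using B by (simp add: m_def)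
  then have "2 / m > 0" by simp
  then have e1: "e > 1" using e unfolding m_def[symmetric] by linarith
  have finB: "finite B" by simp
  obtain p where p: "p \<in> B" using B by fastforce
  have "B - {p} \<noteq> {}"
  proof
    assume "B - {p} = {}"
    then have "B \<subseteq> {p}" by auto
    then have "card B \<le> 1" using card_mono[of "{p}" B] by simp
    then show False using B by simp
  qed
  then obtain q where q: "q \<in> B" "q \<noteq> p" by auto
  \<comment> \<open>On the U_B-invariants every \<open>P (B - {i})\<close> is the identity. The
    subtracted multiple of \<open>P B\<close> makes the operator vanish there, so an eigenvector
    with e \<noteq> 0 has no invariant part.\<close>
  have "sc (complex_of_real e) (P B x) = P B ((\<Sum>i\<in>B. P (B - {i}) x) - sc (of_nat (card B)) (P B x))"
    unfolding eig by (simp add: P_sc)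
  also have "\<dots> = (\<Sum>i\<in>B. P B x) - sc (of_nat (card B)) (P B x)"
    using x by (simp add: P_diff P_sum P_sc P_P_super P_P_sub)
  also have "\<dots> = 0" by (simp add: fun_eq_iff sum_fun_nth)
  finally have PBx: "P B x = 0" using e1 by (auto simp: fun_eq_iff)
  define w where "w = (\<lambda>i. P (B - {i}) x)"
  have ex: "(\<Sum>i\<in>B. w i) = sc (complex_of_real e) x" using eig PBx by (simp add: w_def fun_eq_iff)
  have w_in: "w i \<in> cvecs d" for i by (simp add: w_def)
  define u where "u = (\<lambda>i. R (swp p i) (w i))"
  have u_in: "u i \<in> cvecs d" for i by (simp add: u_def)
  have uw: "w i = R (swp p i) (u i)" for i
    using R_adj_cancel[of "swp p i" "w i"] by (simp add: u_def w_in)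
  have u_eq: "u i = P (B - {p}) (R (swp p i) x)" if "i \<in> B" for i
    using P_swp_conj[OF that p, of "R (swp p i) x"] R_adj_cancel[of "swp p i" x] x
    by (simp add: u_def w_def)
  have u_fix: "R k (u i) = u i" if "k \<in> unitary_sub (B - {p})" "i \<in> B" for k i
    using that by (simp add: u_eq R_P)
  have PBu: "P B (u i) = 0" if "i \<in> B" for i
    using that swp_unitary_sub[OF p that] x PBx by (simp add: u_eq P_P_super P_R)
  define Phi where "Phi = (\<lambda>y. P (B - {p}) (R (swp p q) y))"
  have step: "R (swp p j) (P (B - {j}) (w i)) = Phi (u i)" if ij: "i \<in> B" "j \<in> B" "i \<noteq> j" for i j
  proof -
    have "R (swp p j) (P (B - {j}) (w i)) = P (B - {p}) (R (swp p j) (w i))"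
      using P_swp_conj[OF ij(2) p, of "R (swp p j) (w i)"] R_adj_cancel[of "swp p j" "w i"] w_in by simp
    also have "R (swp p j) (w i) = R (swp p j ** swp p i) (u i)"
      by (simp add: uw R_mult)
    also have "P (B - {p}) (R (swp p j ** swp p i) (u i)) = Phi (u i)"
      unfolding Phi_def
    proof (rule P_double_coset)
      show "swp p j ** swp p i \<in> unitary_sub B" using ij p by (intro unitary_sub_mul swp_unitary_sub)
      show "(swp p j ** swp p i)$p$p = 0"
        using ij by (simp add: swp_mul_nth) (auto simp: swp_def)
    qed (use p q u_fix ij in auto)
    finally show ?thesis .
  qed
  have main: "sc (complex_of_real (e - 1)) (u j) = (\<Sum>i\<in>B - {j}. Phi (u i))" if j: "j \<in> B" for j
  proof -
    have "sc (complex_of_real e) (w j) = P (B - {j}) (\<Sum>i\<in>B. w i)"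
      unfolding ex by (simp add: w_def P_sc)
    also have "\<dots> = (\<Sum>i\<in>B. P (B - {j}) (w i))" by (rule P_sum)
    also have "\<dots> = P (B - {j}) (w j) + (\<Sum>i\<in>B - {j}. P (B - {j}) (w i))"
      by (rule sum.remove[OF finB j])
    also have "P (B - {j}) (w j) = w j" by (simp add: w_def P_P_sub)
    finally have "sc (complex_of_real (e - 1)) (w j) = (\<Sum>i\<in>B - {j}. P (B - {j}) (w i))"
      by (simp add: fun_eq_iff algebra_simps)
    then have "sc (complex_of_real (e - 1)) (u j) = R (swp p j) (\<Sum>i\<in>B - {j}. P (B - {j}) (w i))"
      by (metis R_sc u_def)
    also have "\<dots> = (\<Sum>i\<in>B - {j}. Phi (u i))"
      unfolding R_sum using step j by (intro sum.cong refl) auto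
    finally show ?thesis .
  qed
  define U where "U = (\<Sum>i\<in>B. u i)"
  have PhiU: "(\<Sum>i\<in>B. Phi (u i)) = Phi U"
    unfolding U_def Phi_def by (simp only: R_sum P_sum)
  have main': "sc (complex_of_real (e - 1)) (u j) = Phi U - Phi (u j)" if j: "j \<in> B" for j
  proof -
    have "Phi U = Phi (u j) + (\<Sum>i\<in>B - {j}. Phi (u i))"
      unfolding PhiU[symmetric] by (rule sum.remove[OF finB j])
    then show ?thesis using main[OF j] by simp
  qed
  show False
  proof (cases "U = 0")
    \<comment> \<open>Summing \<open>main'\<close> over j gives (m - 1) Phi U = (e - 1) U; the upper
      bound 2/(m(m - 1)) on the eigenvalues of Phi yields e - 1 \<le> 2/m.\<close>
    case False
    have sumr: "(\<Sum>j\<in>B. Phi U - Phi (u j)) = sc (complex_of_real (m - 1)) (Phi U)"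
    proof -
      have "(\<Sum>j\<in>B. Phi U - Phi (u j)) = (\<Sum>j\<in>B. Phi U) - (\<Sum>j\<in>B. Phi (u j))"
        by (rule sum_subtractf)
      also have "\<dots> = sc (complex_of_real (m - 1)) (Phi U)"
        unfolding PhiU by (simp add: fun_eq_iff sum_fun_nth m_def algebra_simps)
      finally show ?thesis .
    qed
    have "sc (complex_of_real (e - 1)) U = (\<Sum>j\<in>B. sc (complex_of_real (e - 1)) (u j))"
      by (simp add: U_def cv.scale_sum_right)
    also have "\<dots> = sc (complex_of_real (m - 1)) (Phi U)"
      using main' sumr by simp
    finally have "sc (complex_of_real (m - 1)) (Phi U) = sc (complex_of_real (e - 1)) U" by simp
    then have "sc (complex_of_real (1 / (m - 1))) (sc (complex_of_real (m - 1)) (Phi U))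
        = sc (complex_of_real (1 / (m - 1))) (sc (complex_of_real (e - 1)) U)" by simp
    moreover have "complex_of_real (m - 1) \<noteq> 0"
      using m by (simp only: of_real_eq_0_iff)
    then have "complex_of_real m - 1 \<noteq> 0" by simp
    ultimately have Phi_U: "Phi U = sc (complex_of_real ((e - 1) / (m - 1))) U"
      by (auto simp: fun_eq_iff)
    have "- 1 / (real (card B) - 1) \<le> (e - 1) / (m - 1) \<and> (e - 1) / (m - 1) \<le> 2 / (real (card B) * (real (card B) - 1))"
    proof (rule Phi_eigenvalue_bounds[OF p q _ False])
      show "U \<in> cvecs d" unfolding U_def by (intro cvecs_sum u_in)
      show "R k U = U" if "k \<in> unitary_sub (B - {p})" for k
        unfolding U_def R_sum using u_fix that by (intro sum.cong refl) auto
      show "P B U = 0" unfolding U_def P_sum using PBu by (intro sum.neutral) auto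
    qed (use Phi_U Phi_def m e1 in auto)
    then have "(e - 1) / (m - 1) \<le> (2 / m) / (m - 1)" by (simp add: m_def)
    then have "e - 1 \<le> 2 / m" using m by (subst (asm) divide_le_cancel) linarith
    then show False using e by (simp add: m_def)
  next
    \<comment> \<open>Now a non-zero \<open>u j\<close> has Phi-eigenvalue - (e - 1), and the lower
      bound gives e - 1 \<le> 1/(m - 1), which is at most 2/m because m \<ge> 2.\<close>
    case True
    have "\<exists>j\<in>B. u j \<noteq> 0"
    proof (rule ccontr)
      assume "\<not> ?thesis"
      then have "w j = 0" if "j \<in> B" for j using that uw[of j] by simp
      then have "(\<Sum>i\<in>B. w i) = 0" by (intro sum.neutral) auto
      then have "sc (complex_of_real e) x = 0" using ex by simp
      then show False using x e1 by (auto simp: fun_eq_iff)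
    qed
    then obtain j where j: "j \<in> B" "u j \<noteq> 0" by blast
    have "Phi U = 0" using True by (simp add: Phi_def)
    then have "sc (complex_of_real (e - 1)) (u j) = - Phi (u j)" using main'[OF j(1)] by simp
    then have Phi_u: "Phi (u j) = sc (complex_of_real (- (e - 1))) (u j)"
      by (auto simp: fun_eq_iff) (metis minus_minus minus_diff_eq mult_minus_left)
    have "- 1 / (real (card B) - 1) \<le> - (e - 1) \<and> - (e - 1) \<le> 2 / (real (card B) * (real (card B) - 1))"
    proof (rule Phi_eigenvalue_bounds[OF p q u_in[of j] j(2)])
    qed (use Phi_u Phi_def u_fix PBu j e1 in auto)
    then have "e - 1 \<le> 1 / (m - 1)" by (simp add: m_def)
    also have "\<dots> \<le> 2 / m" using m by (simp add: field_simps)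
    finally show False using e by (simp add: m_def)
  qed
qed

section \<open>From the inequality for one set to all levels\<close>

definition defect :: "'n set \<Rightarrow> (nat \<Rightarrow> complex) \<Rightarrow> real" where
  "defect B x = Re (H x x) - Re (H x (P B x))"

lemma defect_nonneg:
  assumes x: "x \<in> cvecs d"
  shows "0 \<le> defect B x"
proof -
  have "H (x - P B x) (x - P B x) = H x x - H x (P B x)"
    using x H_P[OF x, of B x] H_P[of "P B x" B x] by (simp add: H_diff_left H_diff_right P_P_sub)
  moreover have "0 \<le> Re (H (x - P B x) (x - P B x))" by (intro H_nonneg cvecs_diff x P_in)
  ultimately show ?thesis by (simp add: defect_def)
qed

text \<open>At y = x - \<open>P B x\<close> the form of the operator from
  \<open>sum_P_remove_eigenvalue_le\<close> is m times the defect of B minus the sum of the defects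
  of the sets B - {i}, and it is at most 1 + 2/m times the defect of B. The factor is m - (1 + 2/m)
  = (m + 1)(m - 2)/m.\<close>

lemma defect_remove:
  assumes B: "card B \<ge> 2" and x: "x \<in> cvecs d"
  shows "(real (card B) + 1) * (real (card B) - 2) / real (card B) * defect B x \<le> (\<Sum>i\<in>B. defect (B - {i}) x)"
proof (cases "d = 0")
  case True
  have "H a b = 0" for a b unfolding H_def using True by simp
  then show ?thesis by (simp add: defect_def)
next
  case False
  define m where "m = real (card B)"
  have m: "m \<ge> 2" using B by (simp add: m_def)
  define M where "M = (\<lambda>i j. (\<Sum>l\<in>B. hI (B - {l}) (\<lambda>g. \<rho> g i j)) - of_nat (card B) * hI B (\<lambda>g. \<rho> g i j))"
  have M: "mat_app d M y = (\<Sum>i\<in>B. P (B - {i}) y) - sc (of_nat (card B)) (P B y)" for y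
  proof (rule ext)
    fix i
    have "(\<Sum>k<d. M i k * y k) = (\<Sum>l\<in>B. \<Sum>k<d. hI (B - {l}) (\<lambda>g. \<rho> g i k) * y k) - of_nat (card B) * (\<Sum>k<d. hI B (\<lambda>g. \<rho> g i k) * y k)"
      unfolding M_def left_diff_distrib sum_subtractf sum_distrib_right sum_distrib_left mult.assoc
      by (subst sum.swap) (rule refl)
    then show "mat_app d M y i = ((\<Sum>i\<in>B. P (B - {i}) y) - sc (of_nat (card B)) (P B y)) i"
      by (simp add: mat_app_def P_mat sum_fun_nth)
  qed
  have sa: "H (mat_app d M y) z = H y (mat_app d M z)" if "y \<in> cvecs d" "z \<in> cvecs d" for y z
  proof -
    have "H (mat_app d M y) z = cnj (H z (mat_app d M y))" by (simp add: H_cnj)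
    also have "\<dots> = (\<Sum>i\<in>B. H (P (B - {i}) y) z) - of_nat (card B) * H (P B y) z"
      unfolding M by (simp add: H_sum_right H_sc_right H_diff_right H_cnj)
    also have "\<dots> = H y (mat_app d M z)"
      unfolding M using that by (simp add: H_sum_right H_sc_right H_diff_right H_P)
    finally show ?thesis .
  qed
  obtain e :: real where e: "is_eigenvalue d M (complex_of_real e)"
      and le: "\<And>y. y \<in> cvecs d \<Longrightarrow> Re (H y (mat_app d M y)) \<le> e * Re (H y y)"
    using self_adjoint_max_eigenvalue[OF sa] False by (metis One_nat_def Suc_leI gr0I)
  from e obtain v where v: "v \<in> cvecs d" "v \<noteq> 0" "mat_app d M v = sc (complex_of_real e) v"
    unfolding eigenvalue_iff by blast
  have e_le: "e \<le> 1 + 2 / m"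
    unfolding m_def by (rule sum_P_remove_eigenvalue_le[OF B v(1,2)]) (use v(3) M in simp)
  define y where "y = x - P B x"
  have y: "y \<in> cvecs d" unfolding y_def by (intro cvecs_diff x P_in)
  have PBy: "P B y = 0" by (simp add: y_def P_diff P_P_sub)
  have yy: "Re (H y y) = defect B x"
  proof -
    have "H y y = H x y" unfolding y_def[of] using H_P[OF y, of B x] PBy
      by (simp add: H_diff_left y_def)
    then show ?thesis by (simp add: y_def H_diff_right defect_def)
  qed
  have yP: "Re (H y (P (B - {i}) y)) = Re (H x (P (B - {i}) x)) - Re (H x (P B x))" for i
  proof -
    have 1: "P (B - {i}) y = P (B - {i}) x - P B x"
      unfolding y_def P_diff by (simp add: P_P_sub Diff_subset)
    have "H (P B x) (P (B - {i}) x) = H x (P B x)"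
      using H_P[of "P (B - {i}) x" B x] x by (simp add: P_P_super Diff_subset)
    moreover have "H (P B x) (P B x) = H x (P B x)"
      using H_P[of "P B x" B x] by (simp add: P_P_sub)
    ultimately show ?thesis unfolding 1 by (simp add: y_def H_diff_left H_diff_right)
  qed
  have "Re (H y (mat_app d M y)) = (\<Sum>i\<in>B. Re (H x (P (B - {i}) x))) - m * Re (H x (P B x))"
    unfolding M PBy by (simp add: H_diff_right H_sum_right H_sc_right yP sum_subtractf m_def)
  also have "\<dots> = m * defect B x - (\<Sum>i\<in>B. defect (B - {i}) x)"
    by (simp add: defect_def sum_subtractf m_def algebra_simps)
  finally have "m * defect B x - (\<Sum>i\<in>B. defect (B - {i}) x) \<le> e * defect B x"
    using le[OF y] yy by simp
  also have "\<dots> \<le> (1 + 2 / m) * defect B x"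
    by (intro mult_right_mono e_le defect_nonneg x)
  finally have "(m - (1 + 2 / m)) * defect B x \<le> (\<Sum>i\<in>B. defect (B - {i}) x)"
    by (simp add: left_diff_distrib)
  moreover have "(m + 1) * (m - 2) / m = m - (1 + 2 / m)" using m by (simp add: field_simps)
  ultimately show ?thesis by (simp add: m_def)
qed

definition level_defect :: "nat \<Rightarrow> (nat \<Rightarrow> complex) \<Rightarrow> real" where
  "level_defect l x = (\<Sum>B | card B = l. defect B x)"

text \<open>Double counting of pairs (B, i) with i in B and card B = l + 1: removing i reaches each
  set C of size l once for every element of its complement.\<close>

lemma level_defect_step:
  assumes l: "1 \<le> l" "l < CARD('n)" and x: "x \<in> cvecs d"
  shows "(real l + 2) * (real l - 1) / (real l + 1) * level_defect (Suc l) x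
    \<le> (real CARD('n) - real l) * level_defect l x"
proof -
  have "(real l + 2) * (real l - 1) / (real l + 1) * level_defect (Suc l) x
    = (\<Sum>B | card B = Suc l. (real (card B) + 1) * (real (card B) - 2) / real (card B) * defect B x)"
    unfolding level_defect_def sum_distrib_left by (intro sum.cong refl) (simp add: algebra_simps)
  also have "\<dots> \<le> (\<Sum>B | card B = Suc l. \<Sum>i\<in>B. defect (B - {i}) x)"
    using l x by (intro sum_mono defect_remove) auto
  also have "\<dots> = (\<Sum>(B, i)\<in>Sigma {B. card B = Suc l} (\<lambda>B. B). defect (B - {i}) x)"
    by (rule sum.Sigma) auto
  also have "\<dots> = (\<Sum>(C, i)\<in>Sigma {C. card C = l} (\<lambda>C. - C). defect C x)"
  proof (rule sum.reindex_bij_witness[of _ "\<lambda>(C, i). (insert i C, i)" "\<lambda>(B, i). (B - {i}, i)"])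
  qed (auto simp: card_Diff_singleton insert_absorb)
  also have "\<dots> = (\<Sum>C | card C = l. \<Sum>i\<in>-C. defect C x)"
    by (rule sum.Sigma[symmetric]) auto
  also have "\<dots> = (real CARD('n) - real l) * level_defect l x"
    unfolding level_defect_def sum_distrib_left
    using l by (intro sum.cong refl) (simp add: Compl_eq_Diff_UNIV card_Diff_subset of_nat_diff)
  finally show ?thesis .
qed

lemma binomial_step: "Suc k * (n choose Suc k) = (n - k) * (n choose k)"
  by (metis binomial_absorption binomial_absorb_comp)

text \<open>At l = n the coefficient is 1 and the defect is the full square norm. In the step, (l -
  1) binom(n - 2, l - 1) = (n - l) binom(n - 2, l - 2), and the remaining factor (l + 2)/(l + 1)
  turns the denominator l + 2 into l + 1.\<close>

lemma level_defect_lower: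
  assumes inv: "\<And>x. x \<in> cvecs d \<Longrightarrow> P UNIV x = 0" and x: "x \<in> cvecs d"
    and l: "2 \<le> l" "l \<le> CARD('n)"
  shows "real (CARD('n) + 1) / real (l + 1) * real ((CARD('n) - 2) choose (l - 2)) * Re (H x x) \<le> level_defect l x"
  using l(2) l(1)
proof (induction rule: inc_induct)
  case base
  have "{B::'n set. card B = CARD('n)} = {UNIV}" using card_subset_eq[of "UNIV :: 'n set"] by auto
  then show ?case using inv[OF x] by (simp add: level_defect_def defect_def)
next
  case (step l)
  define n where "n = CARD('n)"
  define N where "N = Re (H x x)"
  have ln: "2 \<le> l" "l < n" using step by (auto simp: n_def)
  obtain k where k: "l = k + 2" using ln(1) by (metis add.commute le_Suc_ex)
  have bin: "(real l - 1) * real ((n - 2) choose (Suc l - 2)) = (real n - real l) * real ((n - 2) choose (l - 2))"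
  proof -
    have "real (Suc k) * real ((n - 2) choose Suc k) = real (n - 2 - k) * real ((n - 2) choose k)"
      by (metis binomial_step of_nat_mult)
    moreover have "real l - 1 = real (Suc k)" using k by simp
    moreover have "real (n - 2 - k) = real n - real l" using ln k by (simp add: of_nat_diff)
    moreover have "Suc l - 2 = Suc k" "l - 2 = k" using k by auto
    ultimately show ?thesis by simp
  qed
  have IH: "real (n + 1) / real (Suc l + 1) * real ((n - 2) choose (Suc l - 2)) * N \<le> level_defect (Suc l) x"
    using step by (simp add: n_def N_def)
  have pos: "0 \<le> (real l + 2) * (real l - 1) / (real l + 1)" using ln by simp
  have "(real n - real l) * (real (n + 1) / real (l + 1) * real ((n - 2) choose (l - 2)) * N)
    = real (n + 1) / real (l + 1) * ((real n - real l) * real ((n - 2) choose (l - 2))) * N" by simp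
  also have "\<dots> = real (n + 1) / real (l + 1) * ((real l - 1) * real ((n - 2) choose (Suc l - 2))) * N"
    by (simp only: bin)
  also have "\<dots> = (real l + 2) * (real l - 1) / (real l + 1) * (real (n + 1) / real (Suc l + 1) * real ((n - 2) choose (Suc l - 2)) * N)"
  proof -
    have "y / b * (c * D) * M = a * c / b * (y / a * D * M)" if "a \<noteq> 0" "b \<noteq> 0" for a b c y D M :: real
      using that by simp
    from this[of "real l + 2" "real l + 1"] show ?thesis by (simp add: add.commute)
  qed
  also have "\<dots> \<le> (real l + 2) * (real l - 1) / (real l + 1) * level_defect (Suc l) x"
    by (rule mult_left_mono[OF IH pos])
  also have "\<dots> \<le> (real n - real l) * level_defect l x"
    using level_defect_step[of l x] ln x by (simp add: n_def)
  finally have "real (n + 1) / real (l + 1) * real ((n - 2) choose (l - 2)) * N \<le> level_defect l x"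
    using ln by (subst (asm) mult_le_cancel_left_pos) auto
  then show ?case by (simp add: n_def N_def)
qed

text \<open>The fixed vectors form an invariant subspace; were it everything, each
  \<open>\<rho> g\<close> would be the identity matrix.\<close>

lemma irrep_no_invariants:
  assumes irr: "is_irrep d \<rho>" and nt: "\<not> is_trivial_rep d \<rho>" and x: "x \<in> cvecs d"
  shows "P UNIV x = 0"
proof -
  define W where "W = {x \<in> cvecs d. \<forall>g\<in>unitary_grp. R g x = x}"
  have add: "(\<lambda>k. v k + w k) = v + w" "(\<lambda>k. a * v k) = sc a v" "(\<lambda>_. 0) = (0 :: nat \<Rightarrow> complex)" for v w :: "nat \<Rightarrow> complex" and a
    by (auto simp: fun_eq_iff)
  have "W = {\<lambda>_. 0} \<or> W = cvecs d"
  proof -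
    have "W \<subseteq> cvecs d \<and> (\<lambda>_. 0) \<in> W \<and>
          (\<forall>v\<in>W. \<forall>w\<in>W. (\<lambda>k. v k + w k) \<in> W) \<and>
          (\<forall>a. \<forall>v\<in>W. (\<lambda>k. a * v k) \<in> W) \<and>
          (\<forall>A\<in>unitary_grp. \<forall>v\<in>W. mat_app d (\<rho> A) v \<in> W)"
      unfolding add R_def[symmetric]
      by (auto simp: W_def R_add R_sc cvecs_add cvecs_sc)
    then show ?thesis using irr unfolding is_irrep_def by blast
  qed
  moreover have "P UNIV x \<in> W" using R_P[of _ UNIV x] by (simp add: W_def)
  moreover have "W \<noteq> cvecs d"
  proof
    assume W: "W = cvecs d"
    have "\<rho> g = idm d" if g: "g \<in> unitary_grp" for g
    proof (intro ext)
      fix i j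
      show "\<rho> g i j = idm d i j"
      proof (cases "i < d \<and> j < d")
        case True
        define e where "e = (\<lambda>k. if k = j then 1 else 0 :: complex)"
        have "e \<in> W" unfolding W using True by (auto simp: e_def cvecs_def)
        then have "R g e i = e i" using g by (simp add: W_def)
        then show ?thesis
          using True by (simp add: R_def mat_app_def e_def idm_def if_distrib[of "\<lambda>x. _ * x"] cong: if_cong)
      next
        case False
        then show ?thesis using rep g unfolding is_rep_def idm_def by (auto simp: not_less)
      qed
    qed
    then show False using nt by (simp add: is_trivial_rep_def)
  qed
  ultimately show ?thesis by (auto simp: zero_fun_def)
qed

lemma sum_by_card:
  fixes f :: "nat \<Rightarrow> 'n set \<Rightarrow> real"
  shows "(\<Sum>B\<in>UNIV. f (card B) B) = (\<Sum>l=0..CARD('n). \<Sum>B | card B = l. f l B)"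
proof -
  have "(\<Sum>l=0..CARD('n). \<Sum>B | card B = l. f l B) = (\<Sum>l=0..CARD('n). \<Sum>B\<in>{B \<in> UNIV. card B = l}. f (card B) B)"
    by (intro sum.cong) auto
  also have "\<dots> = (\<Sum>B\<in>UNIV. f (card B) B)"
    by (rule sum.group) (auto simp: card_mono)
  finally show ?thesis by simp
qed

lemma laplacian_eigenvalue_lower:
  assumes irr: "is_irrep d \<rho>" and nt: "\<not> is_trivial_rep d \<rho>"
    and c: "\<forall>l\<le>CARD('n). c l \<ge> 0"
    and e: "is_eigenvalue d (laplacian (\<lambda>B. c (card B)) \<mu> d \<rho>) (complex_of_real e)"
  shows "(\<Sum>l=0..CARD('n). c l * (real (CARD('n) + 1) / real (l + 1)) *
      (if l < 2 then 0 else real ((CARD('n) - 2) choose (l - 2)))) \<le> e"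
proof -
  obtain x where x: "x \<in> cvecs d" "x \<noteq> 0"
      "mat_app d (laplacian (\<lambda>B. c (card B)) \<mu> d \<rho>) x = sc (complex_of_real e) x"
    using e unfolding eigenvalue_iff by blast
  define N where "N = Re (H x x)"
  have N: "N > 0" unfolding N_def by (rule H_pos[OF x(1,2)])
  have "e * N = Re (H x (sc (complex_of_real e) x))" by (simp add: H_sc_right N_def)
  also have "\<dots> = (\<Sum>B\<in>UNIV. c (card B) * defect B x)"
    unfolding x(3)[symmetric] laplacian_app[OF x(1)]
    by (simp add: H_sum_right H_sc_right H_diff_right defect_def)
  also have "\<dots> = (\<Sum>l=0..CARD('n). \<Sum>B | card B = l. c l * defect B x)"
    by (rule sum_by_card)
  also have "\<dots> = (\<Sum>l=0..CARD('n). c l * level_defect l x)"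
    by (simp add: level_defect_def sum_distrib_left)
  finally have eN: "e * N = (\<Sum>l=0..CARD('n). c l * level_defect l x)" .
  have "(\<Sum>l=0..CARD('n). c l * (real (CARD('n) + 1) / real (l + 1)) *
      (if l < 2 then 0 else real ((CARD('n) - 2) choose (l - 2)))) * N
      = (\<Sum>l=0..CARD('n). c l * (real (CARD('n) + 1) / real (l + 1) *
      (if l < 2 then 0 else real ((CARD('n) - 2) choose (l - 2))) * N))"
    by (simp only: sum_distrib_right mult.assoc)
  also have "\<dots> \<le> (\<Sum>l=0..CARD('n). c l * level_defect l x)"
  proof (intro sum_mono mult_left_mono)
    fix l assume l: "l \<in> {0..CARD('n)}"
    show "0 \<le> c l" using c l by simp
    show "real (CARD('n) + 1) / real (l + 1) * (if l < 2 then 0 else real ((CARD('n) - 2) choose (l - 2))) * N \<le> level_defect l x"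
    \<comment> \<open>Levels 0 and 1 have coefficient 0 and need only nonnegative defects.\<close>
    proof (cases "l < 2")
      case True
      then show ?thesis using defect_nonneg[OF x(1)] by (simp add: level_defect_def sum_nonneg)
    next
      case False
      then show ?thesis
        using level_defect_lower[OF irrep_no_invariants[OF irr nt] x(1), of l] l by (simp add: N_def)
    qed
  qed
  finally show ?thesis unfolding eN[symmetric] using N by simp
qed

end

context haar_family
begin

text \<open>The set of real eigenvalues is finite and non-empty, so a bound on all eigenvalues
  bounds \<open>Min\<close>.\<close>

lemma lambda_min_lower:
  assumes irr: "is_irrep d \<rho>" and nt: "\<not> is_trivial_rep d \<rho>"
    and c: "\<forall>l\<le>CARD('n). c l \<ge> 0"
  shows "(\<Sum>l=0..CARD('n). c l * (real (CARD('n) + 1) / real (l + 1)) *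
      (if l < 2 then 0 else real ((CARD('n) - 2) choose (l - 2)))) \<le> lambda_min (\<lambda>B. c (card B)) \<mu> d \<rho>"
proof -
  have rep: "is_rep d \<rho>" and d: "1 \<le> d" using irr by (auto simp: is_irrep_def)
  obtain h where "urep \<mu> d h \<rho>" using rep_unitarizable[OF rep] by blast
  then interpret urep \<mu> d h \<rho> .
  let ?L = "laplacian (\<lambda>B. c (card B)) \<mu> d \<rho>"
  have "finite {x::real. is_eigenvalue d ?L (complex_of_real x)}"
    by (rule finite_real_eigenvalues[OF laplacian_self_adjoint])
  moreover have "{x::real. is_eigenvalue d ?L (complex_of_real x)} \<noteq> {}"
    using self_adjoint_max_eigenvalue[OF laplacian_self_adjoint d] by blast
  ultimately show ?thesis
    unfolding lambda_min_def using laplacian_eigenvalue_lower[OF irr nt c] by (subst Min_ge_iff) auto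
qed

end

section \<open>Highest weight vectors\<close>

text \<open>Polarisation: projections onto lines span all matrices over the complex numbers. Up to
  the factor i they are the generators of the reflection groups, so an identity linear in X can be
  checked by differentiating along reflections.\<close>

lemma complex_linear_ext:
  fixes L :: "complex^('n::finite)^'n \<Rightarrow> complex"
  assumes add: "\<And>X Y. L (X + Y) = L X + L Y" and csm: "\<And>z X. L (csm z X) = z * L X"
    and rank1: "\<And>a. cin a a = 1 \<Longrightarrow> L (outer a a) = 0"
  shows "L X = 0"
proof -
  have zero: "L 0 = 0" using add[of 0 0] by simp
  have Lsum: "L (\<Sum>i\<in>I. f i) = (\<Sum>i\<in>I. L (f i))" for I :: "'n set" and f
    by (induction I rule: infinite_finite_induct) (auto simp: add zero)
  have unit: "L (outer (axis i 1) (axis j 1)) = 0" for i j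
  proof (cases "i = j")
    case True
    then show ?thesis by (simp add: rank1)
  next
    case False
    define s where "s = complex_of_real (1 / sqrt 2)"
    have s: "s * s = 1/2" "cnj s = s" by (simp_all add: s_def of_real_mult[symmetric] del: of_real_mult) 
    define a where "a = (\<lambda>w::complex. (\<chi> l. if l = i then s else if l = j then s * w else 0) :: complex^'n)"
    have unit_a: "cin (a w) (a w) = 1" if w: "cnj w * w = 1" for w
    proof -
      have "cin (a w) (a w) = (\<Sum>l\<in>{i,j}. cnj (a w $ l) * a w $ l)"
        unfolding cin_def by (rule sum.mono_neutral_right) (auto simp: a_def)
      also have "\<dots> = s * s + s * s * (cnj w * w)"
        using False s by (simp add: a_def mult_ac)
      finally show ?thesis using s w by simp
    qed
    \<comment> \<open>The projection onto \<open>a w\<close> has the entry cnj w / 2 at (i, j).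
      Weighting with w keeps this entry and cancels the others, since w and w^2 sum to 0 over the
      fourth roots of unity.\<close>
    have "outer (axis i 1) (axis j 1) = csm (1/2) (outer (a 1) (a 1) + csm \<i> (outer (a \<i>) (a \<i>))
      + csm (-1) (outer (a (-1)) (a (-1))) + csm (-\<i>) (outer (a (-\<i>)) (a (-\<i>))))"
      using False s by (auto simp: vec_eq_iff a_def axis_def algebra_simps)
    then show ?thesis
      by (simp only: csm add) (simp add: rank1 unit_a)
  qed
  have "X = (\<Sum>i\<in>UNIV. \<Sum>j\<in>UNIV. csm (X$i$j) (outer (axis i 1) (axis j 1)))"
    by (simp add: vec_eq_iff axis_def if_distrib[of "\<lambda>x. _ * x"] if_distrib[of "\<lambda>x. x * _"] if_distrib[of cnj] cong: if_cong)
  then have "L X = L (\<Sum>i\<in>UNIV. \<Sum>j\<in>UNIV. csm (X$i$j) (outer (axis i 1) (axis j 1)))" by simp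
  also have "\<dots> = 0" by (simp only: Lsum csm unit) simp
  finally show ?thesis .
qed

lemma cis_has_vector_derivative: "(cis has_vector_derivative \<i> * cis t) (at t)"
  unfolding has_vector_derivative_def using has_derivative_cis[OF has_derivative_ident, of t UNIV] by simp

lemma refl_curve_derivative:
  "((\<lambda>t. refl_mat a (cis t)) has_vector_derivative csm \<i> (outer a a)) (at 0)"
proof -
  have lin: "bounded_linear (\<lambda>z. csm z (outer a a))"
    by (rule linear_conv_bounded_linear[THEN iffD1]) (auto intro!: linearI simp: vec_eq_iff algebra_simps)
  have "(cis has_vector_derivative \<i>) (at 0)"
    using cis_has_vector_derivative[of 0] by simp
  then have "((\<lambda>t. cis t - 1) has_vector_derivative \<i>) (at 0)"
    by (auto intro: derivative_eq_intros)
  then have "((\<lambda>t. csm (cis t - 1) (outer a a)) has_vector_derivative csm \<i> (outer a a)) (at 0)"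
    by (rule bounded_linear.has_vector_derivative[OF lin])
  then show ?thesis unfolding refl_mat_def by (auto intro: derivative_eq_intros)
qed

text \<open>The differential of an ambient extension is only real linear, and only its values on
  skew-hermitian matrices belong to the group. D is the complex linear extension of those values,
  which explains the factor i in the derivative along reflections.\<close>

lemma smooth_rep_imp_lie:
  fixes \<rho> :: "complex^('n::finite)^'n \<Rightarrow> nat \<Rightarrow> nat \<Rightarrow> complex"
  assumes smooth: "\<And>i j. i < d \<Longrightarrow> j < d \<Longrightarrow> \<exists>F. F differentiable (at (mat 1)) \<and> (\<forall>g\<in>unitary_grp. F g = \<rho> g i j)"
  obtains D where "\<And>X Y i j. D (X + Y) i j = D X i j + D Y i j" "\<And>z X i j. D (csm z X) i j = z * D X i j"
    "\<And>a i j. cin a a = 1 \<Longrightarrow> i < d \<Longrightarrow> j < d \<Longrightarrow>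
      ((\<lambda>t. \<rho> (refl_mat a (cis t)) i j) has_vector_derivative (\<i> * D (outer a a) i j)) (at 0)"
proof -
  have "\<forall>i j. \<exists>F F'. i < d \<and> j < d \<longrightarrow> (F has_derivative F') (at (mat 1)) \<and> (\<forall>g\<in>unitary_grp. F g = \<rho> g i j)"
    using smooth unfolding differentiable_def by metis
  then obtain F F' where F: "\<And>i j. i < d \<Longrightarrow> j < d \<Longrightarrow> (F i j has_derivative F' i j) (at (mat 1))"
      "\<And>i j g. i < d \<Longrightarrow> j < d \<Longrightarrow> g \<in> unitary_grp \<Longrightarrow> F i j g = \<rho> g i j"
    by metis
  define G where "G = (\<lambda>i j. if i < d \<and> j < d then F' i j else (\<lambda>_. 0))"
  have linG: "linear (G i j)" for i j
  proof (cases "i < d \<and> j < d")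
    case True
    then show ?thesis using F(1)[of i j] by (auto simp: G_def intro: has_derivative_linear)
  qed (auto simp: G_def intro: linearI)
  \<comment> \<open>X = A X + i B X with both parts skew-hermitian.\<close>
  define A where "A = (\<lambda>X::complex^'n^'n. (1/2) *\<^sub>R (X - adjm X))"
  define B where "B = (\<lambda>X::complex^'n^'n. csm (-\<i>/2) (X + adjm X))"
  define D where "D = (\<lambda>X i j. G i j (A X) + \<i> * G i j (B X))"
  have A_add: "A (X + Y) = A X + A Y" and B_add: "B (X + Y) = B X + B Y" for X Y
    by (simp_all add: A_def B_def vec_eq_iff algebra_simps)
  have A_csm: "A (csm z X) = Re z *\<^sub>R A X - Im z *\<^sub>R B X" and B_csm: "B (csm z X) = Re z *\<^sub>R B X + Im z *\<^sub>R A X" for z X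
    by (simp_all add: A_def B_def vec_eq_iff complex_eq_iff field_simps)
  show ?thesis
  proof (rule that)
    show "D (X + Y) i j = D X i j + D Y i j" for X Y i j
      by (simp add: D_def A_add B_add linear_add[OF linG] algebra_simps)
    show "D (csm z X) i j = z * D X i j" for z X i j
      by (simp add: D_def A_csm B_csm linear_add[OF linG] linear_diff[OF linG] linear_scale[OF linG]
          complex_eq_iff algebra_simps)
    fix a :: "complex^'n" and i j assume a: "cin a a = 1" and ij: "i < d" "j < d"
    have "\<i> * D (outer a a) i j = F' i j (csm \<i> (outer a a))"
    proof -
      have "A (outer a a) = 0" by (simp add: A_def adjm_outer)
      moreover have "B (outer a a) = - csm \<i> (outer a a)"
        by (simp add: B_def adjm_outer vec_eq_iff algebra_simps)
      ultimately show ?thesis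
        using ij linear_0[OF linG, of i j] linear_neg[OF linG, of i j "csm \<i> (outer a a)"] by (simp add: D_def G_def)
    qed
    moreover have "((\<lambda>t. F i j (refl_mat a (cis t))) has_vector_derivative F' i j (csm \<i> (outer a a))) (at 0)"
    proof -
      have "(F i j has_derivative F' i j) (at (refl_mat a (cis 0)))" using F(1)[OF ij] by simp
      then have "(F i j \<circ> (\<lambda>t. refl_mat a (cis t)) has_derivative F' i j \<circ> (\<lambda>s. s *\<^sub>R csm \<i> (outer a a))) (at 0)"
        by (rule diff_chain_at[OF refl_curve_derivative[unfolded has_vector_derivative_def]])
      moreover have "F' i j \<circ> (\<lambda>s. s *\<^sub>R csm \<i> (outer a a)) = (\<lambda>s. s *\<^sub>R F' i j (csm \<i> (outer a a)))"
        using linear_scale[OF has_derivative_linear[OF F(1)[OF ij]]] by (auto simp: fun_eq_iff)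
      ultimately show ?thesis by (simp add: has_vector_derivative_def o_def)
    qed
    moreover have "(\<lambda>t. F i j (refl_mat a (cis t))) = (\<lambda>t. \<rho> (refl_mat a (cis t)) i j)"
      using F(2)[OF ij] refl_mat_unitary[OF a] by auto
    ultimately show "((\<lambda>t. \<rho> (refl_mat a (cis t)) i j) has_vector_derivative (\<i> * D (outer a a) i j)) (at 0)"
      by simp
  qed
qed

text \<open>The growth C M^k makes the Maclaurin remainder C |M t|^n / n! tend to 0. Taylor's
  formula is applied to real functions, so f is first multiplied by a unit w; w = 1 and w = -i
  recover real and imaginary part.\<close>

lemma analytic_zero:
  fixes f :: "nat \<Rightarrow> real \<Rightarrow> complex"
  assumes der: "\<And>k t. (f k has_vector_derivative \<i> * f (Suc k) t) (at t)"
    and zero: "\<And>k. f k 0 = 0" and bound: "\<And>k t. cmod (f k t) \<le> C * M ^ k"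
  shows "f 0 t = 0"
proof -
  have C: "C \<ge> 0" using bound[of 0 0] by (metis norm_ge_zero order_trans mult.right_neutral power_0)
  have real_part: "Re (w * f 0 t) = 0" if w: "cmod w = 1" for w
  proof -
    define g where "g = (\<lambda>k t. Re (w * \<i> ^ k * f k t))"
    have dg: "DERIV (g k) t :> g (Suc k) t" for k t
    proof -
      have "((\<lambda>t. w * \<i> ^ k * f k t) has_vector_derivative w * \<i> ^ k * (\<i> * f (Suc k) t)) (at t)"
        by (rule has_vector_derivative_mult_right[OF der])
      then have "((\<lambda>t. Re (w * \<i> ^ k * f k t)) has_vector_derivative Re (w * \<i> ^ k * (\<i> * f (Suc k) t))) (at t)"
        by (rule bounded_linear.has_vector_derivative[OF bounded_linear_Re])
      then show ?thesis unfolding g_def has_real_derivative_iff_has_vector_derivative by (simp add: mult_ac)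
    qed
    have gb: "\<bar>g k t\<bar> \<le> C * M ^ k" for k t
    proof -
      have "\<bar>g k t\<bar> \<le> cmod (w * \<i> ^ k * f k t)" unfolding g_def by (rule abs_Re_le_cmod)
      also have "\<dots> = cmod (f k t)" using w by (simp add: norm_mult norm_power)
      finally show ?thesis using bound[of k t] by linarith
    qed
    have "\<bar>g 0 t\<bar> \<le> C * \<bar>(M * t) ^ n / fact n\<bar>" for n
    proof -
      have "\<exists>s. \<bar>s\<bar> \<le> \<bar>t\<bar> \<and> g 0 t = (\<Sum>m<n. g m 0 / fact m * t ^ m) + g n s / fact n * t ^ n"
        using Maclaurin_all_le_objl[of g "g 0" t n] dg by blast
      then obtain s where "g 0 t = g n s / fact n * t ^ n" by (auto simp: g_def zero)
      then have "\<bar>g 0 t\<bar> = \<bar>g n s\<bar> * \<bar>t ^ n / fact n\<bar>" by (simp add: abs_mult)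
      also have "\<dots> \<le> \<bar>C * M ^ n\<bar> * \<bar>t ^ n / fact n\<bar>"
        using gb[of n s] by (intro mult_right_mono) auto
      also have "\<dots> = C * \<bar>(M * t) ^ n / fact n\<bar>"
        using C by (simp add: abs_mult power_mult_distrib)
      finally show ?thesis .
    qed
    moreover have "(\<lambda>n. C * \<bar>(M * t) ^ n / fact n\<bar>) \<longlonglongrightarrow> C * \<bar>0\<bar>"
    proof -
      have "(\<lambda>n. inverse (fact n) * (M * t) ^ n) \<longlonglongrightarrow> 0"
        by (rule summable_LIMSEQ_zero[OF summable_exp])
      then show ?thesis by (intro tendsto_intros) (simp add: field_simps)
    qed
    ultimately have "\<bar>g 0 t\<bar> \<le> C * \<bar>0\<bar>"
      using LIMSEQ_le_const by blast
    then show ?thesis by (simp add: g_def)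
  qed
  have "Re (f 0 t) = 0" using real_part[of 1] by simp
  moreover have "Im (f 0 t) = 0" using real_part[of "-\<i>"] by simp
  ultimately show ?thesis by (simp add: complex_eq_iff)
qed

locale lie_rep = urep \<mu> d h \<rho>
  for \<mu> :: "'n::finite set \<Rightarrow> (complex^'n^'n) measure" and d h \<rho> +
  fixes D :: "complex^'n^'n \<Rightarrow> nat \<Rightarrow> nat \<Rightarrow> complex"
  assumes D_add: "D (X + Y) i j = D X i j + D Y i j"
    and D_csm: "D (csm z X) i j = z * D X i j"
    and D_deriv: "cin a a = 1 \<Longrightarrow> i < d \<Longrightarrow> j < d \<Longrightarrow>
      ((\<lambda>t. \<rho> (refl_mat a (cis t)) i j) has_vector_derivative (\<i> * D (outer a a) i j)) (at 0)"
begin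

definition DD :: "complex^'n^'n \<Rightarrow> (nat \<Rightarrow> complex) \<Rightarrow> nat \<Rightarrow> complex" where
  "DD X x = mat_app d (D X) x"

lemma DD_in [simp]: "DD X x \<in> cvecs d" by (simp add: DD_def)
lemma DD_add: "DD X (x + y) = DD X x + DD X y" by (simp add: DD_def mat_app_add)
lemma DD_sc: "DD X (sc a x) = sc a (DD X x)" by (simp add: DD_def mat_app_sc)
lemma DD_sum: "DD X (\<Sum>i\<in>I. f i) = (\<Sum>i\<in>I. DD X (f i))" by (simp only: DD_def mat_app_sum)
lemma DD_add_mat: "DD (X + Y) x = DD X x + DD Y x"
  by (auto simp: DD_def mat_app_def fun_eq_iff D_add algebra_simps sum.distrib)

lemma DD_csm: "DD (csm z X) x = sc z (DD X x)"
  by (auto simp: DD_def mat_app_def fun_eq_iff D_csm sum_distrib_left mult_ac)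

lemma DD_zero_mat [simp]: "DD 0 x = 0"
proof -
  have "csm 0 0 = (0 :: complex^'n^'n)" by (simp add: vec_eq_iff)
  then show ?thesis using DD_csm[of 0 0 x] by (auto simp: fun_eq_iff)
qed

lemma DD_minus_mat: "DD (X - Y) x = DD X x - DD Y x"
proof -
  have "X - Y = X + csm (-1) Y" by (simp add: vec_eq_iff)
  then have "DD (X - Y) x = DD (X + csm (-1) Y) x" by (simp only:)
  then show ?thesis by (simp add: DD_add_mat DD_csm fun_eq_iff)
qed

lemma DD_sum_mat: "DD (\<Sum>i\<in>I. X i) x = (\<Sum>i\<in>I. DD (X i) x)"
  by (induction I rule: infinite_finite_induct)
    (simp_all only: sum.infinite sum.empty sum.insert DD_zero_mat DD_add_mat not_False_eq_True)

lemma mat_app_has_derivative: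
  assumes "\<And>k. k < d \<Longrightarrow> ((\<lambda>t. f t k) has_vector_derivative f' k) (at t0)"
  shows "((\<lambda>t. mat_app d M (f t) i) has_vector_derivative mat_app d M f' i) (at t0)"
  unfolding mat_app_def
  by (cases "i < d") (auto intro!: has_vector_derivative_sum has_vector_derivative_mult_right assms)

lemma H_has_derivative:
  assumes "\<And>k. k < d \<Longrightarrow> ((\<lambda>t. f t k) has_vector_derivative f' k) (at t0)"
  shows "((\<lambda>t. H x (f t)) has_vector_derivative H x f') (at t0)"
  unfolding H_def
  by (auto intro!: has_vector_derivative_sum has_vector_derivative_mult_right assms)

lemma R_refl_derivative_0:
  assumes "cin a a = 1"
  shows "((\<lambda>t. R (refl_mat a (cis t)) x i) has_vector_derivative \<i> * DD (outer a a) x i) (at 0)"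
proof (cases "i < d")
  case True
  have "((\<lambda>t. \<Sum>k<d. \<rho> (refl_mat a (cis t)) i k * x k) has_vector_derivative (\<Sum>k<d. \<i> * D (outer a a) i k * x k)) (at 0)"
    by (intro has_vector_derivative_sum has_vector_derivative_mult_left D_deriv assms True) auto
  then show ?thesis using True by (simp add: R_def DD_def mat_app_def sum_distrib_left mult.assoc)
qed (simp add: R_def DD_def mat_app_def)

text \<open>The reflections along a form a one-parameter group, which transports the derivative from
  0 to \<open>t0\<close>.\<close>

lemma R_refl_derivative:
  assumes a: "cin a a = 1"
  shows "((\<lambda>t. R (refl_mat a (cis t)) x i) has_vector_derivative \<i> * R (refl_mat a (cis t0)) (DD (outer a a) x) i) (at t0)"
proof -
  have 1: "R (refl_mat a (cis t)) x = R (refl_mat a (cis t0)) (R (refl_mat a (cis (t - t0))) x)" for t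
    by (subst R_mult[symmetric]) (simp_all add: refl_mat_mul a refl_mat_unitary cis_mult)
  have "((\<lambda>t. R (refl_mat a (cis (t - t0))) x k) has_vector_derivative sc \<i> (DD (outer a a) x) k) (at t0)" for k
  proof -
    have "((\<lambda>t. t - t0) has_vector_derivative 1) (at t0)" by (auto intro!: derivative_eq_intros)
    moreover have "((\<lambda>t. R (refl_mat a (cis t)) x k) has_vector_derivative \<i> * DD (outer a a) x k) (at (t0 - t0))"
      using R_refl_derivative_0[OF a] by simp
    ultimately show ?thesis
      using vector_diff_chain_at[of "\<lambda>t. t - t0" 1 t0 "\<lambda>t. R (refl_mat a (cis t)) x k" "\<i> * DD (outer a a) x k"]
      by (simp add: o_def)
  qed
  then have "((\<lambda>t. mat_app d (\<rho> (refl_mat a (cis t0))) (R (refl_mat a (cis (t - t0))) x) i) has_vector_derivative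
      mat_app d (\<rho> (refl_mat a (cis t0))) (sc \<i> (DD (outer a a) x)) i) (at t0)"
    by (intro mat_app_has_derivative)
  moreover have "(\<lambda>t. R (refl_mat a (cis t)) x i) = (\<lambda>t. mat_app d (\<rho> (refl_mat a (cis t0))) (R (refl_mat a (cis (t - t0))) x) i)"
    by (rule ext, subst 1, subst (1) R_def, rule refl)
  ultimately show ?thesis by (simp add: R_def[symmetric] R_sc)
qed

text \<open>At X = \<open>outer a a\<close> both sides are derivatives of one curve, because
  conjugation by g takes the reflection along a to the reflection along g a.\<close>

lemma DD_equivariant:
  assumes g: "g \<in> unitary_grp" and x: "x \<in> cvecs d"
  shows "R g (DD X (R (adjm g) x)) = DD (g ** X ** adjm g) x"
proof (rule ext)
  fix i
  define L where "L = (\<lambda>X. R g (DD X (R (adjm g) x)) i - DD (g ** X ** adjm g) x i)"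
  have "L X = 0"
  proof (rule complex_linear_ext)
    show "L (X + Y) = L X + L Y" for X Y
      by (simp add: L_def DD_add_mat R_add matrix_add_ldistrib matrix_add_rdistrib)
    show "L (csm z X) = z * L X" for z X
      by (simp add: L_def DD_csm R_sc csm_mul_left csm_mul_right algebra_simps)
    fix a :: "complex^'n" assume a: "cin a a = 1"
    have ga: "cin (g *v a) (g *v a) = 1" using a by (simp add: cin_mult_unitary[OF g])
    have refl: "g ** refl_mat a z ** adjm g = refl_mat (g *v a) z" for z
      using g by (simp add: refl_mat_def matrix_add_ldistrib matrix_add_rdistrib csm_mul_left csm_mul_right mul_outer_adjm)
    have "R (refl_mat (g *v a) (cis t)) x = R g (R (refl_mat a (cis t)) (R (adjm g) x))" for t
      unfolding refl[symmetric] using g a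
      by (simp add: R_mult unitary_adj unitary_mul refl_mat_unitary)
    then have "((\<lambda>t. R g (R (refl_mat a (cis t)) (R (adjm g) x)) i) has_vector_derivative \<i> * DD (outer (g *v a) (g *v a)) x i) (at 0)"
      using R_refl_derivative_0[OF ga, of x i] by simp
    moreover have "((\<lambda>t. R g (R (refl_mat a (cis t)) (R (adjm g) x)) i) has_vector_derivative
        R g (sc \<i> (DD (outer a a) (R (adjm g) x))) i) (at 0)"
      unfolding R_def[of g] by (intro mat_app_has_derivative) (simp add: R_refl_derivative_0[OF a])
    ultimately have "\<i> * DD (outer (g *v a) (g *v a)) x i = R g (sc \<i> (DD (outer a a) (R (adjm g) x))) i"
      by (rule vector_derivative_unique_at)
    then show "L (outer a a) = 0" by (simp add: L_def mul_outer_adjm R_sc)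
  qed
  then show "R g (DD X (R (adjm g) x)) i = DD (g ** X ** adjm g) x i" by (simp add: L_def)
qed

text \<open>The derivative of equivariance along a reflection curve.\<close>

lemma DD_bracket:
  assumes x: "x \<in> cvecs d"
  shows "DD X (DD Y x) - DD Y (DD X x) = DD (X ** Y - Y ** X) x"
proof (rule ext)
  fix i
  define L where "L = (\<lambda>X. DD X (DD Y x) i - DD Y (DD X x) i - DD (X ** Y - Y ** X) x i)"
  have "L X = 0"
  proof (rule complex_linear_ext)
    show "L (X + X') = L X + L X'" for X X'
      by (simp add: L_def DD_add_mat DD_minus_mat DD_add matrix_add_ldistrib matrix_add_rdistrib algebra_simps)
    show "L (csm z X) = z * L X" for z X
      by (simp add: L_def DD_csm DD_minus_mat DD_sc csm_mul_left csm_mul_right algebra_simps)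
    fix a :: "complex^'n" assume a: "cin a a = 1"
    let ?Q = "outer a a" and ?r = "\<lambda>t. refl_mat a (cis t)"
    have rU: "?r t \<in> unitary_grp" for t by (simp add: refl_mat_unitary a)
    \<comment> \<open>The conjugate is a polynomial in cis t - 1 and its complex conjugate. Both
      vanish at 0, so the last term contributes no derivative and the linear terms give the
      commutator.\<close>
    have conj: "?r t ** Y ** adjm (?r t) = Y + csm (cis t - 1) (?Q ** Y) + csm (cnj (cis t) - 1) (Y ** ?Q)
        + csm ((cis t - 1) * (cnj (cis t) - 1)) (?Q ** Y ** ?Q)" for t
      unfolding adjm_refl_mat unfolding refl_mat_def
      by (simp add: matrix_add_ldistrib matrix_add_rdistrib csm_mul_left csm_mul_right vec_eq_iff algebra_simps)
    have eq: "R (?r t) (DD Y x) i = DD Y (R (?r t) x) i + ((cis t - 1) * DD (?Q ** Y) (R (?r t) x) i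
        + (cnj (cis t) - 1) * DD (Y ** ?Q) (R (?r t) x) i
        + (cis t - 1) * ((cnj (cis t) - 1) * DD (?Q ** Y ** ?Q) (R (?r t) x) i))" for t
    proof -
      have "R (?r t) (DD Y x) = R (?r t) (DD Y (R (adjm (?r t)) (R (?r t) x)))"
        using R_adj_cancel[OF rU x] by simp
      also have "\<dots> = DD (?r t ** Y ** adjm (?r t)) (R (?r t) x)" by (rule DD_equivariant[OF rU]) simp
      finally show ?thesis unfolding conj by (simp add: DD_add_mat DD_csm)
    qed
    have dR: "((\<lambda>t. DD Z (R (?r t) x) i) has_vector_derivative DD Z (sc \<i> (DD ?Q x)) i) (at 0)" for Z
      unfolding DD_def[of Z] by (intro mat_app_has_derivative) (simp add: R_refl_derivative_0[OF a])
    have dc: "((\<lambda>t. cis t - 1) has_vector_derivative \<i>) (at 0)"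
      using cis_has_vector_derivative[of 0] by (auto intro!: derivative_eq_intros)
    have dcc: "((\<lambda>t. cnj (cis t) - 1) has_vector_derivative - \<i>) (at 0)"
    proof -
      have "((\<lambda>t. cnj (cis t - 1)) has_vector_derivative cnj \<i>) (at 0)"
        by (rule bounded_linear.has_vector_derivative[OF bounded_linear_cnj dc])
      then show ?thesis by simp
    qed
    have "((\<lambda>t. DD Y (R (?r t) x) i + ((cis t - 1) * DD (?Q ** Y) (R (?r t) x) i
        + (cnj (cis t) - 1) * DD (Y ** ?Q) (R (?r t) x) i
        + (cis t - 1) * ((cnj (cis t) - 1) * DD (?Q ** Y ** ?Q) (R (?r t) x) i)))
      has_vector_derivative (DD Y (sc \<i> (DD ?Q x)) i + (\<i> * DD (?Q ** Y) x i + (- \<i>) * DD (Y ** ?Q) x i))) (at 0)"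
      by (rule has_vector_derivative_eq_rhs, (rule has_vector_derivative_add has_vector_derivative_mult dR dc dcc)+)
        (simp add: R_one[OF x])
    then have "((\<lambda>t. R (?r t) (DD Y x) i) has_vector_derivative (DD Y (sc \<i> (DD ?Q x)) i + (\<i> * DD (?Q ** Y) x i + (- \<i>) * DD (Y ** ?Q) x i))) (at 0)"
      unfolding eq .
    moreover have "((\<lambda>t. R (?r t) (DD Y x) i) has_vector_derivative \<i> * DD ?Q (DD Y x) i) (at 0)"
      by (rule R_refl_derivative_0[OF a])
    ultimately have "\<i> * DD ?Q (DD Y x) i = DD Y (sc \<i> (DD ?Q x)) i + (\<i> * DD (?Q ** Y) x i + (- \<i>) * DD (Y ** ?Q) x i)"
      by (rule vector_derivative_unique_at[rotated])
    then have "\<i> * L ?Q = 0" by (simp add: L_def DD_sc DD_minus_mat algebra_simps)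
    then show "L ?Q = 0" by simp
  qed
  then show "(DD X (DD Y x) - DD Y (DD X x)) i = DD (X ** Y - Y ** X) x i" by (simp add: L_def)
qed

text \<open>Invariance of H differentiated along a reflection curve, whose inverse runs in -t. The
  sign from -t cancels that of the conjugated factor i.\<close>

lemma H_DD:
  assumes x: "x \<in> cvecs d" and y: "y \<in> cvecs d"
  shows "H x (DD X y) = H (DD (adjm X) x) y"
proof -
  define L where "L = (\<lambda>X. H x (DD X y) - H (DD (adjm X) x) y)"
  have "L X = 0"
  proof (rule complex_linear_ext)
    show "L (X + X') = L X + L X'" for X X'
      by (simp add: L_def DD_add_mat H_add_left H_add_right adjm_add)
    show "L (csm z X) = z * L X" for z X
      by (simp add: L_def DD_csm adjm_csm H_sc_left H_sc_right algebra_simps)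
    fix a :: "complex^'n" assume a: "cin a a = 1"
    let ?Q = "outer a a" and ?r = "\<lambda>t. refl_mat a (cis t)"
    have rU: "?r t \<in> unitary_grp" for t by (simp add: refl_mat_unitary a)
    have 1: "((\<lambda>t. H x (R (?r t) y)) has_vector_derivative H x (sc \<i> (DD ?Q y))) (at 0)"
      by (intro H_has_derivative) (simp add: R_refl_derivative_0[OF a])
    have 2: "((\<lambda>t. R (?r (- t)) x k) has_vector_derivative - (\<i> * DD ?Q x k)) (at 0)" for k
    proof -
      have "((\<lambda>t. - t) has_vector_derivative - 1) (at (0::real))" by (auto intro!: derivative_eq_intros)
      moreover have "((\<lambda>t. R (?r t) x k) has_vector_derivative \<i> * DD ?Q x k) (at (- 0))"
        using R_refl_derivative_0[OF a] by simp
      ultimately show ?thesis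
        using vector_diff_chain_at[of "\<lambda>t. - t" "-1" 0 "\<lambda>t. R (?r t) x k" "\<i> * DD ?Q x k"] by (simp add: o_def)
    qed
    have "((\<lambda>t. H y (R (?r (- t)) x)) has_vector_derivative H y (sc (- \<i>) (DD ?Q x))) (at 0)"
      by (intro H_has_derivative) (use 2 in simp)
    then have "((\<lambda>t. cnj (H y (R (?r (- t)) x))) has_vector_derivative cnj (H y (sc (- \<i>) (DD ?Q x)))) (at 0)"
      by (rule bounded_linear.has_vector_derivative[OF bounded_linear_cnj])
    moreover have "cnj (H y (R (?r (- t)) x)) = H x (R (?r t) y)" for t
      using H_R_left[OF rU[of "- t"] y, of x] by (simp add: H_cnj adjm_refl_mat cis_cnj)
    ultimately have "H x (sc \<i> (DD ?Q y)) = cnj (H y (sc (- \<i>) (DD ?Q x)))"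
      using vector_derivative_unique_at[OF 1] by simp
    then have "\<i> * H x (DD ?Q y) = \<i> * H (DD ?Q x) y" by (simp only: H_sc_right) (simp add: H_cnj)
    then show "L ?Q = 0" by (simp add: L_def adjm_outer)
  qed
  then show ?thesis by (simp add: L_def)
qed

text \<open>The action of a monomial of the universal enveloping algebra, the last letter acting
  first.\<close>

definition wd :: "(complex^'n^'n) list \<Rightarrow> (nat \<Rightarrow> complex) \<Rightarrow> nat \<Rightarrow> complex" where
  "wd Xs x = foldr DD Xs x"

lemma wd_simps [simp]: "wd [] x = x" "wd (X # Xs) x = DD X (wd Xs x)"
  by (simp_all add: wd_def)

lemma wd_append: "wd (Xs @ Ys) x = wd Xs (wd Ys x)"
  by (induction Xs) auto

lemma wd_in: "x \<in> cvecs d \<Longrightarrow> wd Xs x \<in> cvecs d"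
  by (cases Xs) auto

lemma wd_add: "wd Xs (x + y) = wd Xs x + wd Xs y"
  by (induction Xs) (simp_all only: wd_simps DD_add)

lemma wd_sc: "wd Xs (sc a x) = sc a (wd Xs x)"
  by (induction Xs) (simp_all only: wd_simps DD_sc)

text \<open>Each correction term replaces one letter of Ys by a commutator and keeps the length;
  induction on the word length survives because of this.\<close>

lemma wd_commute:
  assumes x: "x \<in> cvecs d"
  shows "wd Ys (DD L x) = DD L (wd Ys x) + (\<Sum>k<length Ys. wd (Ys[k := Ys!k ** L - L ** Ys!k]) x)"
proof (induction Ys)
  case (Cons Y Ys)
  have "wd (Y # Ys) (DD L x) = DD Y (DD L (wd Ys x)) + (\<Sum>k<length Ys. DD Y (wd (Ys[k := Ys!k ** L - L ** Ys!k]) x))"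
    by (simp only: wd_simps Cons.IH DD_add DD_sum)
  also have "DD Y (DD L (wd Ys x)) = DD L (DD Y (wd Ys x)) + DD (Y ** L - L ** Y) (wd Ys x)"
    using DD_bracket[OF wd_in[OF x], of Y L Ys] by (metis add.commute diff_add_cancel)
  also have "(\<Sum>k<length Ys. DD Y (wd (Ys[k := Ys!k ** L - L ** Ys!k]) x))
      = (\<Sum>k<length Ys. wd ((Y # Ys)[Suc k := (Y # Ys)!Suc k ** L - L ** (Y # Ys)!Suc k]) x)" by simp
  also have "DD L (DD Y (wd Ys x)) + DD (Y ** L - L ** Y) (wd Ys x) + \<dots>
    = DD L (wd (Y # Ys) x) + (\<Sum>k<length (Y # Ys). wd ((Y # Ys)[k := (Y # Ys)!k ** L - L ** (Y # Ys)!k]) x)"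
    unfolding length_Cons sum.lessThan_Suc_shift by (simp add: add.assoc)
  finally show ?case .
qed simp

text \<open>The bound is uniform in u by compactness of the group. Together with
  \<open>wd_replicate_bound\<close> it supplies the growth condition of
  \<open>analytic_zero\<close>.\<close>

lemma functional_bound:
  "\<exists>C\<ge>0. \<forall>u\<in>unitary_grp. \<forall>y c. (\<forall>i<d. cmod (y i) \<le> c) \<longrightarrow> cmod (H x (R u y)) \<le> C * c"
proof -
  have "\<exists>K. K > 0 \<and> (\<forall>u\<in>unitary_grp. cmod (\<rho> u i j) \<le> K)" for i j
  proof -
    have "continuous_on (unitary_sub UNIV) (\<lambda>u. \<rho> u i j)" using rep by (simp add: is_rep_def)
    from continuous_unitary_sub_bounded[OF this] show ?thesis by (metis unitary_sub_UNIV)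
  qed
  then obtain K where K: "\<And>i j. K i j > 0" "\<And>i j u. u \<in> unitary_grp \<Longrightarrow> cmod (\<rho> u i j) \<le> K i j" by metis
  define C where "C = (\<Sum>i<d. \<Sum>j<d. cmod (x i) * cmod (h i j) * (\<Sum>k<d. K j k))"
  have "cmod (H x (R u y)) \<le> C * c" if u: "u \<in> unitary_grp" and y: "\<forall>i<d. cmod (y i) \<le> c" for u y c
  proof -
    have "cmod (R u y j) \<le> (\<Sum>k<d. K j k) * c" if j: "j < d" for j
    proof -
      have "cmod (R u y j) \<le> (\<Sum>k<d. cmod (\<rho> u j k * y k))"
        using j by (simp add: R_def mat_app_def norm_sum)
      also have "\<dots> \<le> (\<Sum>k<d. K j k * c)"
        unfolding norm_mult using K u y less_imp_le[OF K(1)] by (intro sum_mono mult_mono) auto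
      finally show ?thesis by (simp add: sum_distrib_right)
    qed
    note Rb = this
    have "cmod (H x (R u y)) \<le> (\<Sum>i<d. cmod (\<Sum>j<d. cnj (x i) * h i j * R u y j))"
      unfolding H_def by (rule norm_sum)
    also have "\<dots> \<le> (\<Sum>i<d. \<Sum>j<d. cmod (cnj (x i) * h i j * R u y j))"
      by (intro sum_mono norm_sum)
    also have "\<dots> \<le> (\<Sum>i<d. \<Sum>j<d. cmod (x i) * cmod (h i j) * ((\<Sum>k<d. K j k) * c))"
      unfolding norm_mult complex_mod_cnj using Rb by (intro sum_mono mult_left_mono) auto
    finally show ?thesis by (simp add: C_def sum_distrib_right mult.assoc)
  qed
  moreover have "C \<ge> 0" unfolding C_def using less_imp_le[OF K(1)] by (intro sum_nonneg mult_nonneg_nonneg) auto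
  ultimately show ?thesis by blast
qed

lemma wd_replicate_bound:
  "\<exists>M\<ge>0. \<forall>k y c. c \<ge> 0 \<longrightarrow> (\<forall>i<d. cmod (y i) \<le> c) \<longrightarrow> (\<forall>i<d. cmod (wd (replicate k Q) y i) \<le> c * M ^ k)"
proof -
  define M where "M = (\<Sum>i<d. \<Sum>j<d. cmod (D Q i j))"
  have M: "M \<ge> 0" unfolding M_def by (intro sum_nonneg) auto
  have one: "cmod (DD Q y i) \<le> c * M" if c: "c \<ge> 0" and y: "\<forall>i<d. cmod (y i) \<le> c" and i: "i < d" for y c i
  proof -
    have "cmod (DD Q y i) \<le> (\<Sum>k<d. cmod (D Q i k * y k))"
      using i by (simp add: DD_def mat_app_def norm_sum)
    also have "\<dots> \<le> (\<Sum>k<d. cmod (D Q i k) * c)"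
      unfolding norm_mult using y by (intro sum_mono mult_left_mono) auto
    also have "\<dots> = (\<Sum>k<d. cmod (D Q i k)) * c" by (simp add: sum_distrib_right)
    also have "\<dots> \<le> M * c"
      unfolding M_def using i c
      by (intro mult_right_mono member_le_sum[of i "{..<d}" "\<lambda>i. \<Sum>j<d. cmod (D Q i j)"]) (auto intro: sum_nonneg)
    finally show ?thesis by (simp add: mult.commute)
  qed
  have "\<forall>i<d. cmod (wd (replicate k Q) y i) \<le> c * M ^ k" if c: "c \<ge> 0" and y: "\<forall>i<d. cmod (y i) \<le> c" for k y c
  proof (induction k)
    case (Suc k)
    then show ?case using one[of "c * M ^ k" "wd (replicate k Q) y"] c M by (simp add: mult_ac)
  qed (use y in simp)
  then show ?thesis using M by blast
qed

end

section \<open>Weights and highest weight vectors\<close>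

lemma diagm_nth [simp]: "diagm z $ i $ j = (if i = j then z i else 0)"
  by (simp add: diagm_def)

lemma cnj_mult_unit: "cmod z = 1 \<Longrightarrow> cnj z * z = 1"
  by (metis complex_norm_square mult.commute of_real_1 power_one)

lemma diagm_unitary: "(\<And>i. cmod (z i) = 1) \<Longrightarrow> diagm z \<in> unitary_grp"
  by (auto simp: unitary_grp_def cnj_mult_unit if_distrib[of "\<lambda>x. _ * x"] if_distrib[of "\<lambda>x. x * _"] if_distrib[of cnj] cong: if_cong)

lemma refl_mat_axis: "refl_mat (axis i 1) w = diagm (\<lambda>j. if j = i then w else 1)"
  by (auto simp: vec_eq_iff refl_mat_def mat1_nth axis_def)

lemma diagm_conj_unit:
  "diagm z ** outer (axis i 1) (axis j 1) ** adjm (diagm z) = csm (z i * cnj (z j)) (outer (axis i 1) (axis j 1))"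
  by (auto simp: vec_eq_iff matmul_nth axis_def if_distrib[of "\<lambda>x. _ * x"] if_distrib[of "\<lambda>x. x * _"] if_distrib[of cnj] cong: if_cong)

definition unit_mat :: "'n::finite \<Rightarrow> 'n \<Rightarrow> complex^'n^'n" where
  "unit_mat i j = outer (axis i 1) (axis j 1)"

lemma sum_unit_mat: "X = (\<Sum>i\<in>UNIV. \<Sum>j\<in>UNIV. csm (X$i$j) (unit_mat i j))"
  by (simp add: unit_mat_def vec_eq_iff axis_def if_distrib[of "\<lambda>x. _ * x"] if_distrib[of "\<lambda>x. x * _"] if_distrib[of cnj] cong: if_cong)

lemma prod_powi_single: "(\<Prod>j\<in>UNIV. (if j = i then w else 1) powi \<nu> j) = (w powi \<nu> i :: complex)" for i :: "'n::finite"
proof -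
  have "(\<Prod>j\<in>UNIV. (if j = i then w else 1) powi \<nu> j) = (\<Prod>j\<in>{i}. (if j = i then w else 1) powi \<nu> j)"
    by (rule prod.mono_neutral_right) auto
  then show ?thesis by simp
qed

lemma prod_powi_shift:
  fixes z :: "'n::finite \<Rightarrow> complex" and \<nu> :: "'n \<Rightarrow> int"
  assumes z: "\<And>i. cmod (z i) = 1" and ij: "i \<noteq> j"
  shows "(\<Prod>k\<in>UNIV. z k powi (\<nu>(i := \<nu> i + 1, j := \<nu> j - 1)) k) = z i * cnj (z j) * (\<Prod>k\<in>UNIV. z k powi \<nu> k)"
proof -
  have z0: "z k \<noteq> 0" for k using z[of k] by auto
  have "(\<Prod>k\<in>UNIV. z k powi (\<nu>(i := \<nu> i + 1, j := \<nu> j - 1)) k)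
      = (\<Prod>k\<in>UNIV. z k powi \<nu> k * z k powi (if k = i then 1 else if k = j then -1 else 0))"
    using ij z0 by (intro prod.cong refl) (auto simp: power_int_add power_int_diff power_int_minus divide_inverse)
  also have "\<dots> = (\<Prod>k\<in>UNIV. z k powi \<nu> k) * (\<Prod>k\<in>UNIV. z k powi (if k = i then 1 else if k = j then -1 else 0))"
    by (rule prod.distrib)
  also have "(\<Prod>k\<in>UNIV. z k powi (if k = i then 1 else if k = j then -1 else 0))
      = (\<Prod>k\<in>{i,j}. z k powi (if k = i then 1 else if k = j then -1 else 0))"
    by (rule prod.mono_neutral_right) auto
  also have "\<dots> = z i * cnj (z j)"
    using ij cnj_mult_unit[OF z[of j]] z0[of j] by (simp add: power_int_minus field_simps)
  finally show ?thesis by (simp only: mult_ac)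
qed

context lie_rep
begin

definition wtv :: "('n \<Rightarrow> int) \<Rightarrow> (nat \<Rightarrow> complex) \<Rightarrow> bool" where
  "wtv \<nu> v \<longleftrightarrow> v \<in> cvecs d \<and> v \<noteq> 0 \<and>
    (\<forall>z. (\<forall>i. cmod (z i) = 1) \<longrightarrow> R (diagm z) v = sc (\<Prod>i\<in>UNIV. z i powi \<nu> i) v)"

lemma is_weight_iff: "is_weight d \<rho> \<nu> \<longleftrightarrow> (\<exists>v. wtv \<nu> v)"
  unfolding is_weight_def wtv_def R_def sc_def zero_fun_def by blast

text \<open>The reflection along the i-th basis vector is the diagonal matrix with the single
  non-trivial entry cis t, so the weight condition can be differentiated.\<close>

lemma wtv_diag:
  assumes v: "wtv \<nu> v"
  shows "DD (unit_mat i i) v = sc (of_int (\<nu> i)) v"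
proof (rule ext)
  fix k
  have 1: "R (refl_mat (axis i 1) (cis t)) v k = cis (of_int (\<nu> i) * t) * v k" for t
  proof -
    have "R (refl_mat (axis i 1) (cis t)) v = sc (\<Prod>j\<in>UNIV. (if j = i then cis t else 1) powi \<nu> j) v"
      using v unfolding refl_mat_axis wtv_def by simp
    then show ?thesis by (simp add: prod_powi_single cis_power_int)
  qed
  have "((\<lambda>t. R (refl_mat (axis i 1) (cis t)) v k) has_vector_derivative \<i> * DD (unit_mat i i) v k) (at 0)"
    unfolding unit_mat_def by (rule R_refl_derivative_0) simp
  moreover have "((\<lambda>t. cis (of_int (\<nu> i) * t) * v k) has_vector_derivative \<i> * (of_int (\<nu> i) * v k)) (at 0)"
  proof -
    have "((\<lambda>t::real. of_int (\<nu> i) * t) has_vector_derivative of_int (\<nu> i)) (at 0)"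
      by (auto intro!: derivative_eq_intros)
    moreover have "(cis has_vector_derivative \<i>) (at (of_int (\<nu> i) * 0))"
      using cis_has_vector_derivative[of 0] by simp
    ultimately have "(cis \<circ> (\<lambda>t. of_int (\<nu> i) * t) has_vector_derivative of_int (\<nu> i) *\<^sub>R \<i>) (at 0)"
      by (rule vector_diff_chain_at)
    from has_vector_derivative_mult_left[OF this, of "v k"] show ?thesis
      by (simp add: o_def scaleR_conv_of_real mult_ac)
  qed
  ultimately have "\<i> * DD (unit_mat i i) v k = \<i> * (of_int (\<nu> i) * v k)"
    unfolding 1 by (rule vector_derivative_unique_at)
  then show "DD (unit_mat i i) v k = sc (of_int (\<nu> i)) v k" by simp
qed

text \<open>A diagonal unitary z conjugates the matrix unit (i, j) to its multiple by z_i cnj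
  z_j.\<close>

lemma wtv_shift:
  assumes v: "wtv \<nu> v" and ij: "i \<noteq> j" and nz: "DD (unit_mat i j) v \<noteq> 0"
  shows "wtv (\<nu>(i := \<nu> i + 1, j := \<nu> j - 1)) (DD (unit_mat i j) v)"
  unfolding wtv_def
proof (intro conjI allI impI)
  fix z :: "'n \<Rightarrow> complex" assume z: "\<forall>i. cmod (z i) = 1"
  let ?g = "diagm z"
  have g: "?g \<in> unitary_grp" using z by (intro diagm_unitary) auto
  have vc: "v \<in> cvecs d" using v by (simp add: wtv_def)
  have "R ?g (DD (unit_mat i j) v) = R ?g (DD (unit_mat i j) (R (adjm ?g) (R ?g v)))"
    using R_adj_cancel[OF g vc] by simp
  also have "\<dots> = DD (?g ** unit_mat i j ** adjm ?g) (R ?g v)" by (rule DD_equivariant[OF g]) simp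
  also have "\<dots> = sc (z i * cnj (z j)) (sc (\<Prod>k\<in>UNIV. z k powi \<nu> k) (DD (unit_mat i j) v))"
    using v z unfolding unit_mat_def diagm_conj_unit by (simp add: wtv_def DD_csm DD_sc)
  finally show "R ?g (DD (unit_mat i j) v) = sc (\<Prod>k\<in>UNIV. z k powi (\<nu>(i := \<nu> i + 1, j := \<nu> j - 1)) k) (DD (unit_mat i j) v)"
    using prod_powi_shift[of z i j \<nu>] z ij by (simp add: fun_eq_iff)
qed (use nz in auto)

end

locale hw_rep = lie_rep \<mu> d h \<rho> D
  for \<mu> :: "'n::{finite,linorder} set \<Rightarrow> ((complex,'n) vec,'n) vec measure" and d h \<rho> D +
  fixes v :: "nat \<Rightarrow> complex" and \<nu> :: "'n \<Rightarrow> int"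
  assumes v: "wtv \<nu> v" and dom: "\<And>\<kappa>. is_weight d \<rho> \<kappa> \<Longrightarrow> dom_le \<kappa> \<nu>"
begin

lemma v_in: "v \<in> cvecs d" and v_nz: "v \<noteq> 0"
  using v by (auto simp: wtv_def)

text \<open>For i < j the shifted weight has a partial sum up to i that exceeds the one of \<nu> by
  1, so dominance excludes it.\<close>

lemma raising_zero:
  assumes "i < j"
  shows "DD (unit_mat i j) v = 0"
proof (rule ccontr)
  let ?\<kappa> = "\<nu>(i := \<nu> i + 1, j := \<nu> j - 1)"
  assume "DD (unit_mat i j) v \<noteq> 0"
  then have "wtv ?\<kappa> (DD (unit_mat i j) v)" using wtv_shift[OF v] assms by auto
  then have "dom_le ?\<kappa> \<nu>" using dom is_weight_iff by blast
  then have "(\<Sum>l\<in>{l. l \<le> i}. ?\<kappa> l) \<le> (\<Sum>l\<in>{l. l \<le> i}. \<nu> l)" by (simp add: dom_le_def)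
  moreover have "(\<Sum>l\<in>{l. l \<le> i}. ?\<kappa> l) = (\<Sum>l\<in>{l. l \<le> i}. \<nu> l + (if l = i then 1 else 0))"
    using assms by (intro sum.cong) auto
  moreover have "\<dots> = (\<Sum>l\<in>{l. l \<le> i}. \<nu> l) + 1" by (simp add: sum.distrib)
  ultimately show False by simp
qed

text \<open>The weight as a linear functional on diagonal matrices, extended by 0 to off-diagonal
  matrix units.\<close>

definition wtrace :: "((complex,'n) vec,'n) vec \<Rightarrow> complex" where
  "wtrace X = (\<Sum>i\<in>UNIV. of_int (\<nu> i) * X$i$i)"

definition lower :: "((complex,'n) vec,'n) vec \<Rightarrow> ((complex,'n) vec,'n) vec" where
  "lower X = (\<chi> i j. if j < i then X$i$j else 0)"

lemma upper_app:
  assumes "\<And>i j. j < i \<Longrightarrow> U$i$j = 0"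
  shows "DD U v = sc (wtrace U) v"
proof -
  have "DD U v = (\<Sum>i\<in>UNIV. \<Sum>j\<in>UNIV. sc (U$i$j) (DD (unit_mat i j) v))"
    by (subst sum_unit_mat) (simp only: DD_sum_mat DD_csm)
  also have "\<dots> = (\<Sum>i\<in>UNIV. \<Sum>j\<in>UNIV. if j = i then sc (of_int (\<nu> i) * U$i$i) v else 0)"
  proof (intro sum.cong refl)
    fix i j :: 'n
    consider "j < i" | "j = i" | "i < j" by (rule linorder_cases)
    then show "sc (U$i$j) (DD (unit_mat i j) v) = (if j = i then sc (of_int (\<nu> i) * U$i$i) v else 0)"
    proof cases
      case 1
      then show ?thesis using assms[OF 1] by (auto simp: fun_eq_iff)
    next
      case 2
      then show ?thesis using wtv_diag[OF v, of i] by (simp add: fun_eq_iff)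
    next
      case 3
      then show ?thesis using raising_zero[OF 3] by (auto simp: fun_eq_iff)
    qed
  qed
  also have "\<dots> = (\<Sum>i\<in>UNIV. sc (of_int (\<nu> i) * U$i$i) v)" by simp
  also have "\<dots> = sc (wtrace U) v"
    by (simp add: wtrace_def fun_eq_iff sum_fun_nth sum_distrib_right)
  finally show ?thesis .
qed

text \<open>The adjoint of a strictly lower triangular matrix is strictly upper triangular and kills
  v.\<close>

lemma H_lower:
  assumes "y \<in> cvecs d"
  shows "H v (DD (lower X) y) = 0"
proof -
  have "DD (adjm (lower X)) v = sc (wtrace (adjm (lower X))) v"
    by (rule upper_app) (auto simp: lower_def)
  also have "wtrace (adjm (lower X)) = 0" by (simp add: wtrace_def lower_def)
  finally have "DD (adjm (lower X)) v = 0" by (auto simp: fun_eq_iff)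
  then show ?thesis using H_DD[OF v_in assms] by simp
qed

text \<open>The words on the right are one letter shorter, and the coefficients involve X, Ys and
  \<nu> only. Two representations with the same highest weight therefore obey the same
  recursion.\<close>

lemma word_reduce:
  "H v (wd (Ys @ [X]) v) = wtrace X * H v (wd Ys v)
    + (\<Sum>k<length Ys. H v (wd (Ys[k := Ys!k ** lower X - lower X ** Ys!k]) v))"
proof -
  define U where "U = X - lower X"
  have XU: "X = lower X + U" by (simp add: U_def)
  have "DD U v = sc (wtrace U) v" by (rule upper_app) (auto simp: U_def lower_def)
  moreover have "wtrace U = wtrace X" by (simp add: wtrace_def U_def lower_def)
  ultimately have "DD X v = DD (lower X) v + sc (wtrace X) v"
    by (metis XU DD_add_mat)
  then have "wd (Ys @ [X]) v = wd Ys (DD (lower X) v) + sc (wtrace X) (wd Ys v)"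
    by (simp only: wd_append wd_simps wd_add wd_sc)
  then show ?thesis
    by (simp only: wd_commute[OF v_in] H_add_right H_sum_right H_sc_right H_lower[OF wd_in[OF v_in]])
      (simp add: add.commute)
qed

end

text \<open>Commuting strictly lower triangular factors to the left, where they are annihilated by \<open>H v\<close>,
  evaluates all \<open>H v (X\<^sub>1 \<cdots> X\<^sub>m v)\<close> in terms of the weight alone. Expanding along the one-parameter
  groups of complex reflections then determines the matrix coefficient of a highest weight vector.\<close>

lemma highest_weight_coefficient_unique:
  fixes \<mu> :: "'n::{finite,linorder} set \<Rightarrow> ((complex,'n) vec,'n) vec measure"
  assumes A: "hw_rep \<mu> d h \<rho> D v \<nu>" and B: "hw_rep \<mu> d' h' \<rho>' D' v' \<nu>"
    and g: "g \<in> unitary_grp"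
  shows "herm_form.H d h v (mat_app d (\<rho> g) v) * herm_form.H d' h' v' v'
    = herm_form.H d' h' v' (mat_app d' (\<rho>' g) v') * herm_form.H d h v v"
proof -
  interpret A: hw_rep \<mu> d h \<rho> D v \<nu> by (rule A)
  interpret B: hw_rep \<mu> d' h' \<rho>' D' v' \<nu> by (rule B)
  have words: "A.H v (A.wd Xs v) * B.H v' v' = B.H v' (B.wd Xs v') * A.H v v" for Xs
  proof (induction "length Xs" arbitrary: Xs)
    case (Suc m)
    then obtain Ys X where Xs: "Xs = Ys @ [X]" by (metis Zero_not_Suc length_0_conv rev_exhaust)
    have len: "length Ys = m" using Suc.hyps Xs by simp
    have IH: "A.H v (A.wd Zs v) * B.H v' v' = B.H v' (B.wd Zs v') * A.H v v" if "length Zs = m" for Zs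
      using Suc.hyps(1) that by simp
    show ?case
      unfolding Xs A.word_reduce B.word_reduce distrib_right sum_distrib_right mult.assoc
      by (simp add: IH len)
  qed simp
  \<comment> \<open>All words are carried along, since every derivative along a reflection curve
    prefixes a letter.\<close>
  have "\<forall>Xs. A.H v (A.R g (A.wd Xs v)) * B.H v' v' = B.H v' (B.R g (B.wd Xs v')) * A.H v v"
  proof (rule unitary_refl_induct[OF g])
    show "\<forall>Xs. A.H v (A.R (mat 1) (A.wd Xs v)) * B.H v' v' = B.H v' (B.R (mat 1) (B.wd Xs v')) * A.H v v"
      using words by (simp add: A.R_one B.R_one A.wd_in B.wd_in A.v_in B.v_in)
  next
    fix g :: "((complex,'n) vec,'n) vec" and a :: "(complex,'n) vec" and z
    assume 2: "g \<in> unitary_grp" "\<forall>Xs. A.H v (A.R g (A.wd Xs v)) * B.H v' v' = B.H v' (B.R g (B.wd Xs v')) * A.H v v" "cin a a = 1" "cmod z = 1"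
    show "\<forall>Xs. A.H v (A.R (g ** refl_mat a z) (A.wd Xs v)) * B.H v' v' = B.H v' (B.R (g ** refl_mat a z) (B.wd Xs v')) * A.H v v"
    proof
      fix Xs
      let ?Q = "outer a a"
      obtain t where z: "z = cis t" using 2(4) by (metis complex_norm_eq_1_exp_eq cis_conv_exp)
      have rU: "refl_mat a (cis t) \<in> unitary_grp" for t using 2(3) by (simp add: refl_mat_unitary)
      \<comment> \<open>Up to a power of i this is the k-th derivative in t of the difference of
        both sides. At t = 0 all of them vanish by the hypothesis on g.\<close>
      define f where "f = (\<lambda>k t. A.H v (A.R (g ** refl_mat a (cis t)) (A.wd (replicate k ?Q @ Xs) v)) * B.H v' v'
        - B.H v' (B.R (g ** refl_mat a (cis t)) (B.wd (replicate k ?Q @ Xs) v')) * A.H v v)"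
      obtain CA where CA: "CA \<ge> 0" "\<And>u y c. u \<in> unitary_grp \<Longrightarrow> (\<forall>i<d. cmod (y i) \<le> c) \<Longrightarrow> cmod (A.H v (A.R u y)) \<le> CA * c"
        using A.functional_bound by blast
      obtain CB where CB: "CB \<ge> 0" "\<And>u y c. u \<in> unitary_grp \<Longrightarrow> (\<forall>i<d'. cmod (y i) \<le> c) \<Longrightarrow> cmod (B.H v' (B.R u y)) \<le> CB * c"
        using B.functional_bound by blast
      obtain MA where MA: "MA \<ge> 0" "\<And>k y c. c \<ge> 0 \<Longrightarrow> (\<forall>i<d. cmod (y i) \<le> c) \<Longrightarrow> (\<forall>i<d. cmod (A.wd (replicate k ?Q) y i) \<le> c * MA ^ k)"
        using A.wd_replicate_bound[of ?Q] by blast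
      obtain MB where MB: "MB \<ge> 0" "\<And>k y c. c \<ge> 0 \<Longrightarrow> (\<forall>i<d'. cmod (y i) \<le> c) \<Longrightarrow> (\<forall>i<d'. cmod (B.wd (replicate k ?Q) y i) \<le> c * MB ^ k)"
        using B.wd_replicate_bound[of ?Q] by blast
      define cA where "cA = (\<Sum>i<d. cmod (A.wd Xs v i))"
      define cB where "cB = (\<Sum>i<d'. cmod (B.wd Xs v' i))"
      have cA: "cA \<ge> 0" "\<forall>i<d. cmod (A.wd Xs v i) \<le> cA"
        unfolding cA_def by (auto intro!: sum_nonneg member_le_sum[of _ "{..<d}" "\<lambda>i. cmod (A.wd Xs v i)"])
      have cB: "cB \<ge> 0" "\<forall>i<d'. cmod (B.wd Xs v' i) \<le> cB"
        unfolding cB_def by (auto intro!: sum_nonneg member_le_sum[of _ "{..<d'}" "\<lambda>i. cmod (B.wd Xs v' i)"])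
      define M where "M = max MA MB"
      define C where "C = CA * cA * cmod (B.H v' v') + CB * cB * cmod (A.H v v)"
      have bound: "cmod (f k t) \<le> C * M ^ k" for k t
      proof -
        let ?u = "g ** refl_mat a (cis t)"
        have u: "?u \<in> unitary_grp" using 2(1) rU by (rule unitary_mul)
        have "cmod (A.H v (A.R ?u (A.wd (replicate k ?Q @ Xs) v))) \<le> CA * (cA * MA ^ k)"
          unfolding A.wd_append by (rule CA(2)[OF u MA(2)[OF cA]])
        also have "\<dots> \<le> CA * (cA * M ^ k)"
          using CA(1) cA(1) MA(1) by (intro mult_left_mono power_mono) (auto simp: M_def)
        finally have 1: "cmod (A.H v (A.R ?u (A.wd (replicate k ?Q @ Xs) v))) \<le> CA * (cA * M ^ k)" .
        have "cmod (B.H v' (B.R ?u (B.wd (replicate k ?Q @ Xs) v'))) \<le> CB * (cB * MB ^ k)"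
          unfolding B.wd_append by (rule CB(2)[OF u MB(2)[OF cB]])
        also have "\<dots> \<le> CB * (cB * M ^ k)"
          using CB(1) cB(1) MB(1) by (intro mult_left_mono power_mono) (auto simp: M_def)
        finally have 2: "cmod (B.H v' (B.R ?u (B.wd (replicate k ?Q @ Xs) v'))) \<le> CB * (cB * M ^ k)" .
        have "cmod (f k t) \<le> cmod (A.H v (A.R ?u (A.wd (replicate k ?Q @ Xs) v))) * cmod (B.H v' v')
            + cmod (B.H v' (B.R ?u (B.wd (replicate k ?Q @ Xs) v'))) * cmod (A.H v v)"
          unfolding f_def norm_mult[symmetric] by (rule norm_triangle_ineq4)
        also have "\<dots> \<le> CA * (cA * M ^ k) * cmod (B.H v' v') + CB * (cB * M ^ k) * cmod (A.H v v)"
          by (intro add_mono mult_right_mono 1 2) auto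
        finally show ?thesis by (simp add: C_def algebra_simps)
      qed
      have "f 0 t = 0"
      proof (rule analytic_zero)
        fix k t
        have dA: "((\<lambda>t. A.H v (A.R g (A.R (refl_mat a (cis t)) (A.wd (replicate k ?Q @ Xs) v)))) has_vector_derivative
          A.H v (A.R g (sc \<i> (A.R (refl_mat a (cis t)) (A.wd (replicate (Suc k) ?Q @ Xs) v))))) (at t)"
          unfolding A.R_def[of g]
          by (intro A.H_has_derivative A.mat_app_has_derivative) (simp add: A.R_refl_derivative[OF 2(3)])
        have dB: "((\<lambda>t. B.H v' (B.R g (B.R (refl_mat a (cis t)) (B.wd (replicate k ?Q @ Xs) v')))) has_vector_derivative
          B.H v' (B.R g (sc \<i> (B.R (refl_mat a (cis t)) (B.wd (replicate (Suc k) ?Q @ Xs) v'))))) (at t)"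
          unfolding B.R_def[of g]
          by (intro B.H_has_derivative B.mat_app_has_derivative) (simp add: B.R_refl_derivative[OF 2(3)])
        have f_eq: "f k t = A.H v (A.R g (A.R (refl_mat a (cis t)) (A.wd (replicate k ?Q @ Xs) v))) * B.H v' v'
          - B.H v' (B.R g (B.R (refl_mat a (cis t)) (B.wd (replicate k ?Q @ Xs) v'))) * A.H v v" for k t
          unfolding f_def using 2(1) rU by (simp only: A.R_mult B.R_mult)
        have f_fun: "f k = (\<lambda>t. A.H v (A.R g (A.R (refl_mat a (cis t)) (A.wd (replicate k ?Q @ Xs) v))) * B.H v' v'
          - B.H v' (B.R g (B.R (refl_mat a (cis t)) (B.wd (replicate k ?Q @ Xs) v'))) * A.H v v)"
          by (rule ext) (rule f_eq)
        have "(f k has_vector_derivative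
          A.H v (A.R g (sc \<i> (A.R (refl_mat a (cis t)) (A.wd (replicate (Suc k) ?Q @ Xs) v)))) * B.H v' v'
          - B.H v' (B.R g (sc \<i> (B.R (refl_mat a (cis t)) (B.wd (replicate (Suc k) ?Q @ Xs) v')))) * A.H v v) (at t)"
          unfolding f_fun by (intro has_vector_derivative_diff has_vector_derivative_mult_left dA dB)
        then show "(f k has_vector_derivative \<i> * f (Suc k) t) (at t)"
          unfolding f_eq[of "Suc k"] by (simp only: A.R_sc B.R_sc A.H_sc_right B.H_sc_right mult.assoc right_diff_distrib)
      next
        fix k
        have "A.H v (A.R g (A.wd (replicate k ?Q @ Xs) v)) * B.H v' v'
            = B.H v' (B.R g (B.wd (replicate k ?Q @ Xs) v')) * A.H v v" using 2(2) by blast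
        then show "f k 0 = 0" by (simp add: f_def)
      next
        fix k t
        show "cmod (f k t) \<le> C * M ^ k" by (rule bound)
      qed
      then show "A.H v (A.R (g ** refl_mat a z) (A.wd Xs v)) * B.H v' v' = B.H v' (B.R (g ** refl_mat a z) (B.wd Xs v')) * A.H v v"
        by (simp add: f_def z)
    qed
  qed
  from spec[OF this, of "[]"] show ?thesis by (simp add: A.R_def B.R_def)
qed

section \<open>Smoothness of irreducible representations\<close>

inductive separable :: "(complex^('n::finite)^'n \<Rightarrow> complex^'n^'n \<Rightarrow> complex) \<Rightarrow> bool" where
  product: "(\<And>A. q differentiable (at A)) \<Longrightarrow> continuous_on unitary_grp r \<Longrightarrow> separable (\<lambda>A g. q A * r g)"
| add: "separable f \<Longrightarrow> separable f' \<Longrightarrow> separable (\<lambda>A g. f A g + f' A g)"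

lemma separable_mult_product:
  assumes "separable f" "\<And>A. q differentiable (at A)" "continuous_on unitary_grp r"
  shows "separable (\<lambda>A g. (q A * r g) * f A g)"
  using assms(1)
proof induction
  case (product q' r')
  have "separable (\<lambda>A g. (q A * q' A) * (r g * r' g))"
    using assms product by (intro separable.product continuous_intros differentiable_mult) auto
  then show ?case by (simp add: mult_ac)
next
  case (add f f')
  then show ?case using separable.add by (simp add: distrib_left)
qed

lemma separable_mult:
  assumes "separable f" "separable f'"
  shows "separable (\<lambda>A g. f A g * f' A g)"
  using assms(1)
proof induction
  case (product q r)
  then show ?case using separable_mult_product[OF assms(2)] by blast
next
  case (add f1 f2)
  then show ?case using separable.add by (simp add: distrib_right)
qed

lemma separable_power: "separable f \<Longrightarrow> separable (\<lambda>A g. f A g ^ N)"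
proof (induction N)
  case 0
  show ?case using separable.product[of "\<lambda>_. 1" "\<lambda>_. 1"] by simp
qed (auto intro: separable_mult)

lemma separable_sum: "finite I \<Longrightarrow> (\<And>i. i \<in> I \<Longrightarrow> separable (f i)) \<Longrightarrow> separable (\<lambda>A g. \<Sum>i\<in>I. f i A g)"
proof (induction I rule: finite_induct)
  case empty
  show ?case using separable.product[of "\<lambda>_. 0" "\<lambda>_. 0"] by simp
qed (auto intro: separable.add)

lemma separable_continuous: "separable f \<Longrightarrow> continuous_on unitary_grp (f A)"
  by (induction rule: separable.induct) (auto intro: continuous_intros)

lemma entry_differentiable: "(\<lambda>A::complex^('n::finite)^'n. A$i$j) differentiable (at X)"
proof -
  have "bounded_linear (\<lambda>A::complex^'n^'n. A$i$j)"
    by (rule linear_conv_bounded_linear[THEN iffD1]) (auto intro: linearI)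
  then show ?thesis by (rule bounded_linear_imp_differentiable)
qed

lemma cnj_entry_differentiable: "(\<lambda>A::complex^('n::finite)^'n. cnj (A$i$j)) differentiable (at X)"
proof -
  have "bounded_linear (\<lambda>A::complex^'n^'n. cnj (A$i$j))"
    by (rule linear_conv_bounded_linear[THEN iffD1]) (auto intro!: linearI)
  then show ?thesis by (rule bounded_linear_imp_differentiable)
qed

text \<open>The mean of 1 and the normalised trace. The summand 1 singles out the identity: the
  normalised trace alone has modulus 1 at every scalar unitary matrix.\<close>

definition peak :: "complex^('n::finite)^'n \<Rightarrow> complex" where
  "peak g = (1 + (\<Sum>a\<in>UNIV. g$a$a) / of_nat CARD('n)) / 2"

lemma peak_le: 
  assumes g: "g \<in> unitary_grp"
  shows "cmod (peak g) \<le> 1"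
proof -
  have "cmod (\<Sum>a\<in>UNIV. g$a$a) \<le> (\<Sum>a\<in>(UNIV::'a set). 1)"
    by (rule order_trans[OF norm_sum]) (intro sum_mono unitary_entry_le1 g)
  then have "cmod ((\<Sum>a\<in>UNIV. g$a$a) / of_nat CARD('a)) \<le> 1"
    by (simp add: norm_divide)
  then have "cmod (1 + (\<Sum>a\<in>UNIV. g$a$a) / of_nat CARD('a)) \<le> 2"
    using norm_triangle_ineq[of 1 "(\<Sum>a\<in>UNIV. g$a$a) / of_nat CARD('a)"] by simp
  then show ?thesis by (simp add: peak_def norm_divide)
qed

text \<open>With T the normalised trace, |1 + T| = 2 and |T| \<le> 1 force Re T \<ge> 1. Then all
  diagonal entries are 1, and the unit columns leave no room for others.\<close>

lemma peak_eq_1: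
  assumes g: "g \<in> unitary_grp" and eq: "cmod (peak g) = 1"
  shows "g = mat 1"
proof -
  define T where "T = (\<Sum>a\<in>UNIV. g$a$a) / of_nat CARD('a)"
  have "cmod (\<Sum>a\<in>UNIV. g$a$a) \<le> (\<Sum>a\<in>(UNIV::'a set). 1)"
    by (rule order_trans[OF norm_sum]) (intro sum_mono unitary_entry_le1 g)
  then have T1: "cmod T \<le> 1" by (simp add: T_def norm_divide)
  have "cmod (1 + T) = 2" using eq by (simp add: peak_def norm_divide T_def)
  then have "(cmod (1 + T))^2 = 4" by simp
  then have "1 + 2 * Re T + (cmod T)^2 = 4" by (simp add: cmod_power2) (simp add: power2_eq_square algebra_simps)
  moreover have "(cmod T)^2 \<le> 1" using T1 by (simp add: power_le_one)
  ultimately have "Re T \<ge> 1" by linarith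
  then have "real CARD('a) \<le> (\<Sum>a\<in>UNIV. Re (g$a$a))"
    by (simp add: T_def field_simps)
  then have "(\<Sum>a\<in>UNIV. 1 - Re (g$a$a)) \<le> 0" by (simp add: sum_subtractf)
  moreover have nn: "0 \<le> 1 - Re (g$a$a)" for a
    using complex_Re_le_cmod[of "g$a$a"] unitary_entry_le1[OF g, of a a] by linarith
  ultimately have "(\<Sum>a\<in>UNIV. 1 - Re (g$a$a)) = 0" by (meson antisym sum_nonneg)
  then have re1: "Re (g$a$a) = 1" for a
    using sum_nonneg_eq_0_iff[of UNIV "\<lambda>a. 1 - Re (g$a$a)"] nn by simp
  have diag: "cmod (g$a$a) = 1" for a
    using complex_Re_le_cmod[of "g$a$a"] unitary_entry_le1[OF g, of a a] re1[of a] by linarith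
  have "g$a$a = 1" for a
    using re1[of a] diag[of a] by (simp add: complex_eq_iff cmod_def)
  moreover have "g$b$a = 0" if "b \<noteq> a" for a b
  proof -
    have "(\<Sum>i\<in>UNIV. (cmod (g$i$a))^2) = (cmod (g$a$a))^2 + (\<Sum>i\<in>UNIV - {a}. (cmod (g$i$a))^2)"
      by (rule sum.remove) auto
    then have "(\<Sum>i\<in>UNIV - {a}. (cmod (g$i$a))^2) = 0"
      using unitary_col[OF g, of a] diag by simp
    then show ?thesis using that by (subst (asm) sum_nonneg_eq_0_iff) auto
  qed
  ultimately show ?thesis by (auto simp: vec_eq_iff mat1_nth)
qed

context haar_family
begin

text \<open>On a product the factor depending on A leaves the integral, so no differentiation under
  the integral sign occurs. Finite sums of products are enough for polynomial kernels.\<close>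

lemma separable_integral_differentiable:
  assumes "separable f" "continuous_on unitary_grp c"
  shows "(\<lambda>A. hI UNIV (\<lambda>g. f A g * c g)) differentiable (at X)"
  using assms(1)
proof induction
  case (product q r)
  have "(\<lambda>A. hI UNIV (\<lambda>g. q A * r g * c g)) = (\<lambda>A. q A * hI UNIV (\<lambda>g. r g * c g))"
    by (simp add: mult.assoc hI_mult_left)
  then show ?case using product by (auto intro: differentiable_mult)
next
  case (add f f')
  have "(\<lambda>A. hI UNIV (\<lambda>g. (f A g + f' A g) * c g)) = (\<lambda>A. hI UNIV (\<lambda>g. f A g * c g) + hI UNIV (\<lambda>g. f' A g * c g))"
    unfolding distrib_right using separable_continuous add(1,2) assms(2)
    by (intro ext hI_add) (auto intro!: continuous_intros)
  then show ?case using add by (auto intro: differentiable_add)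
qed

end

context urep
begin

text \<open>Moving the vector by u amounts to translating the density, so smoothness in u becomes a
  property of the density.\<close>

lemma hI_convolve:
  assumes f: "continuous_on unitary_grp f" and u: "u \<in> unitary_grp"
  shows "R u (\<lambda>i. hI UNIV (\<lambda>g. f g * R g y i)) = (\<lambda>i. hI UNIV (\<lambda>g. f (adjm u ** g) * R g y i))"
proof -
  have c: "continuous_on (unitary_sub UNIV) (\<lambda>g. f g * R g y i)" for i
    using f by (intro continuous_intros R_continuous) simp
  have "R u (\<lambda>i. hI UNIV (\<lambda>g. f g * R g y i)) = (\<lambda>i. hI UNIV (\<lambda>g. R u (sc (f g) (R g y)) i))"
    using R_hI[of UNIV "\<lambda>g. sc (f g) (R g y)" u] c by simp
  also have "\<dots> = (\<lambda>i. hI UNIV (\<lambda>g. f (adjm u ** (u ** g)) * R (u ** g) y i))"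
    using u by (intro ext hI_cong) (simp add: R_sc R_mult adj_cancel_left)
  also have "\<dots> = (\<lambda>i. hI UNIV (\<lambda>g. f (adjm u ** g) * R g y i))"
  proof (rule ext)
    fix i
    have "continuous_on (unitary_sub UNIV) (\<lambda>g. f (adjm u ** g) * R g y i)"
      using f u continuous_on_left_translate[of UNIV f "adjm u"]
      by (intro continuous_intros R_continuous) (simp add: unitary_adj)
    then show "hI UNIV (\<lambda>g. f (adjm u ** (u ** g)) * R (u ** g) y i) = hI UNIV (\<lambda>g. f (adjm u ** g) * R g y i)"
      using u by (intro hI_left[of UNIV "\<lambda>g. f (adjm u ** g) * R g y i"]) auto
  qed
  finally show ?thesis .
qed

text \<open>Smooth vectors form a non-zero invariant subspace: they contain all integrals of \<open>\<rho>\<close> against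
  a polynomial density, and such densities can be concentrated at the identity.\<close>

lemma irrep_smooth:
  assumes irr: "is_irrep d \<rho>" and ij: "i < d" "j < d"
  shows "\<exists>F. F differentiable (at (mat 1)) \<and> (\<forall>g\<in>unitary_grp. F g = \<rho> g i j)"
proof -
  define W where "W = {x \<in> cvecs d. \<forall>i. \<exists>F. (\<forall>A. F differentiable (at A)) \<and> (\<forall>g\<in>unitary_grp. F g = R g x i)}"
  have add: "(\<lambda>k. v k + w k) = v + w" "(\<lambda>k. a * v k) = sc a v" "(\<lambda>_. 0) = (0 :: nat \<Rightarrow> complex)" for v w :: "nat \<Rightarrow> complex" and a
    by (auto simp: fun_eq_iff)
  have "W = {\<lambda>_. 0} \<or> W = cvecs d"
  proof -
    have "0 \<in> W" unfolding W_def
      by (auto intro!: exI[of _ "\<lambda>_. 0"])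
    moreover have "v + w \<in> W" if vw: "v \<in> W" "w \<in> W" for v w
      unfolding W_def
    proof (intro CollectI conjI allI)
      show "v + w \<in> cvecs d" using vw by (auto simp: W_def cvecs_add)
      fix i
      obtain F where F: "\<And>A. F differentiable (at A)" "\<And>g. g \<in> unitary_grp \<Longrightarrow> F g = R g v i"
        using vw(1) unfolding W_def by blast
      obtain G where G: "\<And>A. G differentiable (at A)" "\<And>g. g \<in> unitary_grp \<Longrightarrow> G g = R g w i"
        using vw(2) unfolding W_def by blast
      from F G show "\<exists>F. (\<forall>A. F differentiable (at A)) \<and> (\<forall>g\<in>unitary_grp. F g = R g (v + w) i)"
        by (intro exI[of _ "\<lambda>A. F A + G A"]) (auto simp: R_add intro!: differentiable_add)
    qed
    moreover have "sc a v \<in> W" if v: "v \<in> W" for a v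
      unfolding W_def
    proof (intro CollectI conjI allI)
      show "sc a v \<in> cvecs d" using v by (auto simp: W_def cvecs_sc)
      fix i
      obtain F where "\<And>A. F differentiable (at A)" "\<And>g. g \<in> unitary_grp \<Longrightarrow> F g = R g v i"
        using v unfolding W_def by blast
      then show "\<exists>F. (\<forall>A. F differentiable (at A)) \<and> (\<forall>g\<in>unitary_grp. F g = R g (sc a v) i)"
        by (intro exI[of _ "\<lambda>A. a * F A"]) (auto simp: R_sc intro!: differentiable_mult)
    qed
    moreover have "R u v \<in> W" if v: "v \<in> W" and u: "u \<in> unitary_grp" for u v
      unfolding W_def
    proof (intro CollectI conjI allI)
      fix i
      obtain F where F: "\<And>A. F differentiable (at A)" "\<And>g. g \<in> unitary_grp \<Longrightarrow> F g = R g v i"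
        using v unfolding W_def by blast
      have "(\<lambda>A. F (A ** u)) differentiable (at A)" for A
      proof -
        have "linear (\<lambda>A::complex^'n^'n. A ** u)"
          by (auto intro!: linearI simp: matrix_add_rdistrib vec_eq_iff matmul_nth scaleR_sum_right)
        then have "bounded_linear (\<lambda>A::complex^'n^'n. A ** u)" by (rule linear_conv_bounded_linear[THEN iffD1])
        then have "(\<lambda>A::complex^'n^'n. A ** u) differentiable (at A)" by (rule bounded_linear_imp_differentiable)
        from differentiable_chain_at[OF this F(1)] show ?thesis by (simp add: o_def)
      qed
      then show "\<exists>F. (\<forall>A. F differentiable (at A)) \<and> (\<forall>g\<in>unitary_grp. F g = R g (R u v) i)"
        using F(2) u by (intro exI[of _ "\<lambda>A. F (A ** u)"]) (auto simp: R_mult[symmetric] unitary_mul)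
    qed simp
    ultimately have "W \<subseteq> cvecs d \<and> (\<lambda>_. 0) \<in> W \<and>
          (\<forall>v\<in>W. \<forall>w\<in>W. (\<lambda>k. v k + w k) \<in> W) \<and>
          (\<forall>a. \<forall>v\<in>W. (\<lambda>k. a * v k) \<in> W) \<and>
          (\<forall>A\<in>unitary_grp. \<forall>v\<in>W. mat_app d (\<rho> A) v \<in> W)"
      unfolding add R_def[symmetric] by (auto simp: W_def)
    then show ?thesis using irr unfolding is_irrep_def by blast
  qed
  moreover have "W \<noteq> {\<lambda>_. 0}"
  proof -
    define y where "y = (\<lambda>k. if k = i then 1 else 0 :: complex)"
    have y: "y \<in> cvecs d" using ij by (auto simp: y_def cvecs_def)
    define F where "F = (\<lambda>g::complex^'n^'n. (cmod (peak g))^2)"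
    have cF: "continuous_on S F" for S unfolding F_def peak_def by (intro continuous_intros) auto
    have peak1: "peak (mat 1 :: complex^'n^'n) = 1" by (simp add: peak_def mat_def)
    have F1: "F (mat 1) = 1" by (simp add: F_def peak1)
    have F01: "0 \<le> F g \<and> F g \<le> 1" if "g \<in> unitary_sub UNIV" for g
      using that peak_le[of g] by (simp add: F_def power_le_one)
    \<comment> \<open>The coordinate \<open>R A y i\<close> equals 1 at the identity, the only point
      with F = 1. For this N the coordinate \<open>x i\<close> defined below differs from J by at
      most J / 2.\<close>
    have "\<exists>N. norm (hI UNIV (\<lambda>A. complex_of_real (F A ^ N) * (R A y i - 1))) \<le> (1/2) * Re (hI UNIV (\<lambda>A. complex_of_real (F A ^ N)))"
    proof (rule hI_power_concentration)
      show "R A y i - 1 = 0" if "A \<in> unitary_sub UNIV" "F A = 1" for A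
      proof -
        have "cmod (peak A) = 1" using that(2) power2_eq_imp_eq[of "cmod (peak A)" 1] by (simp add: F_def)
        then have "A = mat 1" using peak_eq_1 that by simp
        then show ?thesis using R_one[OF y] by (simp add: y_def)
      qed
      show "F (mat 1) = 1" by (rule F1)
    qed (use F01 R_continuous[of UNIV y i] in \<open>auto intro!: continuous_intros cF\<close>)
    then obtain N where N: "norm (hI UNIV (\<lambda>A. complex_of_real (F A ^ N) * (R A y i - 1))) \<le> (1/2) * Re (hI UNIV (\<lambda>A. complex_of_real (F A ^ N)))"
      by blast
    define J where "J = Re (hI UNIV (\<lambda>A. complex_of_real (F A ^ N)))"
    have J: "J > 0" unfolding J_def
      by (rule hI_pos[of _ _ "mat 1"]) (use F01 F1 in \<open>auto intro!: continuous_intros cF\<close>)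
    define x where "x = (\<lambda>k. hI UNIV (\<lambda>g. complex_of_real (F g ^ N) * R g y k))"
    have "hI UNIV (\<lambda>A. complex_of_real (F A ^ N) * (R A y i - 1)) = x i - hI UNIV (\<lambda>A. complex_of_real (F A ^ N))"
      unfolding x_def right_diff_distrib mult_1_right
      by (intro hI_diff continuous_intros cF R_continuous)
    also have "hI UNIV (\<lambda>A. complex_of_real (F A ^ N)) = complex_of_real J" unfolding J_def by (rule hI_of_real)
    finally have "x i \<noteq> 0" using N J by (auto simp: J_def)
    moreover have "x \<in> W" unfolding W_def
    proof (intro CollectI conjI allI)
      show "x \<in> cvecs d" by (auto simp: x_def cvecs_def R_def mat_app_def)
      fix k
      \<comment> \<open>\<open>F (adjm u ** g) ^ N\<close> expanded as a polynomial in the entries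
        of u and g and their conjugates. The formula makes sense for every matrix A and is
        separable.\<close>
      define f where "f = (\<lambda>A g::complex^'n^'n.
        ((1/2 + (\<Sum>b\<in>UNIV. \<Sum>a\<in>UNIV. cnj (A$a$b) * (g$a$b / (2 * of_nat CARD('n)))))
         * (1/2 + (\<Sum>b\<in>UNIV. \<Sum>a\<in>UNIV. A$a$b * (cnj (g$a$b) / (2 * of_nat CARD('n)))))) ^ N)"
      have sep: "separable f"
      proof -
        have "separable (\<lambda>A g::complex^'n^'n. 1/2)" using separable.product[of "\<lambda>_. 1/2" "\<lambda>_. 1"] by simp
        then show ?thesis unfolding f_def
          by (intro separable_power separable_mult separable.add separable_sum separable.product
              cnj_entry_differentiable entry_differentiable continuous_intros) auto
      qed
      have fF: "f u g = complex_of_real (F (adjm u ** g) ^ N)" for u g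
      proof -
        have "peak (adjm u ** g) = 1/2 + (\<Sum>b\<in>UNIV. \<Sum>a\<in>UNIV. cnj (u$a$b) * (g$a$b / (2 * of_nat CARD('n))))"
          by (simp add: peak_def matmul_nth sum_divide_distrib add_divide_distrib mult_ac)
        then have "complex_of_real (F (adjm u ** g)) = (1/2 + (\<Sum>b\<in>UNIV. \<Sum>a\<in>UNIV. cnj (u$a$b) * (g$a$b / (2 * of_nat CARD('n)))))
          * (1/2 + (\<Sum>b\<in>UNIV. \<Sum>a\<in>UNIV. u$a$b * (cnj (g$a$b) / (2 * of_nat CARD('n)))))"
          unfolding F_def complex_norm_square by simp
        then show ?thesis unfolding f_def by simp
      qed
      have "R u x k = hI UNIV (\<lambda>g. f u g * R g y k)" if u: "u \<in> unitary_grp" for u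
        unfolding x_def fF using hI_convolve[OF _ u, of "\<lambda>g. complex_of_real (F g ^ N)" y]
        by (simp add: continuous_intros cF del: of_real_power)
      then show "\<exists>F. (\<forall>A. F differentiable (at A)) \<and> (\<forall>g\<in>unitary_grp. F g = R g x k)"
        using separable_integral_differentiable[OF sep] R_continuous[of UNIV y k]
        by (intro exI[of _ "\<lambda>A. hI UNIV (\<lambda>g. f A g * R g y k)"]) auto
    qed
    ultimately show ?thesis by auto
  qed
  ultimately have W: "W = cvecs d" by blast
  define e where "e = (\<lambda>k. if k = j then 1 else 0 :: complex)"
  have "e \<in> W" unfolding W using ij by (auto simp: e_def cvecs_def)
  moreover have "R g e i = \<rho> g i j" for g
    using ij by (simp add: R_def mat_app_def e_def if_distrib[of "\<lambda>x. _ * x"] cong: if_cong)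
  moreover obtain F where "\<And>A. F differentiable (at A)" "\<And>g. g \<in> unitary_grp \<Longrightarrow> F g = R g e i"
    using \<open>e \<in> W\<close> unfolding W_def by blast
  ultimately show ?thesis by auto
qed

end

section \<open>Existence of the irreducible representation\<close>

definition weight_vec :: "nat \<Rightarrow> (complex^('n::finite)^'n \<Rightarrow> nat \<Rightarrow> nat \<Rightarrow> complex) \<Rightarrow> ('n \<Rightarrow> int) \<Rightarrow> (nat \<Rightarrow> complex) \<Rightarrow> bool" where
  "weight_vec d \<rho> \<nu> v \<longleftrightarrow> v \<in> cvecs d \<and> v \<noteq> 0 \<and>
    (\<forall>z. (\<forall>i. cmod (z i) = 1) \<longrightarrow> mat_app d (\<rho> (diagm z)) v = sc (\<Prod>i\<in>UNIV. z i powi \<nu> i) v)"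

lemma is_weight_iff_vec: "is_weight d \<rho> \<nu> \<longleftrightarrow> (\<exists>v. weight_vec d \<rho> \<nu> v)"
  unfolding is_weight_def weight_vec_def sc_def zero_fun_def by blast

definition invariant_subspace :: "nat \<Rightarrow> (complex^('n::finite)^'n \<Rightarrow> nat \<Rightarrow> nat \<Rightarrow> complex) \<Rightarrow> (nat \<Rightarrow> complex) set \<Rightarrow> bool" where
  "invariant_subspace d \<rho> W \<longleftrightarrow> W \<subseteq> cvecs d \<and> cv.subspace W \<and>
    (\<forall>g\<in>unitary_grp. \<forall>v\<in>W. mat_app d (\<rho> g) v \<in> W)"

lemma mat_app_basis_vec:
  assumes "l < d" "m < d"
  shows "mat_app d M (\<lambda>k. if k = l then 1 else 0) m = M m l"
  using assms by (simp add: mat_app_def if_distrib[of "\<lambda>x. _ * x"] cong: if_cong)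

text \<open>In a basis of an invariant subspace \<open>W\<close>, extended to a basis of the whole space, the
  restriction of \<open>\<rho>\<close> to \<open>W\<close> becomes a matrix representation; \<open>J\<close> is the embedding and \<open>K\<close> a retraction.\<close>

lemma subrep_matrix:
  fixes \<rho> :: "complex^('n::finite)^'n \<Rightarrow> nat \<Rightarrow> nat \<Rightarrow> complex"
  assumes rep: "is_rep d \<rho>" and W: "invariant_subspace d \<rho> W" and ne: "W \<noteq> cvecs d"
  obtains d' \<rho>' J K where "d' < d" "is_rep d' \<rho>'"
    "\<And>x. x \<in> cvecs d' \<Longrightarrow> mat_app d J x \<in> W"
    "\<And>x. mat_app d K x \<in> cvecs d'"
    "\<And>w. w \<in> W \<Longrightarrow> mat_app d J (mat_app d K w) = w"
    "\<And>x. x \<in> cvecs d' \<Longrightarrow> mat_app d K (mat_app d J x) = x"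
    "\<And>g x. g \<in> unitary_grp \<Longrightarrow> x \<in> cvecs d' \<Longrightarrow> mat_app d J (mat_app d' (\<rho>' g) x) = mat_app d (\<rho> g) (mat_app d J x)"
proof -
  define e where "e = (\<lambda>(l::nat) k. if k = l then 1 else 0 :: complex)"
  have e_in: "e l \<in> cvecs n" if "l < n" for l n using that by (auto simp: e_def cvecs_def)
  have expand: "x = (\<Sum>k<n. sc (x k) (e k))" if "x \<in> cvecs n" for x n
    using that by (auto simp: fun_eq_iff sum_fun_nth cvecs_def e_def if_distrib[of "\<lambda>x. _ * x"] cong: if_cong)
  have Wsub: "W \<subseteq> cvecs d" "cv.subspace W" and Winv: "\<And>g v. g \<in> unitary_grp \<Longrightarrow> v \<in> W \<Longrightarrow> mat_app d (\<rho> g) v \<in> W"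
    using W by (auto simp: invariant_subspace_def)
  obtain B where B: "B \<subseteq> W" "cv.independent B" "W \<subseteq> cv.span B"
    using cv.maximal_independent_subset by blast
  have spanB: "cv.span B = W" using B Wsub by (simp add: cv.span_minimal subset_antisym)
  obtain B' where B': "B \<subseteq> B'" "B' \<subseteq> cvecs d" "cv.independent B'" "cvecs d \<subseteq> cv.span B'"
    using cv.maximal_independent_subset_extend[of B "cvecs d"] B Wsub by blast
  have "B' \<subseteq> cv.span (e ` {..<d})"
  proof
    fix x assume "x \<in> B'"
    then have "x \<in> cvecs d" using B' by blast
    then show "x \<in> cv.span (e ` {..<d})"
      using expand by (metis (no_types, lifting) cv.span_base cv.span_scale cv.span_sum image_eqI)
  qed
  then have fin': "finite B' \<and> card B' \<le> card (e ` {..<d})"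
    using cv.independent_span_bound[of "e ` {..<d}" B'] B' by simp
  moreover have "card (e ` {..<d}) \<le> d" using card_image_le[of "{..<d}" e] by simp
  moreover have "B \<noteq> B'"
  proof
    assume "B = B'"
    then have "cvecs d \<subseteq> W" using B' spanB by blast
    then show False using ne Wsub by blast
  qed
  moreover have "card B < card B'"
    using fin' B'(1) \<open>B \<noteq> B'\<close> by (intro psubset_card_mono) auto
  ultimately have "card B < d" by linarith
  have finB: "finite B" using fin' B' finite_subset by blast
  define d' where "d' = card B"
  have d': "d' < d" using \<open>card B < d\<close> by (simp add: d'_def)
  obtain b where b: "bij_betw b {..<d'} B"
    using ex_bij_betw_nat_finite[OF finB] unfolding d'_def atLeast0LessThan by blast
  have bB: "b m \<in> B" if "m < d'" for m using b that by (auto simp: bij_betw_def)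
  have b_inj: "b m = b l \<longleftrightarrow> m = l" if "m < d'" "l < d'" for m l
    using b that by (auto simp: bij_betw_def inj_on_def)
  have b_in: "b m \<in> cvecs d" if "m < d'" for m using bB[OF that] B Wsub by blast
  define J where "J = (\<lambda>i m. if m < d' then b m i else 0)"
  define rp where "rp = (\<lambda>x m. cv.representation B' x (b m))"
  define K where "K = (\<lambda>m k. if m < d' then rp (e k) m else 0)"
  have J_app: "mat_app d J x = (\<Sum>m<d'. sc (x m) (b m))" for x
  proof (rule ext)
    fix i
    have "(\<Sum>m<d. J i m * x m) = (\<Sum>m<d'. x m * b m i)"
      using d' by (intro sum.mono_neutral_cong_right) (auto simp: J_def)
    moreover have "(\<Sum>m<d'. x m * b m i) = 0" if "\<not> i < d"
      using b_in that by (intro sum.neutral) (auto simp: cvecs_def)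
    ultimately show "mat_app d J x i = (\<Sum>m<d'. sc (x m) (b m)) i"
      by (auto simp: mat_app_def sum_fun_nth)
  qed
  have sp: "x \<in> cv.span B'" if "x \<in> cvecs d" for x using B' that by blast
  have K_app: "mat_app d K x m = (if m < d' then rp x m else 0)" if x: "x \<in> cvecs d" for x m
  proof (cases "m < d'")
    case True
    have "rp x m = cv.representation B' (\<Sum>k<d. sc (x k) (e k)) (b m)"
      using expand[OF x] by (simp add: rp_def)
    also have "\<dots> = (\<Sum>k<d. cv.representation B' (sc (x k) (e k)) (b m))"
      using B' sp e_in by (subst cv.representation_sum) (auto intro!: cv.span_scale)
    also have "\<dots> = (\<Sum>k<d. x k * rp (e k) m)"
      using B' sp e_in by (intro sum.cong refl) (simp add: cv.representation_scale rp_def)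
    finally show ?thesis using True d' by (simp add: mat_app_def K_def mult.commute)
  qed (auto simp: mat_app_def K_def)
  have J_in: "mat_app d J x \<in> W" for x
    unfolding J_app using Wsub bB B by (intro cv.subspace_sum cv.subspace_scale) auto
  have K_in: "mat_app d K x \<in> cvecs d'" for x
    by (auto simp: cvecs_def mat_app_def K_def)
  have JK: "mat_app d J (mat_app d K w) = w" if w: "w \<in> W" for w
  proof -
    have "mat_app d J (mat_app d K w) = (\<Sum>m<d'. sc (cv.representation B' w (b m)) (b m))"
      using w Wsub K_app unfolding J_app by (intro sum.cong refl) (auto simp: rp_def)
    also have "cv.representation B' w = cv.representation B w"
      using B' w spanB by (intro cv.representation_extend) auto
    also have "(\<Sum>m<d'. sc (cv.representation B w (b m)) (b m)) = (\<Sum>y\<in>B. sc (cv.representation B w y) y)"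
      by (rule sum.reindex_bij_betw[OF b])
    also have "\<dots> = w" using B w finB by (intro cv.sum_representation_eq) auto
    finally show ?thesis .
  qed
  have KJ: "mat_app d K (mat_app d J x) = x" if x: "x \<in> cvecs d'" for x
  proof (rule cvecs_eqI[OF K_in x])
    fix l assume l: "l < d'"
    have "mat_app d K (mat_app d J x) l = cv.representation B' (\<Sum>m<d'. sc (x m) (b m)) (b l)"
      using l J_in[of x] Wsub by (subst K_app) (auto simp: rp_def J_app)
    also have "\<dots> = (\<Sum>m<d'. cv.representation B' (sc (x m) (b m)) (b l))"
      using B' sp b_in by (subst cv.representation_sum) (auto intro!: cv.span_scale)
    also have "\<dots> = (\<Sum>m<d'. x m * (if m = l then 1 else 0))"
    proof (rule sum.cong[OF refl])
      fix m assume m: "m \<in> {..<d'}"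
      have "cv.representation B' (b m) = (\<lambda>v. if v = b m then 1 else 0)"
        using B' bB m by (intro cv.representation_basis) auto
      then show "cv.representation B' (sc (x m) (b m)) (b l) = x m * (if m = l then 1 else 0)"
        using B' sp b_in m l by (auto simp: cv.representation_scale b_inj)
    qed
    also have "\<dots> = x l" using l by (simp add: if_distrib[of "\<lambda>x. _ * x"] cong: if_cong)
    finally show "mat_app d K (mat_app d J x) l = x l" .
  qed
  define \<rho>' where "\<rho>' = (\<lambda>g m l. if m < d' \<and> l < d' then mat_app d K (mat_app d (\<rho> g) (mat_app d J (e l))) m else 0)"
  have rho'_app: "mat_app d' (\<rho>' g) x = mat_app d K (mat_app d (\<rho> g) (mat_app d J x))" if x: "x \<in> cvecs d'" for g x
  proof (rule cvecs_eqI[OF mat_app_in K_in])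
    fix m assume m: "m < d'"
    have "mat_app d K (mat_app d (\<rho> g) (mat_app d J x))
      = (\<Sum>l<d'. sc (x l) (mat_app d K (mat_app d (\<rho> g) (mat_app d J (e l)))))"
      by (subst expand[OF x]) (simp only: mat_app_sum mat_app_sc)
    then show "mat_app d' (\<rho>' g) x m = mat_app d K (mat_app d (\<rho> g) (mat_app d J x)) m"
      using m by (simp add: sum_fun_nth mat_app_def[of d'] \<rho>'_def mult.commute)
  qed
  have inter: "mat_app d J (mat_app d' (\<rho>' g) x) = mat_app d (\<rho> g) (mat_app d J x)"
    if "g \<in> unitary_grp" "x \<in> cvecs d'" for g x
    using that Winv J_in by (simp add: rho'_app JK)
  have rep': "is_rep d' \<rho>'"
    unfolding is_rep_def
  proof (intro conjI ballI allI impI)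
    show "\<rho>' A i j = 0" if "d' \<le> i \<or> d' \<le> j" for A i j using that by (auto simp: \<rho>'_def)
    show "\<rho>' (mat 1) = idm d'"
    proof (intro ext)
      fix i j
      show "\<rho>' (mat 1) i j = idm d' i j"
        using J_in[of "e j"] Wsub KJ[OF e_in, of j] by (auto simp: \<rho>'_def idm_def rep_one[OF rep] subset_iff) (auto simp: e_def)
    qed
    fix A C :: "complex^'n^'n" and i j assume AC: "A \<in> unitary_grp" "C \<in> unitary_grp" and ij: "i < d'" "j < d'"
    have "\<rho>' (A ** C) i j = mat_app d' (\<rho>' (A ** C)) (e j) i"
      using ij mat_app_basis_vec[of j d' i] by (simp add: e_def)
    also have "mat_app d' (\<rho>' (A ** C)) (e j) = mat_app d K (mat_app d (\<rho> A) (mat_app d (\<rho> C) (mat_app d J (e j))))"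
      using ij AC by (simp add: rho'_app e_in rep_mult[OF rep])
    also have "\<dots> = mat_app d K (mat_app d (\<rho> A) (mat_app d J (mat_app d' (\<rho>' C) (e j))))"
      using ij AC by (simp add: inter e_in)
    also have "\<dots> = mat_app d' (\<rho>' A) (mat_app d' (\<rho>' C) (e j))" by (simp add: rho'_app)
    also have "\<dots> i = (\<Sum>k<d'. \<rho>' A i k * mat_app d' (\<rho>' C) (e j) k)" using ij by (simp add: mat_app_def[of d' "\<rho>' A"])
    also have "\<dots> = (\<Sum>k<d'. \<rho>' A i k * \<rho>' C k j)"
      using ij mat_app_basis_vec[of j d'] by (intro sum.cong refl) (simp add: e_def)
    finally show "\<rho>' (A ** C) i j = (\<Sum>k<d'. \<rho>' A i k * \<rho>' C k j)" .
  next
    fix i j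
    show "continuous_on unitary_grp (\<lambda>A. \<rho>' A i j)"
    proof (cases "i < d' \<and> j < d'")
      case True
      then have "(\<lambda>A. \<rho>' A i j) = (\<lambda>A. \<Sum>k<d. K i k * mat_app d (\<rho> A) (mat_app d J (e j)) k)"
        using d' by (auto simp: \<rho>'_def mat_app_def[of d K])
      then show ?thesis by (simp only:) (intro continuous_intros rep_continuous[OF rep])
    qed (auto simp: \<rho>'_def)
  qed
  show ?thesis by (rule that[OF d' rep' J_in K_in JK KJ inter])
qed

text \<open>The maps J and K carry weight vectors in both directions: w gives the weight \<nu>
  below, and every weight below is a weight above, so dominance is inherited.\<close>

lemma subrep_highest_weight:
  fixes \<rho> :: "((complex,'n::{finite,linorder}) vec,'n) vec \<Rightarrow> nat \<Rightarrow> nat \<Rightarrow> complex"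
  assumes rep: "is_rep d \<rho>" and W: "invariant_subspace d \<rho> W" and ne: "W \<noteq> cvecs d"
    and hw: "has_highest_weight d \<rho> \<nu>" and w: "w \<in> W" "weight_vec d \<rho> \<nu> w"
  shows "\<exists>d'<d. \<exists>\<rho>'. is_rep d' \<rho>' \<and> has_highest_weight d' \<rho>' \<nu>"
proof -
  obtain d' \<rho>' J K where d': "d' < d" "is_rep d' \<rho>'"
    "\<And>x. x \<in> cvecs d' \<Longrightarrow> mat_app d J x \<in> W"
    "\<And>x. mat_app d K x \<in> cvecs d'"
    "\<And>w. w \<in> W \<Longrightarrow> mat_app d J (mat_app d K w) = w"
    "\<And>x. x \<in> cvecs d' \<Longrightarrow> mat_app d K (mat_app d J x) = x"
    "\<And>g x. g \<in> unitary_grp \<Longrightarrow> x \<in> cvecs d' \<Longrightarrow> mat_app d J (mat_app d' (\<rho>' g) x) = mat_app d (\<rho> g) (mat_app d J x)"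
    using subrep_matrix[OF rep W ne] by blast
  have "weight_vec d' \<rho>' \<nu> (mat_app d K w)"
    unfolding weight_vec_def
  proof (intro conjI allI impI d')
    show "mat_app d K w \<noteq> 0"
    proof
      assume "mat_app d K w = 0"
      then have "w = 0" using d'(5)[OF w(1)] by simp
      then show False using w by (simp add: weight_vec_def)
    qed
    fix z :: "'n \<Rightarrow> complex" assume z: "\<forall>i. cmod (z i) = 1"
    have g: "diagm z \<in> unitary_grp" using z by (intro diagm_unitary) auto
    let ?c = "\<Prod>i\<in>UNIV. z i powi \<nu> i"
    have "mat_app d J (mat_app d' (\<rho>' (diagm z)) (mat_app d K w)) = mat_app d (\<rho> (diagm z)) w"
      using d'(7)[OF g d'(4)] d'(5)[OF w(1)] by simp
    also have "\<dots> = sc ?c w" using w z by (simp add: weight_vec_def)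
    finally have "mat_app d K (mat_app d J (mat_app d' (\<rho>' (diagm z)) (mat_app d K w))) = mat_app d K (sc ?c w)" by simp
    then show "mat_app d' (\<rho>' (diagm z)) (mat_app d K w) = sc ?c (mat_app d K w)"
      by (simp add: d'(6) mat_app_sc)
  qed
  moreover have "is_weight d \<rho> \<kappa>" if k: "is_weight d' \<rho>' \<kappa>" for \<kappa>
  proof -
    obtain x where x: "weight_vec d' \<rho>' \<kappa> x" using k is_weight_iff_vec by blast
    have xin: "x \<in> cvecs d'" using x by (simp add: weight_vec_def)
    have "weight_vec d \<rho> \<kappa> (mat_app d J x)"
      unfolding weight_vec_def
    proof (intro conjI allI impI mat_app_in)
      show "mat_app d J x \<noteq> 0"
      proof
        assume "mat_app d J x = 0"
        then have "x = 0" using d'(6)[OF xin] by simp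
        then show False using x by (simp add: weight_vec_def)
      qed
      fix z :: "'n \<Rightarrow> complex" assume z: "\<forall>i. cmod (z i) = 1"
      have g: "diagm z \<in> unitary_grp" using z by (intro diagm_unitary) auto
      show "mat_app d (\<rho> (diagm z)) (mat_app d J x) = sc (\<Prod>i\<in>UNIV. z i powi \<kappa> i) (mat_app d J x)"
        using d'(7)[OF g xin] x z by (simp add: weight_vec_def mat_app_sc)
    qed
    then show ?thesis using is_weight_iff_vec by blast
  qed
  ultimately have "has_highest_weight d' \<rho>' \<nu>"
    using hw unfolding has_highest_weight_def is_weight_iff_vec by blast
  then show ?thesis using d' by blast
qed

text \<open>Averaging a projection onto \<open>W\<close> over the group gives an equivariant one.\<close>

lemma (in haar_family) equivariant_projection:
  fixes \<rho> :: "complex^'n^'n \<Rightarrow> nat \<Rightarrow> nat \<Rightarrow> complex"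
  assumes rep: "is_rep d \<rho>" and W: "invariant_subspace d \<rho> W" and ne: "W \<noteq> cvecs d"
  obtains p where "\<And>x. x \<in> cvecs d \<Longrightarrow> p x \<in> W" "\<And>w. w \<in> W \<Longrightarrow> p w = w"
    "\<And>x y. p (x + y) = p x + p y" "\<And>a x. p (sc a x) = sc a (p x)"
    "\<And>g x. g \<in> unitary_grp \<Longrightarrow> x \<in> cvecs d \<Longrightarrow> p (mat_app d (\<rho> g) x) = mat_app d (\<rho> g) (p x)"
proof -
  obtain h where "urep \<mu> d h \<rho>" using rep_unitarizable[OF rep] by blast
  then interpret urep \<mu> d h \<rho> .
  obtain d' \<rho>' J K where d': "d' < d" "is_rep d' \<rho>'"
    "\<And>x. x \<in> cvecs d' \<Longrightarrow> mat_app d J x \<in> W"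
    "\<And>x. mat_app d K x \<in> cvecs d'"
    "\<And>w. w \<in> W \<Longrightarrow> mat_app d J (mat_app d K w) = w"
    "\<And>x. x \<in> cvecs d' \<Longrightarrow> mat_app d K (mat_app d J x) = x"
    "\<And>g x. g \<in> unitary_grp \<Longrightarrow> x \<in> cvecs d' \<Longrightarrow> mat_app d J (mat_app d' (\<rho>' g) x) = mat_app d (\<rho> g) (mat_app d J x)"
    using subrep_matrix[OF rep W ne] by blast
  have Wsub: "W \<subseteq> cvecs d" and Winv: "\<And>g v. g \<in> unitary_grp \<Longrightarrow> v \<in> W \<Longrightarrow> R g v \<in> W"
    using W by (auto simp: invariant_subspace_def R_def)
  define q where "q = (\<lambda>x. mat_app d J (mat_app d K x))"
  have q_in: "q x \<in> W" for x unfolding q_def by (intro d')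
  have q_id: "q w = w" if "w \<in> W" for w unfolding q_def using that by (rule d')
  have q_hI: "q (\<lambda>i. hI UNIV (\<lambda>g. f g i)) = (\<lambda>i. hI UNIV (\<lambda>g. q (f g) i))"
    if f: "\<And>i. continuous_on (unitary_sub UNIV) (\<lambda>g. f g i)" for f
  proof -
    have c: "continuous_on (unitary_sub UNIV) (\<lambda>g. mat_app d K (f g) i)" for i
      unfolding mat_app_def by (cases "i < d") (simp_all only: if_True if_False, (intro continuous_intros f)+)
    show ?thesis unfolding q_def by (simp only: mat_app_hI[OF f] mat_app_hI[OF c])
  qed
  define p where "p = (\<lambda>x i. hI UNIV (\<lambda>g. R g (q (R (adjm g) x)) i))"
  have cp: "continuous_on (unitary_sub UNIV) (\<lambda>g. R g (q (R (adjm g) x)) i)" for x i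
  proof (cases "i < d")
    case True
    have "continuous_on (unitary_sub UNIV) (\<lambda>g. \<rho> g i k)" for k using rep by (simp add: is_rep_def)
    moreover have "continuous_on (unitary_sub UNIV) (\<lambda>g. R (adjm g) x k)" for k
      by (rule continuous_on_inverse_arg[OF R_continuous])
    then have "continuous_on (unitary_sub UNIV) (\<lambda>g. mat_app d K (R (adjm g) x) k)" for k
      unfolding mat_app_def[of d K] by (cases "k < d") (auto intro!: continuous_intros)
    then have "continuous_on (unitary_sub UNIV) (\<lambda>g. q (R (adjm g) x) k)" for k
      unfolding q_def mat_app_def[of d J] by (cases "k < d") (auto intro!: continuous_intros)
    ultimately show ?thesis
      using True unfolding R_def[of _ "q _"] mat_app_def[of d "\<rho> _" "q _"] by (auto intro!: continuous_intros)
  qed (simp add: R_def mat_app_def)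
  have lin: "R g (q (R (adjm g) (x + y))) = R g (q (R (adjm g) x)) + R g (q (R (adjm g) y))"
    "R g (q (R (adjm g) (sc a x))) = sc a (R g (q (R (adjm g) x)))" for g x y a
    by (simp_all only: R_add R_sc q_def mat_app_add mat_app_sc)
  show ?thesis
  proof (rule that)
    fix x assume x: "x \<in> cvecs d"
    have "q (p x) = p x"
      unfolding p_def q_hI[OF cp] using Winv q_in by (intro ext hI_cong) (simp add: q_id)
    then show "p x \<in> W" using q_in by metis
  next
    fix w assume w: "w \<in> W"
    then have wc: "w \<in> cvecs d" using Wsub by blast
    show "p w = w"
    proof (rule ext)
      fix i
      have "p w i = hI UNIV (\<lambda>g. w i)"
        unfolding p_def
      proof (rule hI_cong)
        fix g :: "complex^'n^'n" assume "g \<in> unitary_sub UNIV"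
        then have g: "g \<in> unitary_grp" by simp
        have "R g (q (R (adjm g) w)) = w"
          using w wc g Winv[OF unitary_adj[OF g] w] R_adj_cancel[OF unitary_adj[OF g] wc] by (simp add: q_id)
        then show "R g (q (R (adjm g) w)) i = w i" by simp
      qed
      then show "p w i = w i" by simp
    qed
  next
    show "p (x + y) = p x + p y" for x y
      unfolding p_def lin by (simp add: fun_eq_iff hI_add[OF cp cp])
    show "p (sc a x) = sc a (p x)" for a x
      unfolding p_def lin by (simp add: fun_eq_iff hI_mult_left)
  next
    fix u :: "complex^'n^'n" and x assume u: "u \<in> unitary_grp" and x: "x \<in> cvecs d"
    have "R u (p x) = (\<lambda>i. hI UNIV (\<lambda>g. R u (R g (q (R (adjm g) x))) i))"
      unfolding p_def by (rule R_hI[OF cp])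
    also have "\<dots> = (\<lambda>i. hI UNIV (\<lambda>g. R (u ** g) (q (R (adjm (u ** g)) (R u x))) i))"
    proof (intro ext hI_cong)
      fix i and g :: "complex^'n^'n" assume "g \<in> unitary_sub UNIV"
      then have g: "g \<in> unitary_grp" by simp
      have "R (adjm (u ** g)) (R u x) = R (adjm g) x"
        using u g x by (simp add: adjm_mul R_mult unitary_adj R_adj_cancel)
      then show "R u (R g (q (R (adjm g) x))) i = R (u ** g) (q (R (adjm (u ** g)) (R u x))) i"
        using u g by (simp add: R_mult)
    qed
    also have "\<dots> = p (R u x)"
      unfolding p_def using u by (intro ext hI_left[OF cp]) simp
    finally show "p (mat_app d (\<rho> u) x) = mat_app d (\<rho> u) (p x)" by (simp add: R_def)
  qed
qed

text \<open>Induction on the dimension. Given an invariant subspace W and an equivariant projection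
  p onto it, a weight vector v either has the non-zero image \<open>p v\<close> in W or lies in the
  kernel of p. Both subspaces are invariant and proper.\<close>

lemma highest_weight_irrep_exists:
  fixes \<mu> :: "'n::{finite,linorder} set \<Rightarrow> ((complex,'n) vec,'n) vec measure"
    and \<rho> :: "((complex,'n) vec,'n) vec \<Rightarrow> nat \<Rightarrow> nat \<Rightarrow> complex"
  assumes haar: "haar_family \<mu>" and "is_rep d \<rho>" "has_highest_weight d \<rho> \<nu>"
  shows "\<exists>d (\<rho> :: ((complex,'n) vec,'n) vec \<Rightarrow> nat \<Rightarrow> nat \<Rightarrow> complex). is_irrep d \<rho> \<and> has_highest_weight d \<rho> \<nu>"
  using assms(2,3)
proof (induction d arbitrary: \<rho> rule: less_induct)
  case (less d)
  interpret haar_family \<mu> by (rule haar)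
  have add: "(\<lambda>k. v k + w k) = v + w" "(\<lambda>k. a * v k) = sc a v" "(\<lambda>_. 0) = (0 :: nat \<Rightarrow> complex)" for v w :: "nat \<Rightarrow> complex" and a
    by (auto simp: fun_eq_iff)
  obtain v where v: "weight_vec d \<rho> \<nu> v"
    using less.prems unfolding has_highest_weight_def is_weight_iff_vec by blast
  have vc: "v \<in> cvecs d" "v \<noteq> 0" using v by (auto simp: weight_vec_def)
  have "1 \<le> d"
  proof (rule ccontr)
    assume "\<not> 1 \<le> d"
    then have "v = 0" using vc by (auto simp: cvecs_def fun_eq_iff)
    then show False using vc by simp
  qed
  show ?case
  proof (cases "is_irrep d \<rho>")
    case False
    then have "\<exists>W. W \<subseteq> cvecs d \<and> 0 \<in> W \<and> (\<forall>v\<in>W. \<forall>w\<in>W. v + w \<in> W) \<and> (\<forall>a. \<forall>v\<in>W. sc a v \<in> W)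
        \<and> (\<forall>g\<in>unitary_grp. \<forall>v\<in>W. mat_app d (\<rho> g) v \<in> W) \<and> W \<noteq> {0} \<and> W \<noteq> cvecs d"
      using less.prems(1) \<open>1 \<le> d\<close> unfolding is_irrep_def add
      by (simp only: simp_thms not_all not_imp de_Morgan_disj conj_assoc)
    then obtain W where W0: "W \<subseteq> cvecs d \<and> 0 \<in> W \<and> (\<forall>v\<in>W. \<forall>w\<in>W. v + w \<in> W) \<and> (\<forall>a. \<forall>v\<in>W. sc a v \<in> W)
        \<and> (\<forall>g\<in>unitary_grp. \<forall>v\<in>W. mat_app d (\<rho> g) v \<in> W) \<and> W \<noteq> {0} \<and> W \<noteq> cvecs d"
      by (elim exE)
    then have W: "W \<subseteq> cvecs d" "0 \<in> W" "\<And>v w. v \<in> W \<Longrightarrow> w \<in> W \<Longrightarrow> v + w \<in> W"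
        "\<And>a v. v \<in> W \<Longrightarrow> sc a v \<in> W" "\<And>g v. g \<in> unitary_grp \<Longrightarrow> v \<in> W \<Longrightarrow> mat_app d (\<rho> g) v \<in> W"
        "W \<noteq> {0}" "W \<noteq> cvecs d"
      by simp_all
    have inv: "invariant_subspace d \<rho> W"
      using W by (auto simp: invariant_subspace_def cv.subspace_def)
    obtain p where p: "\<And>x. x \<in> cvecs d \<Longrightarrow> p x \<in> W" "\<And>w. w \<in> W \<Longrightarrow> p w = w"
        "\<And>x y. p (x + y) = p x + p y" "\<And>a x. p (sc a x) = sc a (p x)"
        "\<And>g x. g \<in> unitary_grp \<Longrightarrow> x \<in> cvecs d \<Longrightarrow> p (mat_app d (\<rho> g) x) = mat_app d (\<rho> g) (p x)"
      using equivariant_projection[OF less.prems(1) inv W(7)] by blast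
    have "\<exists>d'<d. \<exists>\<rho>'. is_rep d' \<rho>' \<and> has_highest_weight d' \<rho>' \<nu>"
    proof (cases "p v = 0")
      case False
      have "weight_vec d \<rho> \<nu> (p v)"
        unfolding weight_vec_def
      proof (intro conjI allI impI False)
        show "p v \<in> cvecs d" using p(1)[OF vc(1)] W(1) by blast
        fix z :: "'n \<Rightarrow> complex" assume z: "\<forall>i. cmod (z i) = 1"
        then have "diagm z \<in> unitary_grp" by (intro diagm_unitary) auto
        then show "mat_app d (\<rho> (diagm z)) (p v) = sc (\<Prod>i\<in>UNIV. z i powi \<nu> i) (p v)"
          using p(5)[of "diagm z" v] p(4) vc v z by (simp add: weight_vec_def)
      qed
      then show ?thesis by (rule subrep_highest_weight[OF less.prems(1) inv W(7) less.prems(2) p(1)[OF vc(1)]])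
    next
      case True
      define W' where "W' = {x \<in> cvecs d. p x = 0}"
      have inv': "invariant_subspace d \<rho> W'"
        using p(2)[OF W(2)] p by (auto simp: invariant_subspace_def cv.subspace_def W'_def cvecs_add cvecs_sc)
      have "W' \<noteq> cvecs d"
      proof
        assume "W' = cvecs d"
        then have "p w = 0" if "w \<in> W" for w using that W(1) unfolding W'_def by blast
        then have "w = 0" if "w \<in> W" for w using that p(2) by simp
        then show False using W(2,6) by blast
      qed
      then show ?thesis
        using subrep_highest_weight[OF less.prems(1) inv' _ less.prems(2) _ v] True vc by (simp add: W'_def)
    qed
    then show ?thesis using less.IH by blast
  qed (use less.prems in blast)
qed

section \<open>The tensor representation\<close>

lemma cis_powi_eq_imp_eq:
  assumes "\<And>t. cis t powi a = cis t powi b"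
  shows "a = b"
proof (rule ccontr)
  assume "a \<noteq> b"
  \<comment> \<open>Here the two powers differ by the factor cis pi = -1.\<close>
  define t where "t = pi / of_int (a - b)"
  have "cis (of_int a * t) = cis (of_int b * t)" using assms[of t] by (simp add: cis_power_int)
  then have "cis (of_int a * t) / cis (of_int b * t) = 1" by simp
  then have "cis (of_int (a - b) * t) = 1" by (simp add: cis_divide algebra_simps)
  moreover have "of_int (a - b) * t = pi" using \<open>a \<noteq> b\<close> by (simp add: t_def)
  ultimately show False by simp
qed

lemma sum4:
  fixes f :: "'n::finite \<times> 'n \<times> 'n \<times> 'n \<Rightarrow> complex"
  shows "(\<Sum>I\<in>UNIV. f I) = (\<Sum>i\<in>UNIV. \<Sum>j\<in>UNIV. \<Sum>k\<in>UNIV. \<Sum>l\<in>UNIV. f (i, j, k, l))"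
  by (simp only: sum.cartesian_product UNIV_Times_UNIV) (simp add: case_prod_unfold)

text \<open>The matrix of g on the tensor product of two copies of V and two copies of its dual. For
  unitary g the dual is given by the conjugate entries.\<close>

definition tens :: "complex^('n::finite)^'n \<Rightarrow> 'n \<times> 'n \<times> 'n \<times> 'n \<Rightarrow> 'n \<times> 'n \<times> 'n \<times> 'n \<Rightarrow> complex" where
  "tens g = (\<lambda>(i, j, k, l) (i', j', k', l'). g$i$i' * g$j$j' * cnj (g$k$k') * cnj (g$l$l'))"

lemma tens_one: "tens (mat 1) I J = (if I = J then 1 else 0)"
  by (cases I, cases J) (auto simp: tens_def mat1_nth)

lemma tens_mult: "tens (g ** g') I J = (\<Sum>K\<in>UNIV. tens g I K * tens g' K J)"
proof -
  obtain i j k l i' j' k' l' where I: "I = (i, j, k, l)" and J: "J = (i', j', k', l')"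
    by (cases I, cases J) auto
  have "tens (g ** g') I J = (\<Sum>a\<in>UNIV. g$i$a * g'$a$i') * (\<Sum>b\<in>UNIV. g$j$b * g'$b$j')
      * (\<Sum>c\<in>UNIV. cnj (g$k$c) * cnj (g'$c$k')) * (\<Sum>e\<in>UNIV. cnj (g$l$e) * cnj (g'$e$l'))"
    by (simp add: I J tens_def matmul_nth)
  also have "\<dots> = (\<Sum>a\<in>UNIV. \<Sum>b\<in>UNIV. \<Sum>c\<in>UNIV. \<Sum>e\<in>UNIV. (g$i$a * g'$a$i') * (g$j$b * g'$b$j')
      * (cnj (g$k$c) * cnj (g'$c$k')) * (cnj (g$l$e) * cnj (g'$e$l')))"
  proof -
    have "sum A UNIV * sum B UNIV * sum C UNIV * sum E UNIV
        = (\<Sum>a\<in>UNIV. \<Sum>b\<in>UNIV. \<Sum>c\<in>UNIV. \<Sum>e\<in>UNIV. A a * B b * C c * E e)" for A B C E :: "'a \<Rightarrow> complex"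
    proof -
      have "sum A UNIV * sum B UNIV * sum C UNIV * sum E UNIV
          = (\<Sum>a\<in>UNIV. A a * (\<Sum>b\<in>UNIV. B b * (\<Sum>c\<in>UNIV. C c * (\<Sum>e\<in>UNIV. E e))))"
        by (simp only: sum_distrib_right[symmetric] mult.assoc)
      then show ?thesis by (simp only: sum_distrib_left mult.assoc)
    qed
    then show ?thesis .
  qed
  also have "\<dots> = (\<Sum>K\<in>UNIV. tens g I K * tens g' K J)"
    unfolding sum4 by (simp add: I J tens_def mult_ac)
  finally show ?thesis .
qed

lemma cnj_tens: "cnj (tens g I J) = tens (adjm g) J I"
  by (cases I, cases J) (simp add: tens_def mult_ac)

lemma Min_neq_Max:
  assumes n2: "CARD('n::{finite,linorder}) \<ge> 2"
  shows "(Min UNIV :: 'n) \<noteq> Max UNIV"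
proof
  assume eq: "(Min UNIV :: 'n) = Max UNIV"
  have "x = Min UNIV" for x :: 'n using eq Min_le[of UNIV x] Max_ge[of UNIV x] by (simp add: order_antisym)
  then have "(UNIV :: 'n set) \<subseteq> {Min UNIV}" by blast
  then have "CARD('n) \<le> 1" using card_mono[of "{Min UNIV :: 'n}" UNIV] by simp
  then show False using n2 by simp
qed

lemma weight_2m2_partial:
  fixes m :: "'n::{finite,linorder}"
  assumes n2: "CARD('n) \<ge> 2"
  shows "(\<Sum>x\<in>{x. x \<le> m}. weight_2m2 x) = (if m = Max UNIV then 0 else 2)" "(\<Sum>x\<in>(UNIV::'n set). weight_2m2 x) = 0"
proof -
  note pq = Min_neq_Max[OF n2]
  have split: "weight_2m2 x = (if x = Min UNIV then 2 else 0) + (if x = Max UNIV then - 2 else 0)" for x :: 'n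
    using pq by (auto simp: weight_2m2_def)
  have "Min UNIV \<le> m" by simp
  moreover have "Max UNIV \<le> m \<longleftrightarrow> m = Max UNIV" by (metis Max_ge UNIV_I antisym finite order_refl)
  ultimately show "(\<Sum>x\<in>{x. x \<le> m}. weight_2m2 x) = (if m = Max UNIV then 0 else 2)"
    unfolding split sum.distrib by simp
  show "(\<Sum>x\<in>(UNIV::'n set). weight_2m2 x) = 0"
    unfolding split sum.distrib by simp
qed

text \<open>With p the first and q the last index, the basis vector indexed by (p, p, q, q) has the
  required weight, and its matrix coefficient is a single entry of the tensor matrix. The model
  serves twice: as source of an irreducible representation and to evaluate the coefficient in all of
  them.\<close>

lemma tensor_rep_highest_weight:
  fixes \<mu> :: "'n::{finite,linorder} set \<Rightarrow> ((complex,'n) vec,'n) vec measure"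
  assumes haar: "haar_family \<mu>" and n2: "CARD('n) \<ge> 2"
  shows "\<exists>d h \<rho> D v. hw_rep \<mu> d h \<rho> D v weight_2m2 \<and> herm_form.H d h v v = 1 \<and>
    (\<forall>g\<in>unitary_grp. herm_form.H d h v (mat_app d (\<rho> g) v) = (g$(Min UNIV)$(Min UNIV))^2 * (cnj (g$(Max UNIV)$(Max UNIV)))^2)"
proof -
  interpret haar_family \<mu> by (rule haar)
  let ?p = "Min UNIV :: 'n" and ?q = "Max UNIV :: 'n"
  note pq = Min_neq_Max[OF n2]
  define N where "N = CARD('n \<times> 'n \<times> 'n \<times> 'n)"
  obtain en :: "nat \<Rightarrow> 'n \<times> 'n \<times> 'n \<times> 'n" where en: "bij_betw en {..<N} UNIV"
    using ex_bij_betw_nat_finite[OF finite[of UNIV]] unfolding N_def atLeast0LessThan by blast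
  have en_inj: "en a = en b \<longleftrightarrow> a = b" if "a < N" "b < N" for a b
    using en that by (auto simp: bij_betw_def inj_on_def)
  define \<tau> :: "((complex,'n) vec,'n) vec \<Rightarrow> nat \<Rightarrow> nat \<Rightarrow> complex" where "\<tau> = (\<lambda>g a b. if a < N \<and> b < N then tens g (en a) (en b) else 0)"
  have sum_en: "(\<Sum>c<N. f (en c)) = (\<Sum>K\<in>UNIV. f K)" for f :: "_ \<Rightarrow> complex"
    by (rule sum.reindex_bij_betw[OF en])
  have mult: "(\<Sum>c<N. \<tau> g a c * \<tau> g' c b) = tens (g ** g') (en a) (en b)" if "a < N" "b < N" for g g' a b
    unfolding tens_mult sum_en[symmetric] using that by (intro sum.cong refl) (simp add: \<tau>_def)
  have rep: "is_rep N \<tau>"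
    unfolding is_rep_def
  proof (intro conjI ballI allI impI)
    show "\<tau> A i j = 0" if "N \<le> i \<or> N \<le> j" for A i j using that by (auto simp: \<tau>_def)
    show "\<tau> (mat 1) = idm N" by (auto simp: \<tau>_def idm_def tens_one en_inj fun_eq_iff)
    show "\<tau> (A ** B) i j = (\<Sum>k<N. \<tau> A i k * \<tau> B k j)" if "i < N" "j < N" for A B i j
      using that mult by (simp add: \<tau>_def)
    fix i j
    show "continuous_on unitary_grp (\<lambda>A. \<tau> A i j)"
      by (cases "i < N \<and> j < N") (auto simp: \<tau>_def tens_def case_prod_unfold intro!: continuous_intros)
  qed
  define h where "h = (\<lambda>a b :: nat. if a = b then 1 else 0 :: complex)"
  have H_eq: "(\<Sum>i<N. \<Sum>j<N. cnj (x i) * h i j * y j) = (\<Sum>i<N. cnj (x i) * y i)" for x y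
    by (simp add: h_def if_distrib[of "\<lambda>x. _ * x"] if_distrib[of "\<lambda>x. x * _"] cong: if_cong)
  interpret hf: herm_form N h
  proof
    show "h i j = cnj (h j i)" for i j by (simp add: h_def)
    fix x :: "nat \<Rightarrow> complex" assume x: "x \<in> cvecs N" "x \<noteq> 0"
    obtain k where k: "x k \<noteq> 0" using x by (auto simp: fun_eq_iff)
    then have "k < N" using x by (metis (mono_tags, lifting) cvecs_def mem_Collect_eq not_le)
    then have "0 < (\<Sum>i<N. (cmod (x i))^2)" using k by (intro sum_pos2[of _ k]) auto
    also have "\<dots> = Re (\<Sum>i<N. cnj (x i) * x i)" by (simp add: cmod_power2) (simp add: power2_eq_square)
    finally show "0 < Re (\<Sum>i<N. \<Sum>j<N. cnj (x i) * h i j * x j)" by (simp only: H_eq)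
  qed
  have hf_H: "hf.H x y = (\<Sum>i<N. cnj (x i) * y i)" for x y unfolding hf.H_def by (rule H_eq)
  have H_inv: "hf.H (mat_app N (\<tau> g) x) (mat_app N (\<tau> g) y) = hf.H x y" if g: "g \<in> unitary_grp" for g x y
  proof -
    have orth: "(\<Sum>a<N. cnj (\<tau> g a b) * \<tau> g a c) = (if b = c then 1 else 0)" if "b < N" "c < N" for b c
    proof -
      have "(\<Sum>a<N. cnj (\<tau> g a b) * \<tau> g a c) = (\<Sum>a<N. \<tau> (adjm g) b a * \<tau> g a c)"
        using that by (intro sum.cong refl) (simp add: \<tau>_def cnj_tens)
      also have "\<dots> = tens (adjm g ** g) (en b) (en c)" by (rule mult[OF that])
      finally show ?thesis using that g by (simp add: tens_one en_inj)
    qed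
    have "hf.H (mat_app N (\<tau> g) x) (mat_app N (\<tau> g) y)
        = (\<Sum>a<N. \<Sum>b<N. \<Sum>c<N. cnj (x b) * y c * (cnj (\<tau> g a b) * \<tau> g a c))"
      unfolding hf_H by (intro sum.cong refl) (simp add: mat_app_def sum_product, simp only: mult_ac)
    also have "\<dots> = (\<Sum>b<N. \<Sum>c<N. \<Sum>a<N. cnj (x b) * y c * (cnj (\<tau> g a b) * \<tau> g a c))"
      by (subst sum.swap, rule sum.cong[OF refl], rule sum.swap)
    also have "\<dots> = (\<Sum>b<N. \<Sum>c<N. cnj (x b) * y c * (if b = c then 1 else 0))"
      by (intro sum.cong refl) (simp only: sum_distrib_left[symmetric] orth lessThan_iff)
    also have "\<dots> = hf.H x y" by (simp add: hf_H if_distrib[of "\<lambda>x. _ * x"] cong: if_cong)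
    finally show ?thesis .
  qed
  interpret u: urep \<mu> N h \<tau> by unfold_locales (use rep H_inv in auto)
  have smooth: "\<exists>F. F differentiable (at (mat 1)) \<and> (\<forall>g\<in>unitary_grp. F g = \<tau> g i j)" if ij: "i < N" "j < N" for i j
  proof -
    obtain a b c e a' b' c' e' where e: "en i = (a, b, c, e)" "en j = (a', b', c', e')"
      by (cases "en i", cases "en j") auto
    have "(\<lambda>g::((complex,'n) vec,'n) vec. g$a$a' * g$b$b' * cnj (g$c$c') * cnj (g$e$e')) differentiable (at (mat 1))"
      by (intro differentiable_mult entry_differentiable cnj_entry_differentiable)
    moreover have "\<tau> g i j = g$a$a' * g$b$b' * cnj (g$c$c') * cnj (g$e$e')" for g
      using ij by (simp add: \<tau>_def tens_def e)
    ultimately show ?thesis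
      by (intro exI[of _ "\<lambda>g. g$a$a' * g$b$b' * cnj (g$c$c') * cnj (g$e$e')"] conjI) auto
  qed
  obtain D where D: "\<And>X Y i j. D (X + Y) i j = D X i j + D Y i j" "\<And>z X i j. D (csm z X) i j = z * D X i j"
    "\<And>a i j. cin a a = 1 \<Longrightarrow> i < N \<Longrightarrow> j < N \<Longrightarrow>
      ((\<lambda>t. \<tau> (refl_mat a (cis t)) i j) has_vector_derivative (\<i> * D (outer a a) i j)) (at 0)"
    using smooth_rep_imp_lie[of N \<tau>, OF smooth] by blast
  interpret l: lie_rep \<mu> N h \<tau> D by unfold_locales (use D in auto)
  have "en ` {..<N} = UNIV" using en by (simp add: bij_betw_def)
  then have "(?p, ?p, ?q, ?q) \<in> en ` {..<N}" by simp
  then obtain a0 where a0: "a0 < N" "en a0 = (?p, ?p, ?q, ?q)" by auto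
  define v where "v = (\<lambda>a. if a = a0 then 1 else 0 :: complex)"
  have tau_diag: "mat_app N (\<tau> (diagm z)) x a = (case en a of (i, j, k, l) \<Rightarrow> z i * z j * cnj (z k) * cnj (z l)) * x a" if a: "a < N" for z x a
  proof -
    have "\<tau> (diagm z) a b = (if b = a then (case en a of (i, j, k, l) \<Rightarrow> z i * z j * cnj (z k) * cnj (z l)) else 0)" if "b < N" for b
      using a that en_inj[of a b] by (cases "en a", cases "en b") (auto simp: \<tau>_def tens_def)
    then have "(\<Sum>b<N. \<tau> (diagm z) a b * x b) = (\<Sum>b<N. (if b = a then (case en a of (i, j, k, l) \<Rightarrow> z i * z j * cnj (z k) * cnj (z l)) * x a else 0))"
      by (intro sum.cong refl) auto
    then show ?thesis using a by (simp add: mat_app_def)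
  qed
  have wt: "l.wtv weight_2m2 v"
    unfolding l.wtv_def
  proof (intro conjI allI impI)
    show v_in: "v \<in> cvecs N" using a0 by (auto simp: v_def cvecs_def)
    have "v a0 \<noteq> 0" by (simp add: v_def)
    then show "v \<noteq> 0" by auto
    fix z :: "'n \<Rightarrow> complex" assume z: "\<forall>i. cmod (z i) = 1"
    have inv: "inverse (z i) = cnj (z i)" for i
      using cnj_mult_unit[of "z i"] z by (metis inverse_unique mult.commute)
    have "(\<Prod>i\<in>UNIV. z i powi weight_2m2 i) = (\<Prod>i\<in>{?p, ?q}. z i powi weight_2m2 i)"
      by (rule prod.mono_neutral_right) (auto simp: weight_2m2_def)
    also have "\<dots> = (z ?p)^2 * (cnj (z ?q))^2"
      using pq by (simp add: weight_2m2_def power_int_minus inv power_inverse[symmetric])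
    finally have pr: "(\<Prod>i\<in>UNIV. z i powi weight_2m2 i) = z ?p * z ?p * cnj (z ?q) * cnj (z ?q)"
      by (simp add: power2_eq_square)
    show "u.R (diagm z) v = sc (\<Prod>i\<in>UNIV. z i powi weight_2m2 i) v"
    proof (rule cvecs_eqI[of _ N])
      show "u.R (diagm z) v a = sc (\<Prod>i\<in>UNIV. z i powi weight_2m2 i) v a" if "a < N" for a
        unfolding u.R_def tau_diag[OF that] pr by (simp add: v_def a0)
    qed (use v_in in \<open>auto intro: cvecs_sc\<close>)
  qed
  have dom: "dom_le \<kappa> weight_2m2" if k: "is_weight N \<tau> \<kappa>" for \<kappa>
  proof -
    obtain x where x: "l.wtv \<kappa> x" using k l.is_weight_iff by blast
    then obtain a where a: "x a \<noteq> 0" unfolding l.wtv_def by (auto simp: fun_eq_iff)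
    have aN: "a < N" using a x unfolding l.wtv_def cvecs_def by (metis (mono_tags, lifting) mem_Collect_eq not_le)
    obtain i j k' l' where ijkl: "en a = (i, j, k', l')" by (cases "en a") auto
    have eq: "z i * z j * cnj (z k') * cnj (z l') = (\<Prod>m\<in>UNIV. z m powi \<kappa> m)" if z: "\<forall>i. cmod (z i) = 1" for z
    proof -
      have "u.R (diagm z) x a = (\<Prod>m\<in>UNIV. z m powi \<kappa> m) * x a" using x z by (simp add: l.wtv_def)
      then show ?thesis using a unfolding u.R_def tau_diag[OF aN] ijkl by simp
    qed
    define dl where "dl = (\<lambda>(m::'n) m'. if m = m' then 1 else 0 :: int)"
    \<comment> \<open>Tuples z with one coordinate cis t and all others 1 isolate the exponent at
      m.\<close>
    have kap: "\<kappa> m = dl m i + dl m j - dl m k' - dl m l'" for m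
    proof (rule cis_powi_eq_imp_eq)
      fix t
      define z where "z = (\<lambda>m'. if m' = m then cis t else 1)"
      have z1: "z m' = cis t powi dl m m'" and z2: "cnj (z m') = cis t powi (- dl m m')" for m'
        by (auto simp: z_def dl_def cis_cnj power_int_minus cis_inverse)
      have "cis t powi \<kappa> m = z i * z j * cnj (z k') * cnj (z l')"
        using eq[of z] prod_powi_single[of m "cis t" \<kappa>] by (simp add: z_def)
      also have "\<dots> = cis t powi (dl m i + dl m j - dl m k' - dl m l')"
        unfolding z2 unfolding z1 by (simp add: power_int_add[symmetric] cis_neq_zero)
      finally show "cis t powi \<kappa> m = cis t powi (dl m i + dl m j - dl m k' - dl m l')" .
    qed
    \<comment> \<open>A partial sum counts the indices i, j up to c minus the indices k', l' up to
      c. It is at most 2, and 0 once c is the last index.\<close>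
    have part: "(\<Sum>m\<in>{m. m \<le> c}. \<kappa> m) = (if i \<le> c then 1 else 0) + (if j \<le> c then 1 else 0) - (if k' \<le> c then 1 else 0) - (if l' \<le> c then 1 else 0)" for c
      unfolding kap sum_subtractf sum.distrib dl_def by simp
    have "(\<Sum>m\<in>UNIV. \<kappa> m) = 0"
      unfolding kap sum_subtractf sum.distrib dl_def by simp
    moreover have "(\<Sum>m\<in>{m. m \<le> c}. \<kappa> m) \<le> (\<Sum>m\<in>{m. m \<le> c}. weight_2m2 m)" for c
    proof (cases "c = ?q")
      case True
      then have "x \<le> c" for x by simp
      then show ?thesis unfolding part weight_2m2_partial(1)[OF n2] using True by simp
    next
      case False
      then show ?thesis unfolding part weight_2m2_partial(1)[OF n2] by simp
    qed
    ultimately show ?thesis unfolding dom_le_def using weight_2m2_partial(2)[OF n2] by simp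
  qed
  have hw: "hw_rep \<mu> N h \<tau> D v weight_2m2"
    by unfold_locales (use wt dom in auto)
  have H_v: "hf.H v y = y a0" for y
    using a0 by (simp add: hf_H v_def if_distrib[of "\<lambda>x. x * _"] if_distrib[of cnj] cong: if_cong)
  have "hf.H v v = 1" by (simp add: H_v) (simp add: v_def)
  moreover have "hf.H v (mat_app N (\<tau> g) v) = (g$?p$?p)^2 * (cnj (g$?q$?q))^2" for g
  proof -
    have "hf.H v (mat_app N (\<tau> g) v) = mat_app N (\<tau> g) v a0" by (rule H_v)
    also have "\<dots> = \<tau> g a0 a0" unfolding v_def by (rule mat_app_basis_vec[OF a0(1) a0(1)])
    finally have "hf.H v (mat_app N (\<tau> g) v) = \<tau> g a0 a0" .
    then show ?thesis using a0 by (simp add: \<tau>_def tens_def power2_eq_square)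
  qed
  ultimately show ?thesis using hw by blast
qed

section \<open>The extremal eigenvector\<close>

lemma card_supersets:
  fixes S :: "'n::finite set"
  shows "card {B. card B = l \<and> S \<subseteq> B} = (if l < card S then 0 else (CARD('n) - card S) choose (l - card S))"
proof (cases "l < card S")
  case True
  have "card S \<le> card B" if "S \<subseteq> B" for B :: "'n set" using that by (simp add: card_mono)
  then have "{B. card B = l \<and> S \<subseteq> B} = {}" using True leD by blast
  then show ?thesis using True by simp
next
  case False
  have "bij_betw (\<lambda>B. B - S) {B. card B = l \<and> S \<subseteq> B} {B. B \<subseteq> - S \<and> card B = l - card S}"
  proof (rule bij_betw_byWitness[of _ "\<lambda>B. B \<union> S"])
    show "(\<lambda>B. B - S) ` {B. card B = l \<and> S \<subseteq> B} \<subseteq> {B. B \<subseteq> - S \<and> card B = l - card S}"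
      by (auto simp: card_Diff_subset)
    show "(\<lambda>B. B \<union> S) ` {B. B \<subseteq> - S \<and> card B = l - card S} \<subseteq> {B. card B = l \<and> S \<subseteq> B}"
    proof safe
      fix B assume B: "B \<subseteq> - S" "card B = l - card S"
      then have "B \<inter> S = {}" by auto
      then show "card (B \<union> S) = l" using B False by (simp add: card_Un_disjoint)
    qed
  qed auto
  then have "card {B. card B = l \<and> S \<subseteq> B} = card {B. B \<subseteq> - S \<and> card B = l - card S}"
    by (rule bij_betw_same_card)
  also have "\<dots> = card (- S) choose (l - card S)" by (rule n_subsets) simp
  also have "card (- S) = CARD('n) - card S" by (simp add: Compl_eq_Diff_UNIV card_Diff_subset)
  finally show ?thesis using False by simp
qed

lemma sum_over_subsets:
  fixes x :: "'n::finite \<Rightarrow> real"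
  shows "(\<Sum>B | card B = l. \<Sum>i\<in>B. x i) = real (if l < 1 then 0 else (CARD('n) - 1) choose (l - 1)) * (\<Sum>i\<in>UNIV. x i)"
proof -
  have "(\<Sum>B | card B = l. \<Sum>i\<in>B. x i) = (\<Sum>B | card B = l. \<Sum>i\<in>UNIV. if i \<in> B then x i else 0)"
    by (rule sum.cong[OF refl]) (simp add: sum.If_cases)
  also have "\<dots> = (\<Sum>i\<in>UNIV. \<Sum>B | card B = l. if i \<in> B then x i else 0)" by (rule sum.swap)
  also have "\<dots> = (\<Sum>i\<in>UNIV. real (card {B. card B = l \<and> {i} \<subseteq> B}) * x i)"
    by (intro sum.cong refl) (simp add: sum.If_cases Int_def)
  finally show ?thesis by (simp only: card_supersets) (simp add: sum_distrib_left)
qed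

lemma sum_over_subsets2:
  fixes x :: "'n::finite \<Rightarrow> 'n \<Rightarrow> real"
  shows "(\<Sum>B | card B = l. \<Sum>i\<in>B. \<Sum>j\<in>B - {i}. x i j)
    = real (if l < 2 then 0 else (CARD('n) - 2) choose (l - 2)) * (\<Sum>i\<in>UNIV. \<Sum>j\<in>UNIV - {i}. x i j)"
proof -
  have "(\<Sum>B | card B = l. \<Sum>i\<in>B. \<Sum>j\<in>B - {i}. x i j)
      = (\<Sum>B | card B = l. \<Sum>i\<in>UNIV. \<Sum>j\<in>UNIV - {i}. if {i, j} \<subseteq> B then x i j else 0)"
  proof (rule sum.cong[OF refl])
    fix B :: "'n set"
    have "(\<Sum>i\<in>UNIV. \<Sum>j\<in>UNIV - {i}. if {i, j} \<subseteq> B then x i j else 0)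
        = (\<Sum>i\<in>UNIV. if i \<in> B then \<Sum>j\<in>UNIV - {i}. if j \<in> B then x i j else 0 else 0)"
      by (intro sum.cong refl) auto
    also have "\<dots> = (\<Sum>i\<in>B. \<Sum>j\<in>UNIV - {i}. if j \<in> B then x i j else 0)"
      by (simp add: sum.If_cases)
    also have "\<dots> = (\<Sum>i\<in>B. \<Sum>j\<in>B - {i}. x i j)"
      by (rule sum.cong[OF refl]) (auto simp: sum.If_cases intro!: sum.cong)
    finally show "(\<Sum>i\<in>B. \<Sum>j\<in>B - {i}. x i j) = (\<Sum>i\<in>UNIV. \<Sum>j\<in>UNIV - {i}. if {i, j} \<subseteq> B then x i j else 0)" by simp
  qed
  also have "\<dots> = (\<Sum>i\<in>UNIV. \<Sum>j\<in>UNIV - {i}. \<Sum>B | card B = l. if {i, j} \<subseteq> B then x i j else 0)"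
    by (subst sum.swap, rule sum.cong[OF refl], rule sum.swap)
  also have "\<dots> = (\<Sum>i\<in>UNIV. \<Sum>j\<in>UNIV - {i}. real (if l < 2 then 0 else (CARD('n) - 2) choose (l - 2)) * x i j)"
  proof (intro sum.cong refl)
    fix i j :: 'n assume "j \<in> UNIV - {i}"
    then have c2: "card {i, j} = 2" by auto
    have "(\<Sum>B | card B = l. if {i, j} \<subseteq> B then x i j else 0) = real (card {B. card B = l \<and> {i, j} \<subseteq> B}) * x i j"
      by (simp add: sum.If_cases Int_def)
    then show "(\<Sum>B | card B = l. if {i, j} \<subseteq> B then x i j else 0) = real (if l < 2 then 0 else (CARD('n) - 2) choose (l - 2)) * x i j"
      by (simp only: card_supersets c2)
  qed
  finally show ?thesis by (simp add: sum_distrib_left)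
qed

text \<open>Each square lies in binom(n - 1, l - 1) sets of size l and each mixed product in binom(n
  - 2, l - 2); the mixed products add up to 1 - T since the sum of a is 1. The outcome is affine in
  T, with the constant of the theorem as its slope.\<close>

lemma level_sum_identity:
  fixes a :: "'n::finite \<Rightarrow> real"
  assumes a1: "(\<Sum>i\<in>UNIV. a i) = 1" and n2: "CARD('n) \<ge> 2"
  shows "(\<Sum>B | card B = l. (\<Sum>i\<in>B. (a i)^2) - 2 / (real l + 1) * (\<Sum>i\<in>B. a i)^2)
    = real (CARD('n) + 1) / real (l + 1) * (if l < 2 then 0 else real ((CARD('n) - 2) choose (l - 2))) * (\<Sum>i\<in>UNIV. (a i)^2)
      - 2 / (real l + 1) * (if l < 2 then 0 else real ((CARD('n) - 2) choose (l - 2)))"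
proof -
  define T where "T = (\<Sum>i\<in>UNIV. (a i)^2)"
  define C1 where "C1 = real (if l < 1 then 0 else (CARD('n) - 1) choose (l - 1))"
  define C2 where "C2 = real (if l < 2 then 0 else (CARD('n) - 2) choose (l - 2))"
  have sq: "(\<Sum>i\<in>B. a i)^2 = (\<Sum>i\<in>B. (a i)^2) + (\<Sum>i\<in>B. \<Sum>j\<in>B - {i}. a i * a j)" for B :: "'n set"
  proof -
    have "(\<Sum>i\<in>B. a i)^2 = (\<Sum>i\<in>B. \<Sum>j\<in>B. a i * a j)" by (simp add: power2_eq_square sum_product)
    also have "\<dots> = (\<Sum>i\<in>B. a i * a i + (\<Sum>j\<in>B - {i}. a i * a j))"
      by (intro sum.cong refl sum.remove) auto
    finally show ?thesis by (simp add: sum.distrib power2_eq_square)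
  qed
  have off: "(\<Sum>i\<in>UNIV. \<Sum>j\<in>UNIV - {i}. a i * a j) = 1 - T" using sq[of UNIV] a1 by (simp add: T_def)
  have "(\<Sum>B | card B = l. (\<Sum>i\<in>B. (a i)^2) - 2 / (real l + 1) * (\<Sum>i\<in>B. a i)^2)
    = (\<Sum>B | card B = l. \<Sum>i\<in>B. (a i)^2)
      - 2 / (real l + 1) * ((\<Sum>B | card B = l. \<Sum>i\<in>B. (a i)^2) + (\<Sum>B | card B = l. \<Sum>i\<in>B. \<Sum>j\<in>B - {i}. a i * a j))"
    by (simp only: sq sum_subtractf sum_distrib_left[symmetric] sum.distrib)
  also have "\<dots> = C1 * T - 2 / (real l + 1) * (C1 * T + C2 * (1 - T))"
    unfolding sum_over_subsets sum_over_subsets2 off C1_def C2_def T_def by (rule refl)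
  also have "\<dots> = ((real l - 1) * C1 + 2 * C2) / (real l + 1) * T - 2 / (real l + 1) * C2"
  proof -
    have "C1 * T - 2 / L * (C1 * T + C2 * (1 - T)) = ((L - 2) * C1 + 2 * C2) / L * T - 2 / L * C2" if "L \<noteq> 0" for L
      using that by (simp add: field_simps)
    from this[of "real l + 1"] show ?thesis by simp
  qed
  \<comment> \<open>Absorption gives (l - 1) binom(n - 1, l - 1) = (n - 1) binom(n - 2, l - 2),
    whence the factor n - 1 + 2 = n + 1.\<close>
  also have "(real l - 1) * C1 + 2 * C2 = real (CARD('n) + 1) * C2"
  proof -
    have "(real l - 1) * C1 = (real CARD('n) - 1) * C2"
    proof -
      consider "l = 0" | "l = 1" | k where "l = k + 2" by (metis One_nat_def Suc_1 add.commute add_2_eq_Suc less_2_cases not_less le_Suc_ex)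
      then show ?thesis
      proof cases
        case 3
        have "Suc k * ((CARD('n) - 1) choose Suc k) = (CARD('n) - 1) * ((CARD('n) - 1 - 1) choose k)"
          by (rule binomial_absorption)
        then have "real (Suc k) * real ((CARD('n) - 1) choose Suc k) = real (CARD('n) - 1) * real ((CARD('n) - 1 - 1) choose k)"
          by (metis of_nat_mult)
        moreover have "l - 1 = Suc k" "l - 2 = k" "real l - 1 = real (Suc k)" "\<not> l < 1" "\<not> l < 2" "CARD('n) - 1 - 1 = CARD('n) - 2"
          "real (CARD('n) - 1) = real CARD('n) - 1"
          using 3 n2 by (auto simp: of_nat_diff)
        ultimately show ?thesis unfolding C1_def C2_def by simp
      qed (auto simp: C1_def C2_def)
    qed
    then show ?thesis by (simp add: algebra_simps)
  qed
  moreover have "C2 = (if l < 2 then 0 else real ((CARD('n) - 2) choose (l - 2)))" by (simp add: C2_def)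
  ultimately show ?thesis by (simp add: T_def[symmetric] add.commute)
qed

section \<open>Eigenvectors from the quartic function\<close>

context urep
begin

text \<open>For i in B the entry is a linear form in a random unit column over B, with fourth moment
  2/(m(m + 1)) times the fourth power of the length of the coefficient vector over B. The m such
  entries give 2/(m + 1). For i outside B nothing moves.\<close>

lemma quartic_average:
  fixes g :: "complex^'n^'n"
  shows "hI B (\<lambda>u. complex_of_real (\<Sum>i\<in>UNIV. cmod ((adjm u ** g)$i$p) ^ 4))
    = complex_of_real ((\<Sum>i\<in>-B. ((cmod (g$i$p))^2)^2) + 2 / (real (card B) + 1) * (\<Sum>i\<in>B. (cmod (g$i$p))^2)^2)"
proof -
  have ent: "cmod ((adjm u ** g)$i$p) = cmod (\<Sum>j\<in>UNIV. cnj (g$j$p) * u$j$i)" for u i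
  proof -
    have "(adjm u ** g)$i$p = cnj (\<Sum>j\<in>UNIV. cnj (g$j$p) * u$j$i)" by (simp add: matmul_nth mult.commute)
    then show ?thesis by (simp only: complex_mod_cnj)
  qed
  have each: "hI B (\<lambda>u. complex_of_real (cmod ((adjm u ** g)$i$p) ^ 4))
    = complex_of_real (if i \<in> B then (\<Sum>j\<in>B. (cmod (g$j$p))^2)^2 * (2 / (real (card B) * (real (card B) + 1))) else ((cmod (g$i$p))^2)^2)" for i
  proof (cases "i \<in> B")
    case True
    then show ?thesis
      using hI_abs_linear_power[OF True, of "\<lambda>j. cnj (g$j$p)" 2] by (simp add: ent mom_2)
  next
    case False
    have "hI B (\<lambda>u. complex_of_real (cmod ((adjm u ** g)$i$p) ^ 4)) = hI B (\<lambda>u. complex_of_real (((cmod (g$i$p))^2)^2))"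
    proof (rule hI_cong)
      fix u assume u: "u \<in> unitary_sub B"
      have "(adjm u ** g)$i$p = g$i$p"
        using unitary_sub_nth[OF u, of _ i] False
        by (simp add: matmul_nth if_distrib[of "\<lambda>x. x * _"] if_distrib[of cnj] cong: if_cong)
      then show "complex_of_real (cmod ((adjm u ** g)$i$p) ^ 4) = complex_of_real (((cmod (g$i$p))^2)^2)" by simp
    qed
    then show ?thesis using False by simp
  qed
  have "hI B (\<lambda>u. complex_of_real (\<Sum>i\<in>UNIV. cmod ((adjm u ** g)$i$p) ^ 4))
    = (\<Sum>i\<in>UNIV. hI B (\<lambda>u. complex_of_real (cmod ((adjm u ** g)$i$p) ^ 4)))"
    unfolding of_real_sum by (intro hI_sum continuous_intros)
  also have "\<dots> = complex_of_real (\<Sum>i\<in>UNIV. if i \<in> B then (\<Sum>j\<in>B. (cmod (g$j$p))^2)^2 * (2 / (real (card B) * (real (card B) + 1))) else ((cmod (g$i$p))^2)^2)"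
    by (simp only: each of_real_sum)
  also have "(\<Sum>i\<in>UNIV. if i \<in> B then (\<Sum>j\<in>B. (cmod (g$j$p))^2)^2 * (2 / (real (card B) * (real (card B) + 1))) else ((cmod (g$i$p))^2)^2)
    = real (card B) * ((\<Sum>j\<in>B. (cmod (g$j$p))^2)^2 * (2 / (real (card B) * (real (card B) + 1)))) + (\<Sum>i\<in>-B. ((cmod (g$i$p))^2)^2)"
    by (simp add: sum.If_cases)
  also have "real (card B) * ((\<Sum>j\<in>B. (cmod (g$j$p))^2)^2 * (2 / (real (card B) * (real (card B) + 1))))
    = 2 / (real (card B) + 1) * (\<Sum>j\<in>B. (cmod (g$j$p))^2)^2"
  proof (cases "B = {}")
    case False
    have "m * (X * (2 / (m * (m + 1)))) = 2 / (m + 1) * X" if "m \<noteq> 0" for m X :: real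
      using that by simp
    from this[of "real (card B)"] show ?thesis using False by simp
  qed simp
  finally show ?thesis by (simp add: add.commute)
qed

text \<open>The Laplacian acts on the density. Column p has squared moduli adding up to 1, so
  \<open>level_sum_identity\<close> shows that the density t becomes V t - K with a constant K, and
  the constant integrates to K times \<open>P UNIV y\<close>, which is 0.\<close>

lemma quartic_vector_eigen:
  fixes c :: "nat \<Rightarrow> real" and p :: 'n
  assumes inv: "\<And>x. x \<in> cvecs d \<Longrightarrow> P UNIV x = 0" and n2: "CARD('n) \<ge> 2" and y: "y \<in> cvecs d"
  defines "s \<equiv> (\<lambda>k. hI UNIV (\<lambda>g. complex_of_real (\<Sum>i\<in>UNIV. cmod (g$i$p) ^ 4) * R g y k))"
  shows "s \<in> cvecs d" and "mat_app d (laplacian (\<lambda>B. c (card B)) \<mu> d \<rho>) s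
    = sc (complex_of_real (\<Sum>l=0..CARD('n). c l * (real (CARD('n) + 1) / real (l + 1)) *
        (if l < 2 then 0 else real ((CARD('n) - 2) choose (l - 2))))) s"
proof -
  let ?t = "\<lambda>g::complex^'n^'n. \<Sum>i\<in>UNIV. cmod (g$i$p) ^ 4"
  let ?a = "\<lambda>(g::complex^'n^'n) i. (cmod (g$i$p))^2"
  show s_in: "s \<in> cvecs d" by (auto simp: s_def cvecs_def R_def mat_app_def)
  have ct: "continuous_on S (\<lambda>g. complex_of_real (?t g))" for S by (intro continuous_intros)
  have PBs: "P B s k = hI UNIV (\<lambda>g. complex_of_real ((\<Sum>i\<in>-B. (?a g i)^2) + 2 / (real (card B) + 1) * (\<Sum>i\<in>B. ?a g i)^2) * R g y k)" for B k
  proof -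
    have "P B s k = hI B (\<lambda>u. hI UNIV (\<lambda>g. complex_of_real (?t (adjm u ** g)) * R g y k))"
      unfolding P_def s_def using hI_convolve[OF ct] by (intro hI_cong) (simp add: unitary_subD)
    also have "\<dots> = hI UNIV (\<lambda>g. hI B (\<lambda>u. complex_of_real (?t (adjm u ** g)) * R g y k))"
    proof (rule hI_fubini)
      have "continuous_on (unitary_sub B \<times> unitary_sub UNIV) (\<lambda>z. R (snd z) y k)"
        by (rule continuous_on_compose2[OF R_continuous[of UNIV y k] continuous_on_snd[OF continuous_on_id]]) auto
      then show "continuous_on (unitary_sub B \<times> unitary_sub UNIV) (\<lambda>(u, g). complex_of_real (?t (adjm u ** g)) * R g y k)"
        unfolding case_prod_unfold by (intro continuous_intros)
    qed
    also have "\<dots> = hI UNIV (\<lambda>g. complex_of_real ((\<Sum>i\<in>-B. (?a g i)^2) + 2 / (real (card B) + 1) * (\<Sum>i\<in>B. ?a g i)^2) * R g y k)"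
      by (simp only: hI_mult_right quartic_average)
    finally show ?thesis .
  qed
  define V where "V = (\<Sum>l=0..CARD('n). c l * (real (CARD('n) + 1) / real (l + 1)) *
        (if l < 2 then 0 else real ((CARD('n) - 2) choose (l - 2))))"
  define K where "K = (\<Sum>l=0..CARD('n). c l * (2 / (real l + 1) * (if l < 2 then 0 else real ((CARD('n) - 2) choose (l - 2)))))"
  have point: "(\<Sum>B\<in>UNIV. c (card B) * (?t g - ((\<Sum>i\<in>-B. (?a g i)^2) + 2 / (real (card B) + 1) * (\<Sum>i\<in>B. ?a g i)^2))) = V * ?t g - K"
    if g: "g \<in> unitary_grp" for g
  proof -
    have t_eq: "?t g = (\<Sum>i\<in>UNIV. (?a g i)^2)" by simp
    have e: "?t g - ((\<Sum>i\<in>-B. (?a g i)^2) + 2 / (real (card B) + 1) * (\<Sum>i\<in>B. ?a g i)^2)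
        = (\<Sum>i\<in>B. (?a g i)^2) - 2 / (real (card B) + 1) * (\<Sum>i\<in>B. ?a g i)^2" for B
    proof -
      have "(\<Sum>i\<in>UNIV. (?a g i)^2) = (\<Sum>i\<in>B. (?a g i)^2) + (\<Sum>i\<in>-B. (?a g i)^2)"
        using sum.union_disjoint[of B "- B" "\<lambda>i. (?a g i)^2"] by (simp add: Compl_partition)
      then show ?thesis unfolding t_eq by simp
    qed
    have "(\<Sum>B\<in>UNIV. c (card B) * (?t g - ((\<Sum>i\<in>-B. (?a g i)^2) + 2 / (real (card B) + 1) * (\<Sum>i\<in>B. ?a g i)^2)))
      = (\<Sum>B\<in>UNIV. c (card B) * ((\<Sum>i\<in>B. (?a g i)^2) - 2 / (real (card B) + 1) * (\<Sum>i\<in>B. ?a g i)^2))"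
      by (simp only: e)
    also have "\<dots> = (\<Sum>l=0..CARD('n). \<Sum>B | card B = l. c l * ((\<Sum>i\<in>B. (?a g i)^2) - 2 / (real l + 1) * (\<Sum>i\<in>B. ?a g i)^2))"
      using sum_by_card[of "\<lambda>l B. c l * ((\<Sum>i\<in>B. (?a g i)^2) - 2 / (real l + 1) * (\<Sum>i\<in>B. ?a g i)^2)"] by simp
    also have "\<dots> = (\<Sum>l=0..CARD('n). c l * (real (CARD('n) + 1) / real (l + 1) * (if l < 2 then 0 else real ((CARD('n) - 2) choose (l - 2))) * (\<Sum>i\<in>UNIV. (?a g i)^2)
      - 2 / (real l + 1) * (if l < 2 then 0 else real ((CARD('n) - 2) choose (l - 2)))))"
      by (simp only: sum_distrib_left[symmetric] level_sum_identity[OF unitary_col[OF g] n2])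
    also have "\<dots> = V * (\<Sum>i\<in>UNIV. (?a g i)^2) - K"
      unfolding V_def K_def sum_distrib_right by (simp only: right_diff_distrib sum_subtractf mult.assoc)
    finally show ?thesis unfolding t_eq .
  qed
  have cc: "continuous_on (unitary_sub UNIV) (\<lambda>g. complex_of_real (f g) * R g y k)" if "continuous_on (unitary_sub UNIV) f" for f k
    by (intro continuous_intros that R_continuous)
  show "mat_app d (laplacian (\<lambda>B. c (card B)) \<mu> d \<rho>) s = sc (complex_of_real V) s"
  proof (rule ext)
    fix k
    have "mat_app d (laplacian (\<lambda>B. c (card B)) \<mu> d \<rho>) s k = (\<Sum>B\<in>UNIV. complex_of_real (c (card B)) * (s k - P B s k))"
      by (simp add: laplacian_app[OF s_in] sum_fun_nth)
    also have "\<dots> = (\<Sum>B\<in>UNIV. hI UNIV (\<lambda>g. complex_of_real (c (card B) * (?t g - ((\<Sum>i\<in>-B. (?a g i)^2) + 2 / (real (card B) + 1) * (\<Sum>i\<in>B. ?a g i)^2))) * R g y k))"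
    proof (rule sum.cong[OF refl])
      fix B :: "'n set"
      have "s k - P B s k = hI UNIV (\<lambda>g. complex_of_real (?t g) * R g y k
          - complex_of_real ((\<Sum>i\<in>-B. (?a g i)^2) + 2 / (real (card B) + 1) * (\<Sum>i\<in>B. ?a g i)^2) * R g y k)"
        unfolding PBs unfolding s_def by (rule hI_diff[symmetric]) (intro cc continuous_intros)+
      then show "complex_of_real (c (card B)) * (s k - P B s k)
        = hI UNIV (\<lambda>g. complex_of_real (c (card B) * (?t g - ((\<Sum>i\<in>-B. (?a g i)^2) + 2 / (real (card B) + 1) * (\<Sum>i\<in>B. ?a g i)^2))) * R g y k)"
        by (simp only: hI_mult_left[symmetric]) (intro hI_cong, simp only: of_real_mult of_real_diff mult.assoc left_diff_distrib)
    qed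
    also have "\<dots> = hI UNIV (\<lambda>g. \<Sum>B\<in>UNIV. complex_of_real (c (card B) * (?t g - ((\<Sum>i\<in>-B. (?a g i)^2) + 2 / (real (card B) + 1) * (\<Sum>i\<in>B. ?a g i)^2))) * R g y k)"
      by (rule hI_sum[symmetric]) (intro cc continuous_intros)
    also have "\<dots> = hI UNIV (\<lambda>g. complex_of_real V * (complex_of_real (?t g) * R g y k) - complex_of_real K * R g y k)"
    proof (rule hI_cong)
      fix g :: "complex^'n^'n" assume "g \<in> unitary_sub UNIV"
      then have eq: "(\<Sum>B\<in>UNIV. complex_of_real (c (card B) * (?t g - ((\<Sum>i\<in>-B. (?a g i)^2) + 2 / (real (card B) + 1) * (\<Sum>i\<in>B. ?a g i)^2)))) = complex_of_real (V * ?t g - K)"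
        using point[of g] by (simp only: of_real_sum[symmetric] unitary_sub_UNIV)
      show "(\<Sum>B\<in>UNIV. complex_of_real (c (card B) * (?t g - ((\<Sum>i\<in>-B. (?a g i)^2) + 2 / (real (card B) + 1) * (\<Sum>i\<in>B. ?a g i)^2))) * R g y k)
        = complex_of_real V * (complex_of_real (?t g) * R g y k) - complex_of_real K * R g y k"
        unfolding sum_distrib_right[symmetric] eq
        by (simp only: of_real_mult of_real_diff mult.assoc left_diff_distrib)
    qed
    also have "\<dots> = complex_of_real V * s k - complex_of_real K * P UNIV y k"
      unfolding s_def P_def by (subst hI_diff, (intro continuous_intros R_continuous)+) (simp only: hI_mult_left)
    also have "\<dots> = sc (complex_of_real V) s k" using inv[OF y] by simp
    finally show "mat_app d (laplacian (\<lambda>B. c (card B)) \<mu> d \<rho>) s k = sc (complex_of_real V) s k" .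
  qed
qed

end

section \<open>Polarisation of the quartic function\<close>

definition mix :: "'n::finite \<Rightarrow> 'n \<Rightarrow> complex \<Rightarrow> complex^'n^'n" where
  "mix p q w = (\<chi> i j. if i = p then (if j = p then of_real (1 / sqrt 2) else if j = q then of_real (1 / sqrt 2) * w else 0)
     else if i = q then (if j = p then of_real (1 / sqrt 2) else if j = q then - of_real (1 / sqrt 2) * w else 0)
     else if i = j then 1 else 0)"

text \<open>A Hadamard rotation: rows p and q become their normalised sum and difference after row q
  is multiplied by w.\<close>

lemma mix_mul_nth:
  assumes pq: "p \<noteq> q"
  shows "(mix p q w ** A)$p$j = of_real (1 / sqrt 2) * (A$p$j + w * A$q$j)"
    "(mix p q w ** A)$q$j = of_real (1 / sqrt 2) * (A$p$j - w * A$q$j)"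
    "i \<noteq> p \<Longrightarrow> i \<noteq> q \<Longrightarrow> (mix p q w ** A)$i$j = A$i$j"
proof -
  have red: "(\<Sum>k\<in>UNIV. mix p q w $ r $ k * A$k$j) = (\<Sum>k\<in>{p, q}. mix p q w $ r $ k * A$k$j)" if "r \<in> {p, q}" for r
    using that by (intro sum.mono_neutral_right) (auto simp: mix_def)
  show "(mix p q w ** A)$p$j = of_real (1 / sqrt 2) * (A$p$j + w * A$q$j)"
    unfolding matmul_nth using red[of p] pq by (simp add: mix_def algebra_simps)
  show "(mix p q w ** A)$q$j = of_real (1 / sqrt 2) * (A$p$j - w * A$q$j)"
    unfolding matmul_nth using red[of q] pq by (simp add: mix_def algebra_simps)
  show "(mix p q w ** A)$i$j = A$i$j" if "i \<noteq> p" "i \<noteq> q"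
    unfolding matmul_nth using that by (simp add: mix_def if_distrib[of "\<lambda>x. x * _"] cong: if_cong)
qed

lemma inv_sqrt2_sq: "complex_of_real (1 / sqrt 2) * complex_of_real (1 / sqrt 2) = 1 / 2"
  by (simp add: of_real_mult[symmetric] del: of_real_mult)

lemma mix_unitary:
  assumes pq: "p \<noteq> q" and w: "cmod w = 1"
  shows "mix p q w \<in> unitary_grp"
proof -
  let ?s = "complex_of_real (1 / sqrt 2)"
  have ww: "w * cnj w = 1" using cnj_mult_unit[OF w] by (simp add: mult.commute)
  have "(mix p q w ** adjm (mix p q w))$i$j = (if i = j then 1 else 0)" for i j
  proof -
    have ent: "mix p q w $ j $ p = (if j = p \<or> j = q then ?s else 0)"
      "mix p q w $ j $ q = (if j = p then ?s * w else if j = q then - ?s * w else 0)"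
      "i \<noteq> p \<Longrightarrow> i \<noteq> q \<Longrightarrow> mix p q w $ j $ i = (if j = i then 1 else 0)"
      using pq by (auto simp: mix_def)
    consider "i = p" | "i = q" | "i \<noteq> p" "i \<noteq> q" by blast
    then show ?thesis
    proof cases
      case 1
      have "(mix p q w ** adjm (mix p q w))$p$j = ?s * (cnj (mix p q w $ j $ p) + w * cnj (mix p q w $ j $ q))"
        unfolding mix_mul_nth[OF pq] by simp
      also have "\<dots> = (if p = j then ?s * ?s + ?s * ?s * (w * cnj w) else if q = j then ?s * ?s - ?s * ?s * (w * cnj w) else 0)"
        unfolding ent using pq by (auto simp: algebra_simps)
      finally show ?thesis using 1 unfolding ww inv_sqrt2_sq by simp
    next
      case 2
      have "(mix p q w ** adjm (mix p q w))$q$j = ?s * (cnj (mix p q w $ j $ p) - w * cnj (mix p q w $ j $ q))"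
        unfolding mix_mul_nth[OF pq] by simp
      also have "\<dots> = (if q = j then ?s * ?s + ?s * ?s * (w * cnj w) else if p = j then ?s * ?s - ?s * ?s * (w * cnj w) else 0)"
        unfolding ent using pq by (auto simp: algebra_simps)
      finally show ?thesis using 2 unfolding ww inv_sqrt2_sq by simp
    next
      case 3
      have "(mix p q w ** adjm (mix p q w))$i$j = adjm (mix p q w)$i$j" by (rule mix_mul_nth(3)[OF pq 3])
      also have "\<dots> = cnj (if j = i then 1 else 0)" unfolding ent(3)[OF 3, symmetric] by simp
      finally show ?thesis by auto
    qed
  qed
  then show ?thesis unfolding unitary_iff2 vec_eq_iff by (simp only: mat1_nth) blast
qed

text \<open>Each pair of squares has terms of degree 0, 2 and -2 in w. Passing to i w keeps degree 0
  and negates the other two, so the difference doubles the latter.\<close>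

lemma quartic_polarization:
  fixes a b a' b' w w' :: complex
  assumes "w * w' = 1"
  shows "((a + w * b) * (a' + w' * b'))^2 + ((a - w * b) * (a' - w' * b'))^2
    - (((a + \<i> * w * b) * (a' - \<i> * w' * b'))^2 + ((a - \<i> * w * b) * (a' + \<i> * w' * b'))^2)
    = 4 * ((a * b')^2 * w'^2 + (a' * b)^2 * w^2)"
proof -
  have id: "((a + x) * (a' + y))^2 + ((a - x) * (a' - y))^2
    - (((a + j * x) * (a' - j * y))^2 + ((a - j * x) * (a' + j * y))^2)
    = 4 * ((a * y)^2 + (a' * x)^2)" if "j * j = -1" for j x y :: complex
    using that by algebra
  show ?thesis
    using id[of \<i> "w * b" "w' * b'"] by (simp add: power_mult_distrib mult_ac)
qed

text \<open>Summation over the fourth roots of unity keeps the terms whose degree in the root is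
  divisible by 4. After the prefactor these are one of degree 0 and one of degree -4.\<close>

lemma fourth_root_extraction:
  fixes al be ga de e f :: complex
  shows "(\<Sum>z\<leftarrow>[(1, 1), (\<i>, - \<i>), (- 1, - 1), (- \<i>, \<i>)]. (snd z * f)^2 * ((al + snd z * f * be)^2 * (ga + fst z * e * de)^2))
    = 4 * ((e * f)^2 * (al^2 * de^2) + f^4 * (be^2 * ga^2))"
proof -
  have id: "f^2 * ((al + f * be)^2 * (ga + e * de)^2) + ((- j * f)^2 * ((al + - j * f * be)^2 * (ga + j * e * de)^2)
    + ((- 1 * f)^2 * ((al + - 1 * f * be)^2 * (ga + - 1 * e * de)^2) + (j * f)^2 * ((al + j * f * be)^2 * (ga + - j * e * de)^2)))
    = 4 * ((e * f)^2 * (al^2 * de^2) + f^4 * (be^2 * ga^2))" if "j * j = -1" for j :: complex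
    using that by algebra
  show ?thesis using id[of \<i>] by simp
qed

context hw_rep
begin

text \<open>The functions in \<open>null\<close> integrate to 0 against F and form a vector space.
  If every quartic vector were 0, this space would contain all two-sided translates of t, hence cnj
  F, although the integral of |F|^2 is positive.\<close>

lemma quartic_vector_nonzero:
  assumes coeff: "\<And>g. g \<in> unitary_grp \<Longrightarrow> H v (R g v) = C * ((g$p$p)^2 * (cnj (g$q$q))^2)"
    and C: "C \<noteq> 0" and pq: "p \<noteq> q"
  shows "\<exists>y\<in>cvecs d. (\<lambda>k. hI UNIV (\<lambda>g. complex_of_real (\<Sum>i\<in>UNIV. cmod (g$i$p) ^ 4) * R g y k)) \<noteq> 0"
proof (rule ccontr)
  assume "\<not> ?thesis"
  then have zero: "(\<lambda>k. hI UNIV (\<lambda>g. complex_of_real (\<Sum>i\<in>UNIV. cmod (g$i$p) ^ 4) * R g y k)) = 0" if "y \<in> cvecs d" for y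
    using that by blast
  define F where "F = (\<lambda>g::((complex,'n) vec,'n) vec. (g$p$p)^2 * (cnj (g$q$q))^2)"
  define t where "t = (\<lambda>g::((complex,'n) vec,'n) vec. complex_of_real (\<Sum>i\<in>UNIV. cmod (g$i$p) ^ 4))"
  have ct: "continuous_on S t" for S unfolding t_def by (intro continuous_intros)
  have cF: "continuous_on S F" for S unfolding F_def by (intro continuous_intros)
  define null where "null = (\<lambda>f. continuous_on unitary_grp f \<and> hI UNIV (\<lambda>g. f g * F g) = 0)"
  have null_add: "null (\<lambda>g. f g + f' g)" if "null f" "null f'" for f f'
    using that hI_add[of UNIV "\<lambda>g. f g * F g" "\<lambda>g. f' g * F g"] cF
    unfolding null_def by (auto simp: distrib_right intro!: continuous_intros)
  have null_mult: "null (\<lambda>g. c * f g)" if "null f" for c f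
    using that unfolding null_def by (auto simp: mult.assoc hI_mult_left intro!: continuous_intros)
  have null_cong: "null f'" if "null f" "\<And>g. f g = f' g" for f f'
    using that by (metis ext)
  \<comment> \<open>After a change of variables, the integral of the translate against C F pairs
    \<open>R u v\<close> with the quartic vector of \<open>R (adjm u') v\<close>, which is 0 by
    assumption.\<close>
  have base: "null (\<lambda>g. t (u ** g ** u'))" if u: "u \<in> unitary_grp" and u': "u' \<in> unitary_grp" for u u'
  proof -
    define f where "f = (\<lambda>g. t g * H v (R (adjm u ** g ** adjm u') v))"
    have cR: "continuous_on (unitary_sub UNIV) (\<lambda>g. H v (R g v))"
      by (intro continuous_on_H R_continuous continuous_on_const)
    have cR2: "continuous_on (unitary_sub UNIV) (\<lambda>g. H v (R (adjm u ** g ** adjm u') v))"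
      by (rule continuous_on_compose2[OF cR])
        (use u u' in \<open>auto intro!: continuous_intros unitary_mul unitary_adj\<close>)
    have cf: "continuous_on (unitary_sub UNIV) f" unfolding f_def by (intro continuous_intros ct cR2)
    have hf: "hI UNIV f = H (R u v) (\<lambda>k. hI UNIV (\<lambda>g. t g * R g (R (adjm u') v) k))"
    proof -
      have "H (R u v) (\<lambda>k. hI UNIV (\<lambda>g. sc (t g) (R g (R (adjm u') v)) k)) = hI UNIV (\<lambda>g. H (R u v) (sc (t g) (R g (R (adjm u') v))))"
        by (rule H_hI) (simp, intro continuous_intros ct R_continuous[of UNIV, simplified])
      also have "\<dots> = hI UNIV f"
      proof (rule hI_cong)
        fix g :: "((complex,'n) vec,'n) vec" assume "g \<in> unitary_sub UNIV"
        then have g: "g \<in> unitary_grp" by simp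
        have "H (R u v) (R g (R (adjm u') v)) = H v (R (adjm u) (R g (R (adjm u') v)))"
          by (rule H_R_left[OF u]) simp
        also have "\<dots> = H v (R (adjm u ** g ** adjm u') v)"
          using u u' g by (simp add: R_mult unitary_mul unitary_adj)
        finally show "H (R u v) (sc (t g) (R g (R (adjm u') v))) = f g" by (simp add: f_def H_sc_right)
      qed
      finally show ?thesis by simp
    qed
    have z: "(\<lambda>k. hI UNIV (\<lambda>g. t g * R g (R (adjm u') v) k)) = 0" unfolding t_def by (rule zero) simp
    have f0: "hI UNIV f = 0" unfolding hf z by (rule H_zero_right)
    have fu: "continuous_on (unitary_sub UNIV) (\<lambda>g. f (u ** g))"
      using continuous_on_left_translate[OF cf] u by simp
    have "hI UNIV (\<lambda>g. f (u ** (g ** u'))) = hI UNIV (\<lambda>g. f (u ** g))"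
      using hI_right[OF fu] u' by simp
    also have "\<dots> = 0" using hI_left[OF cf] u f0 by simp
    also have "hI UNIV (\<lambda>g. f (u ** (g ** u'))) = hI UNIV (\<lambda>g. C * (t (u ** g ** u') * F g))"
    proof (rule hI_cong)
      fix g :: "((complex,'n) vec,'n) vec" assume "g \<in> unitary_sub UNIV"
      then have g: "g \<in> unitary_grp" by simp
      have "adjm u ** (u ** (g ** u')) ** adjm u' = g"
        using u u' by (simp add: adj_cancel_left adj_cancel_right)
      then show "f (u ** (g ** u')) = C * (t (u ** g ** u') * F g)"
        using coeff[OF g] by (simp add: f_def F_def matrix_mul_assoc)
    qed
    finally have "hI UNIV (\<lambda>g. t (u ** g ** u') * F g) = 0" using C by (simp add: hI_mult_left)
    moreover have "continuous_on unitary_grp (\<lambda>g. t (u ** g ** u'))"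
      by (rule continuous_on_compose2[OF ct[of UNIV]]) (auto intro!: continuous_intros)
    ultimately show ?thesis by (simp add: null_def)
  qed
  have t_sq: "t A = (\<Sum>i\<in>UNIV. (A$i$p * cnj (A$i$p))^2)" for A
  proof -
    have "complex_of_real (cmod z ^ 4) = (z * cnj z)^2" for z
      by (metis complex_norm_square of_real_power power_mult mult_2 numeral_Bit0)
    then show ?thesis by (simp only: t_def of_real_sum)
  qed
  let ?s = "complex_of_real (1 / sqrt 2)"
  have s4: "?s ^ 4 = 1/4" and cs: "cnj ?s = ?s"
  proof -
    have s2: "?s^2 = 1/2" using inv_sqrt2_sq by (simp only: power2_eq_square)
    have "?s ^ 4 = (?s^2)^2" by (simp only: power_mult[symmetric]) simp
    then show "?s ^ 4 = 1/4" unfolding s2 by (simp add: power2_eq_square)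
    show "cnj ?s = ?s" by (rule complex_cnj_complex_of_real)
  qed
  have t_mix: "t (mix p q w ** A) = (\<Sum>i\<in>UNIV - {p, q}. (A$i$p * cnj (A$i$p))^2)
      + 1/4 * (((A$p$p + w * A$q$p) * (cnj (A$p$p) + cnj w * cnj (A$q$p)))^2 + ((A$p$p - w * A$q$p) * (cnj (A$p$p) - cnj w * cnj (A$q$p)))^2)" for w A
  proof -
    have "t (mix p q w ** A) = (\<Sum>i\<in>UNIV - {p, q}. ((mix p q w ** A)$i$p * cnj ((mix p q w ** A)$i$p))^2)
        + (\<Sum>i\<in>{p, q}. ((mix p q w ** A)$i$p * cnj ((mix p q w ** A)$i$p))^2)"
      unfolding t_sq by (rule sum.subset_diff) auto
    also have "(\<Sum>i\<in>UNIV - {p, q}. ((mix p q w ** A)$i$p * cnj ((mix p q w ** A)$i$p))^2) = (\<Sum>i\<in>UNIV - {p, q}. (A$i$p * cnj (A$i$p))^2)"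
      by (intro sum.cong refl) (simp add: mix_mul_nth(3)[OF pq])
    also have "(\<Sum>i\<in>{p, q}. ((mix p q w ** A)$i$p * cnj ((mix p q w ** A)$i$p))^2)
      = ?s^4 * (((A$p$p + w * A$q$p) * (cnj (A$p$p) + cnj w * cnj (A$q$p)))^2 + ((A$p$p - w * A$q$p) * (cnj (A$p$p) - cnj w * cnj (A$q$p)))^2)"
    proof -
      have sq: "(?s * x * (?s * y))^2 = ?s^4 * (x * y)^2" for x y
        by (simp only: power2_eq_square power4_eq_xxxx mult_ac)
      have "(\<Sum>i\<in>{p, q}. ((mix p q w ** A)$i$p * cnj ((mix p q w ** A)$i$p))^2)
        = (?s * (A$p$p + w * A$q$p) * (?s * (cnj (A$p$p) + cnj w * cnj (A$q$p))))^2
        + (?s * (A$p$p - w * A$q$p) * (?s * (cnj (A$p$p) - cnj w * cnj (A$q$p))))^2"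
        using pq by (simp add: mix_mul_nth[OF pq])
      then show ?thesis unfolding sq by (simp only: distrib_left)
    qed
    finally show ?thesis unfolding s4 .
  qed
  have diff_mix: "t (mix p q w ** A) - t (mix p q (\<i> * w) ** A)
      = (A$p$p * cnj (A$q$p))^2 * (cnj w)^2 + (cnj (A$p$p) * A$q$p)^2 * w^2" if "cmod w = 1" for w A
  proof -
    have ww: "w * cnj w = 1" using cnj_mult_unit[OF that] by (simp add: mult.commute)
    show ?thesis unfolding t_mix
      using quartic_polarization[OF ww, of "A$p$p" "A$q$p" "cnj (A$p$p)" "cnj (A$q$p)"]
      by (simp add: algebra_simps)
  qed
  \<comment> \<open>A primitive eighth root of unity. Its square i separates the terms with w^2 from
    those with (cnj w)^2, which w = 1 does not; its fourth power -1 removes the unwanted term at the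
    end.\<close>
  define w8 where "w8 = cis (pi / 4)"
  have w8: "cmod w8 = 1" "w8^2 = \<i>" "(cnj w8)^2 = - \<i>"
    by (simp_all add: w8_def cis_cnj Complex.DeMoivre cis_minus_pi_half)
  have "(cnj w8)^4 = ((cnj w8)^2)^2" by (simp only: power_mult[symmetric]) simp
  then have w84: "(cnj w8)^4 = -1" unfolding w8 by simp
  have col: "null (\<lambda>g. (cnj ((g ** u)$p$p) * (g ** u)$q$p)^2)" if u: "u \<in> unitary_grp" for u
  proof -
    have m: "null (\<lambda>g. t (mix p q w ** (g ** u)))" if "cmod w = 1" for w
      using base[OF mix_unitary[OF pq that] u] by (simp add: matrix_mul_assoc)
    have d: "null (\<lambda>g. t (mix p q w ** (g ** u)) + (-1) * t (mix p q (\<i> * w) ** (g ** u)))" if w: "cmod w = 1" for w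
      by (intro null_add null_mult m) (use w in \<open>simp_all add: norm_mult\<close>)
    have "null (\<lambda>g. (1/2) * ((t (mix p q 1 ** (g ** u)) + (-1) * t (mix p q (\<i> * 1) ** (g ** u)))
        + (-\<i>) * (t (mix p q w8 ** (g ** u)) + (-1) * t (mix p q (\<i> * w8) ** (g ** u)))))"
      by (intro null_mult null_add d) (use w8 in simp_all)
    then show ?thesis
    proof (rule null_cong)
      fix g
      have e1: "t (mix p q 1 ** (g ** u)) + (-1) * t (mix p q (\<i> * 1) ** (g ** u))
        = ((g ** u)$p$p * cnj ((g ** u)$q$p))^2 + (cnj ((g ** u)$p$p) * (g ** u)$q$p)^2"
        using diff_mix[of 1 "g ** u"] by simp
      have e2: "t (mix p q w8 ** (g ** u)) + (-1) * t (mix p q (\<i> * w8) ** (g ** u))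
        = ((g ** u)$p$p * cnj ((g ** u)$q$p))^2 * (- \<i>) + (cnj ((g ** u)$p$p) * (g ** u)$q$p)^2 * \<i>"
        using diff_mix[of w8 "g ** u"] w8 by simp
      show "(1/2) * ((t (mix p q 1 ** (g ** u)) + (-1) * t (mix p q (\<i> * 1) ** (g ** u)))
        + (-\<i>) * (t (mix p q w8 ** (g ** u)) + (-1) * t (mix p q (\<i> * w8) ** (g ** u))))
        = (cnj ((g ** u)$p$p) * (g ** u)$q$p)^2"
        unfolding e1 e2 by (simp add: algebra_simps)
    qed
  qed
  \<comment> \<open>Rows have been treated by left translation; right translation now replaces
    column p by column p plus e times column q, up to normalisation.\<close>
  have eta: "null (\<lambda>g. (cnj (g$p$p) + cnj e * cnj (g$p$q))^2 * (g$q$p + e * g$q$q)^2)" if e: "cmod e = 1" for e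
  proof -
    have "cmod (cnj e) = 1" using e by simp
    then have u: "adjm (mix p q (cnj e)) \<in> unitary_grp" by (intro unitary_adj mix_unitary pq)
    have ent: "(g ** adjm (mix p q (cnj e)))$i$p = ?s * (g$i$p + e * g$i$q)" for g :: "((complex,'n) vec,'n) vec" and i
    proof -
      have "(g ** adjm (mix p q (cnj e)))$i$p = cnj ((mix p q (cnj e) ** adjm g)$p$i)"
        by (simp add: matmul_nth mult.commute)
      then show ?thesis by (simp add: mix_mul_nth(1)[OF pq])
    qed
    have "null (\<lambda>g. 4 * (cnj ((g ** adjm (mix p q (cnj e)))$p$p) * (g ** adjm (mix p q (cnj e)))$q$p)^2)"
      by (rule null_mult[OF col[OF u]])
    then show ?thesis
    proof (rule null_cong)
      fix g
      show "4 * (cnj ((g ** adjm (mix p q (cnj e)))$p$p) * (g ** adjm (mix p q (cnj e)))$q$p)^2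
        = (cnj (g$p$p) + cnj e * cnj (g$p$q))^2 * (g$q$p + e * g$q$q)^2" (is "4 * ?l = ?r")
      proof -
        have "?l = ?s^4 * ?r"
          unfolding ent by (simp only: complex_cnj_mult complex_cnj_add cs power2_eq_square power4_eq_xxxx mult_ac)
        then have "?l = 1/4 * ?r" unfolding s4 .
        then show ?thesis by (simp only:) simp
      qed
    qed
  qed
  \<comment> \<open>The phases e, i e, -e and -i e, combined as in
    \<open>fourth_root_extraction\<close>.\<close>
  have four: "null (\<lambda>g. 4 * ((cnj (g$p$p))^2 * (g$q$q)^2 + (cnj e)^4 * ((cnj (g$p$q))^2 * (g$q$p)^2)))" if e: "cmod e = 1" for e
  proof -
    have ee: "e * cnj e = 1" using cnj_mult_unit[OF e] by (simp add: mult.commute)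
    have "null (\<lambda>g. (cnj e)^2 * ((cnj (g$p$p) + cnj e * cnj (g$p$q))^2 * (g$q$p + e * g$q$q)^2)
      + ((- \<i> * cnj e)^2 * ((cnj (g$p$p) + cnj (\<i> * e) * cnj (g$p$q))^2 * (g$q$p + (\<i> * e) * g$q$q)^2)
      + ((- 1 * cnj e)^2 * ((cnj (g$p$p) + cnj (- 1 * e) * cnj (g$p$q))^2 * (g$q$p + (- 1 * e) * g$q$q)^2)
      + (\<i> * cnj e)^2 * ((cnj (g$p$p) + cnj (- \<i> * e) * cnj (g$p$q))^2 * (g$q$p + (- \<i> * e) * g$q$q)^2))))"
      by (intro null_add null_mult eta) (use e in \<open>simp_all add: norm_mult\<close>)
    then show ?thesis
    proof (rule null_cong)
      fix g
      show "(cnj e)^2 * ((cnj (g$p$p) + cnj e * cnj (g$p$q))^2 * (g$q$p + e * g$q$q)^2)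
      + ((- \<i> * cnj e)^2 * ((cnj (g$p$p) + cnj (\<i> * e) * cnj (g$p$q))^2 * (g$q$p + (\<i> * e) * g$q$q)^2)
      + ((- 1 * cnj e)^2 * ((cnj (g$p$p) + cnj (- 1 * e) * cnj (g$p$q))^2 * (g$q$p + (- 1 * e) * g$q$q)^2)
      + (\<i> * cnj e)^2 * ((cnj (g$p$p) + cnj (- \<i> * e) * cnj (g$p$q))^2 * (g$q$p + (- \<i> * e) * g$q$q)^2)))
      = 4 * ((cnj (g$p$p))^2 * (g$q$q)^2 + (cnj e)^4 * ((cnj (g$p$q))^2 * (g$q$p)^2))"
        using fourth_root_extraction[of "cnj e" "cnj (g$p$p)" "cnj (g$p$q)" "g$q$p" e "g$q$q"]
        unfolding ee by (simp add: mult_ac)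
    qed
  qed
  \<comment> \<open>At e = 1 and e = w8 the fourth powers are 1 and -1, so the second term cancels
    and 2 * 4 copies of the first remain.\<close>
  have "null (\<lambda>g. (1/8) * (4 * ((cnj (g$p$p))^2 * (g$q$q)^2 + (cnj 1)^4 * ((cnj (g$p$q))^2 * (g$q$p)^2))
      + 4 * ((cnj (g$p$p))^2 * (g$q$q)^2 + (cnj w8)^4 * ((cnj (g$p$q))^2 * (g$q$p)^2))))"
    by (intro null_mult null_add four) (use w8 in simp_all)
  then have "null (\<lambda>g. cnj (F g))"
    by (rule null_cong) (simp add: w84 F_def algebra_simps)
  then have "hI UNIV (\<lambda>g. cnj (F g) * F g) = 0" by (simp add: null_def)
  moreover have "Re (hI UNIV (\<lambda>g. cnj (F g) * F g)) > 0"
  proof (rule hI_pos)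
    show "0 < Re (cnj (F (mat 1)) * F (mat 1))" by (simp add: F_def mat_def)
    show "0 \<le> Re (cnj (F A) * F A)" for A
      by (simp add: mult.commute[of "cnj (F A)"] complex_mult_cnj)
  qed (auto intro!: continuous_intros cF)
  ultimately show False by simp
qed

end

text \<open>Irreducibility enters through differentiability of the matrix entries, from which the
  Lie algebra action is built.\<close>

lemma irrep_hw_rep:
  fixes \<mu> :: "'n::{finite,linorder} set \<Rightarrow> ((complex,'n) vec,'n) vec measure"
  assumes haar: "haar_family \<mu>" and irr: "is_irrep d \<rho>" and hw: "has_highest_weight d \<rho> wt"
  shows "\<exists>h D v. hw_rep \<mu> d h \<rho> D v wt"
proof -
  interpret haar_family \<mu> by (rule haar)
  have rep: "is_rep d \<rho>" using irr by (simp add: is_irrep_def)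
  obtain h where "urep \<mu> d h \<rho>" using rep_unitarizable[OF rep] by blast
  then interpret U: urep \<mu> d h \<rho> .
  obtain D where D: "\<And>X Y i j. D (X + Y) i j = D X i j + D Y i j" "\<And>z X i j. D (csm z X) i j = z * D X i j"
    "\<And>a i j. cin a a = 1 \<Longrightarrow> i < d \<Longrightarrow> j < d \<Longrightarrow>
      ((\<lambda>t. \<rho> (refl_mat a (cis t)) i j) has_vector_derivative (\<i> * D (outer a a) i j)) (at 0)"
    using smooth_rep_imp_lie[of d \<rho>, OF U.irrep_smooth[OF irr]] by blast
  interpret L: lie_rep \<mu> d h \<rho> D by unfold_locales (use D in auto)
  obtain v where v: "L.wtv wt v"
    using hw L.is_weight_iff unfolding has_highest_weight_def by blast
  have "hw_rep \<mu> d h \<rho> D v wt"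
    using v hw by unfold_locales (auto simp: has_highest_weight_def)
  then show ?thesis by blast
qed

theorem theorem1p4:
  fixes c :: "nat \<Rightarrow> real"
    and \<mu> :: "'n::{finite,linorder} set \<Rightarrow> ((complex,'n) vec,'n) vec measure"
  assumes n2: "CARD('n) \<ge> 2"
    and c_nonneg: "\<forall>l\<le>CARD('n). c l \<ge> 0"
    and haar: "\<forall>B. is_haar_prob B (\<mu> B)"
  shows "(\<forall>d \<rho>. is_irrep d \<rho> \<and> \<not> is_trivial_rep d \<rho> \<longrightarrow>
            lambda_min (\<lambda>B. c (card B)) \<mu> d \<rho> \<ge>
              (\<Sum>l=0..CARD('n). c l * (real (CARD('n) + 1) / real (l + 1)) *
                 (if l < 2 then 0 else real ((CARD('n) - 2) choose (l - 2))))) \<and>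
         (\<exists>d (\<rho>::((complex,'n) vec,'n) vec \<Rightarrow> nat \<Rightarrow> nat \<Rightarrow> complex). is_irrep d \<rho> \<and> has_highest_weight d \<rho> weight_2m2) \<and>
         (\<forall>d \<rho>. is_irrep d \<rho> \<and> has_highest_weight d \<rho> weight_2m2 \<longrightarrow>
            lambda_min (\<lambda>B. c (card B)) \<mu> d \<rho> =
              (\<Sum>l=0..CARD('n). c l * (real (CARD('n) + 1) / real (l + 1)) *
                 (if l < 2 then 0 else real ((CARD('n) - 2) choose (l - 2)))))"
proof (intro conjI allI impI)
  have haar': "haar_family \<mu>" using haar by unfold_locales blast
  then interpret haar_family \<mu> .
  let ?V = "\<Sum>l=0..CARD('n). c l * (real (CARD('n) + 1) / real (l + 1)) *
                 (if l < 2 then 0 else real ((CARD('n) - 2) choose (l - 2)))"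
  let ?p = "Min UNIV :: 'n" and ?q = "Max UNIV :: 'n"
  show low: "?V \<le> lambda_min (\<lambda>B. c (card B)) \<mu> d \<rho>" if "is_irrep d \<rho> \<and> \<not> is_trivial_rep d \<rho>" for d \<rho>
    using lambda_min_lower[of d \<rho> c] that c_nonneg by blast
  obtain d0 h0 \<rho>0 D0 v0 where T: "hw_rep \<mu> d0 h0 \<rho>0 D0 v0 weight_2m2" "herm_form.H d0 h0 v0 v0 = 1"
    "\<forall>g\<in>unitary_grp. herm_form.H d0 h0 v0 (mat_app d0 (\<rho>0 g) v0) = (g$?p$?p)^2 * (cnj (g$?q$?q))^2"
    using tensor_rep_highest_weight[OF haar' n2] by blast
  interpret T: hw_rep \<mu> d0 h0 \<rho>0 D0 v0 weight_2m2 by (rule T)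
  have "has_highest_weight d0 \<rho>0 weight_2m2"
    unfolding has_highest_weight_def using T.v T.dom T.is_weight_iff by blast
  then show "\<exists>d (\<rho>::((complex,'n) vec,'n) vec \<Rightarrow> nat \<Rightarrow> nat \<Rightarrow> complex). is_irrep d \<rho> \<and> has_highest_weight d \<rho> weight_2m2"
    by (rule highest_weight_irrep_exists[OF haar' T.rep])
  fix d :: nat and \<rho> :: "((complex,'n) vec,'n) vec \<Rightarrow> nat \<Rightarrow> nat \<Rightarrow> complex"
  assume "is_irrep d \<rho> \<and> has_highest_weight d \<rho> weight_2m2"
  then have irr: "is_irrep d \<rho>" and hw: "has_highest_weight d \<rho> weight_2m2" by auto
  have rep: "is_rep d \<rho>" using irr by (simp add: is_irrep_def)
  obtain h D v where A: "hw_rep \<mu> d h \<rho> D v weight_2m2"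
    using irrep_hw_rep[OF haar' irr hw] by blast
  interpret A: hw_rep \<mu> d h \<rho> D v weight_2m2 by (rule A)
  note pq = Min_neq_Max[OF n2]
  \<comment> \<open>The weight is that of the tensor model, so uniqueness transfers the explicit
    coefficient, rescaled because only \<open>v0\<close> is known to have length 1.\<close>
  have coeff: "A.H v (A.R g v) = A.H v v * ((g$?p$?p)^2 * (cnj (g$?q$?q))^2)" if g: "g \<in> unitary_grp" for g
    using highest_weight_coefficient_unique[OF A T(1) g] T(2,3) g by (simp add: A.R_def mult.commute)
  have "A.H v v \<noteq> 0" using A.H_eq_0_iff[OF A.v_in] A.v_nz by simp
  then obtain y where y: "y \<in> cvecs d"
    "(\<lambda>k. hI UNIV (\<lambda>g. complex_of_real (\<Sum>i\<in>UNIV. cmod (g$i$?p) ^ 4) * A.R g y k)) \<noteq> 0"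
    using A.quartic_vector_nonzero[OF coeff _ pq] by blast
  \<comment> \<open>In a trivial representation the coefficient would be constant, but the
    transposition of the first and last index annihilates it.\<close>
  have nt: "\<not> is_trivial_rep d \<rho>"
  proof
    assume "is_trivial_rep d \<rho>"
    then have coeff_one: "A.R g v = v" if "g \<in> unitary_grp" for g
      using that A.R_one[OF A.v_in] rep unfolding is_trivial_rep_def A.R_def is_rep_def by simp
    have "A.H v v * ((swp ?p ?q $?p$?p)^2 * (cnj (swp ?p ?q $?q$?q))^2) = A.H v v"
      using coeff[OF swp_unitary] coeff_one[OF swp_unitary] by metis
    moreover have "swp ?p ?q $?p$?p = 0" using pq by (simp add: swp_def)
    ultimately show False using \<open>A.H v v \<noteq> 0\<close> by simp
  qed
  let ?L = "laplacian (\<lambda>B. c (card B)) \<mu> d \<rho>"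
  have "is_eigenvalue d ?L (complex_of_real ?V)"
    unfolding eigenvalue_iff
    using A.quartic_vector_eigen(1)[OF A.irrep_no_invariants[OF irr nt] n2 y(1), where p = ?p]
      A.quartic_vector_eigen(2)[OF A.irrep_no_invariants[OF irr nt] n2 y(1), where p = ?p and c = c] y(2) by blast
  moreover have "finite {x::real. is_eigenvalue d ?L (complex_of_real x)}"
    by (rule A.finite_real_eigenvalues[OF A.laplacian_self_adjoint])
  ultimately have "lambda_min (\<lambda>B. c (card B)) \<mu> d \<rho> \<le> ?V"
    unfolding lambda_min_def by (intro Min_le) auto
  then show "lambda_min (\<lambda>B. c (card B)) \<mu> d \<rho> = ?V" using low[of d \<rho>] irr nt by simp
qed

end
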